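(* Let $\mathcal{L}$ be a clan-algebraic category and let $J:\mathfrak{C}(\mathcal{L})\hookrightarrow\mathcal{L}$ be the inclusion of the full subcategory of compact 0-extensions. Then the nerve functor $J_N:\mathcal{L}\to\mathfrak{C}(\mathcal{L})^{\mathsf{op}}\text{-}\mathsf{Mod}$, $J_N(X)=\mathcal{L}(J(-),X)$, is an equivalence of categories.
   Context: An $(\mathsf{E},\mathsf{F})$-category is a locally finitely presentable category $\mathcal{L}$ with a weak factorization system $(\mathsf{E},\mathsf{F})$, whose left maps are called extensions and right maps full maps. A 0-extension is an object $A$ such that $0\to A$ is an extension; $\mathfrak{C}(\mathcal{L})\subseteq\mathcal{L}$ is the full subcategory on compact (= finitely presentable) 0-extensions (essentially small; treat it as small by choosing an equivalent small category). $\mathcal{L}$ is clan-algebraic if: (D) the inclusion $J:\mathfrak{C}(\mathcal{L})\hookrightarrow\mathcal{L}$ is dense; (CG) $(\mathsf{E},\mathsf{F})$ is cofibrantly generated by the extensions between objects of $\mathfrak{C}(\mathcal{L})$; (FQ) every equivalence relation $\langle p,q\rangle:R\rightarrowtail A\times A$ in $\mathcal{L}$ with $p,q$ full is effective (i.e. is the kernel pair of its coequalizer) and has full coequalizer. A clan is a small category with a class of display maps, closed under composition, containing isomorphisms, such that pullbacks of display maps along arbitrary maps exist and are display maps, and such that there is a terminal object and all maps to it are display maps. A model of a clan $\mathcal{T}$ is a functor $\mathcal{T}\to\mathsf{Set}$ preserving the terminal object and pullbacks of display maps; $\mathcal{T}\text{-}\mathsf{Mod}\subseteq[\mathcal{T},\mathsf{Set}]$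 is the full subcategory on models. $\mathfrak{C}(\mathcal{L})^{\mathsf{op}}$ is a clan whose display maps are the opposites of extensions; thus its models are the functors $\mathfrak{C}(\mathcal{L})^{\mathsf{op}}\to\mathsf{Set}$ sending $0$ to $1$ and pushouts of extensions in $\mathfrak{C}(\mathcal{L})$ to pullbacks. *)

theory Defs
  imports "HOL-Library.FuncSet"
begin

unbundle cardinal_syntax

section \<open>Categories and functors\<close>

record ('o, 'a) cat =
  obj :: "'o set"
  arr :: "'a set"
  src :: "'a \<Rightarrow> 'o"
  tgt :: "'a \<Rightarrow> 'o"
  ide :: "'o \<Rightarrow> 'a"
  cmp :: "'a \<Rightarrow> 'a \<Rightarrow> 'a"  (infixr "\<cdot>\<index>" 70)

definition hom :: "('o, 'a) cat \<Rightarrow> 'o \<Rightarrow> 'o \<Rightarrow> 'a set" where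
  "hom C A B = {f \<in> arr C. src C f = A \<and> tgt C f = B}"

locale category =
  fixes C :: "('o, 'a) cat" (structure)
  assumes src_obj: "f \<in> arr C \<Longrightarrow> src C f \<in> obj C"
    and tgt_obj: "f \<in> arr C \<Longrightarrow> tgt C f \<in> obj C"
    and ide_hom: "A \<in> obj C \<Longrightarrow> ide C A \<in> hom C A A"
    and cmp_hom: "f \<in> hom C A B \<Longrightarrow> g \<in> hom C B D \<Longrightarrow> g \<cdot> f \<in> hom C A D"
    and cmp_ide: "f \<in> hom C A B \<Longrightarrow> f \<cdot> ide C A = f"
    and ide_cmp: "f \<in> hom C A B \<Longrightarrow> ide C B \<cdot> f = f"
    and assoc: "f \<in> hom C A B \<Longrightarrow> g \<in> hom C B D \<Longrightarrow> h \<in> hom C D E \<Longrightarrow> (h \<cdot> g) \<cdot> f = h \<cdot> (g \<cdot> f)"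

definition op :: "('o, 'a) cat \<Rightarrow> ('o, 'a) cat" where
  "op C = \<lparr>obj = obj C, arr = arr C, src = tgt C, tgt = src C, ide = ide C,
           cmp = (\<lambda>g f. f \<cdot>\<^bsub>C\<^esub> g)\<rparr>"

definition full_sub :: "('o, 'a) cat \<Rightarrow> 'o set \<Rightarrow> ('o, 'a) cat" where
  "full_sub C S = C\<lparr>obj := S, arr := {f \<in> arr C. src C f \<in> S \<and> tgt C f \<in> S}\<rparr>"

record ('o, 'a, 'p, 'b) fctr =
  omap :: "'o \<Rightarrow> 'p"
  amap :: "'a \<Rightarrow> 'b"

text \<open>Functors and natural transformations are extensional (fixed to \<open>undefined\<close> outside their
  domain), so that equality of them is equality on the domain category.\<close>

definition is_functor :: "('o, 'a) cat \<Rightarrow> ('p, 'b) cat \<Rightarrow> ('o, 'a, 'p, 'b) fctr \<Rightarrow> bool" where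
  "is_functor C D F \<longleftrightarrow>
     omap F \<in> obj C \<rightarrow>\<^sub>E obj D \<and> amap F \<in> arr C \<rightarrow>\<^sub>E arr D \<and>
     (\<forall>f \<in> arr C. src D (amap F f) = omap F (src C f) \<and> tgt D (amap F f) = omap F (tgt C f)) \<and>
     (\<forall>A \<in> obj C. amap F (ide C A) = ide D (omap F A)) \<and>
     (\<forall>f \<in> arr C. \<forall>g \<in> arr C. tgt C f = src C g \<longrightarrow>
        amap F (g \<cdot>\<^bsub>C\<^esub> f) = amap F g \<cdot>\<^bsub>D\<^esub> amap F f)"

definition id_fctr :: "('o, 'a) cat \<Rightarrow> ('o, 'a, 'o, 'a) fctr" where
  "id_fctr C = \<lparr>omap = restrict id (obj C), amap = restrict id (arr C)\<rparr>"

text \<open>\<open>fcomp C G F\<close> is the composite \<open>G \<circ> F\<close> of functors, where \<open>F\<close> has domain \<open>C\<close>.\<close>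

definition fcomp :: "('o, 'a) cat \<Rightarrow> ('p, 'b, 'q, 'c) fctr \<Rightarrow> ('o, 'a, 'p, 'b) fctr \<Rightarrow> ('o, 'a, 'q, 'c) fctr" where
  "fcomp C G F = \<lparr>omap = (\<lambda>A \<in> obj C. omap G (omap F A)),
                  amap = (\<lambda>f \<in> arr C. amap G (amap F f))\<rparr>"

definition nat_trans ::
    "('o, 'a) cat \<Rightarrow> ('p, 'b) cat \<Rightarrow> ('o, 'a, 'p, 'b) fctr \<Rightarrow> ('o, 'a, 'p, 'b) fctr \<Rightarrow> ('o \<Rightarrow> 'b) \<Rightarrow> bool" where
  "nat_trans C D F G \<eta> \<longleftrightarrow>
     \<eta> \<in> extensional (obj C) \<and>
     (\<forall>A \<in> obj C. \<eta> A \<in> hom D (omap F A) (omap G A)) \<and>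
     (\<forall>f \<in> arr C. \<eta> (tgt C f) \<cdot>\<^bsub>D\<^esub> amap F f = amap G f \<cdot>\<^bsub>D\<^esub> \<eta> (src C f))"

definition functor_cat ::
    "('o, 'a) cat \<Rightarrow> ('p, 'b) cat \<Rightarrow>
     (('o, 'a, 'p, 'b) fctr, ('o, 'a, 'p, 'b) fctr \<times> ('o, 'a, 'p, 'b) fctr \<times> ('o \<Rightarrow> 'b)) cat" where
  "functor_cat C D =
     \<lparr>obj = {F. is_functor C D F},
      arr = {(F, G, \<eta>). is_functor C D F \<and> is_functor C D G \<and> nat_trans C D F G \<eta>},
      src = (\<lambda>(F, G, \<eta>). F),
      tgt = (\<lambda>(F, G, \<eta>). G),
      ide = (\<lambda>F. (F, F, \<lambda>A \<in> obj C. ide D (omap F A))),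
      cmp = (\<lambda>(G', H, \<theta>) (F, G, \<eta>). (F, H, \<lambda>A \<in> obj C. \<theta> A \<cdot>\<^bsub>D\<^esub> \<eta> A))\<rparr>"

definition is_iso :: "('o, 'a) cat \<Rightarrow> 'a \<Rightarrow> bool" where
  "is_iso C f \<longleftrightarrow> f \<in> arr C \<and>
     (\<exists>g \<in> hom C (tgt C f) (src C f). g \<cdot>\<^bsub>C\<^esub> f = ide C (src C f) \<and> f \<cdot>\<^bsub>C\<^esub> g = ide C (tgt C f))"

definition isomorphic :: "('o, 'a) cat \<Rightarrow> 'o \<Rightarrow> 'o \<Rightarrow> bool" where
  "isomorphic C A B \<longleftrightarrow> (\<exists>f \<in> hom C A B. is_iso C f)"

definition naturally_isomorphic ::
    "('o, 'a) cat \<Rightarrow> ('p, 'b) cat \<Rightarrow> ('o, 'a, 'p, 'b) fctr \<Rightarrow> ('o, 'a, 'p, 'b) fctr \<Rightarrow> bool" where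
  "naturally_isomorphic C D F G \<longleftrightarrow>
     (\<exists>\<eta>. nat_trans C D F G \<eta> \<and> (\<forall>A \<in> obj C. is_iso D (\<eta> A)))"

definition is_equivalence :: "('o, 'a) cat \<Rightarrow> ('p, 'b) cat \<Rightarrow> ('o, 'a, 'p, 'b) fctr \<Rightarrow> bool" where
  "is_equivalence C D F \<longleftrightarrow> is_functor C D F \<and>
     (\<exists>G. is_functor D C G \<and>
          naturally_isomorphic C C (id_fctr C) (fcomp C G F) \<and>
          naturally_isomorphic D D (fcomp D F G) (id_fctr D))"


section \<open>Limits and colimits\<close>

definition initial :: "('o, 'a) cat \<Rightarrow> 'o \<Rightarrow> bool" where
  "initial C I \<longleftrightarrow> I \<in> obj C \<and> (\<forall>A \<in> obj C. \<exists>!f. f \<in> hom C I A)"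

definition terminal :: "('o, 'a) cat \<Rightarrow> 'o \<Rightarrow> bool" where
  "terminal C T \<longleftrightarrow> T \<in> obj C \<and> (\<forall>A \<in> obj C. \<exists>!f. f \<in> hom C A T)"

text \<open>\<open>pullback C f g p q\<close>: the square \<open>f \<cdot> p = g \<cdot> q\<close> is a pullback.\<close>

definition pullback :: "('o, 'a) cat \<Rightarrow> 'a \<Rightarrow> 'a \<Rightarrow> 'a \<Rightarrow> 'a \<Rightarrow> bool" where
  "pullback C f g p q \<longleftrightarrow>
     f \<in> arr C \<and> g \<in> arr C \<and> p \<in> arr C \<and> q \<in> arr C \<and> tgt C f = tgt C g \<and>
     src C p = src C q \<and> tgt C p = src C f \<and> tgt C q = src C g \<and> f \<cdot>\<^bsub>C\<^esub> p = g \<cdot>\<^bsub>C\<^esub> q \<and>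
     (\<forall>X \<in> obj C. \<forall>u \<in> hom C X (src C f). \<forall>v \<in> hom C X (src C g).
        f \<cdot>\<^bsub>C\<^esub> u = g \<cdot>\<^bsub>C\<^esub> v \<longrightarrow>
        (\<exists>!h. h \<in> hom C X (src C p) \<and> p \<cdot>\<^bsub>C\<^esub> h = u \<and> q \<cdot>\<^bsub>C\<^esub> h = v))"

definition coequalizer :: "('o, 'a) cat \<Rightarrow> 'a \<Rightarrow> 'a \<Rightarrow> 'a \<Rightarrow> bool" where
  "coequalizer C p q c \<longleftrightarrow>
     p \<in> arr C \<and> q \<in> arr C \<and> c \<in> arr C \<and> src C p = src C q \<and> tgt C p = tgt C q \<and>
     src C c = tgt C p \<and> c \<cdot>\<^bsub>C\<^esub> p = c \<cdot>\<^bsub>C\<^esub> q \<and>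
     (\<forall>d \<in> arr C. src C d = tgt C p \<and> d \<cdot>\<^bsub>C\<^esub> p = d \<cdot>\<^bsub>C\<^esub> q \<longrightarrow>
        (\<exists>!h. h \<in> hom C (tgt C c) (tgt C d) \<and> h \<cdot>\<^bsub>C\<^esub> c = d))"

definition is_cocone ::
    "('j, 'i) cat \<Rightarrow> ('o, 'a) cat \<Rightarrow> ('j, 'i, 'o, 'a) fctr \<Rightarrow> 'o \<Rightarrow> ('j \<Rightarrow> 'a) \<Rightarrow> bool" where
  "is_cocone J C D X \<iota> \<longleftrightarrow> is_functor J C D \<and> X \<in> obj C \<and>
     (\<forall>j \<in> obj J. \<iota> j \<in> hom C (omap D j) X) \<and>
     (\<forall>u \<in> arr J. \<iota> (tgt J u) \<cdot>\<^bsub>C\<^esub> amap D u = \<iota> (src J u))"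

definition is_colimit ::
    "('j, 'i) cat \<Rightarrow> ('o, 'a) cat \<Rightarrow> ('j, 'i, 'o, 'a) fctr \<Rightarrow> 'o \<Rightarrow> ('j \<Rightarrow> 'a) \<Rightarrow> bool" where
  "is_colimit J C D X \<iota> \<longleftrightarrow> is_cocone J C D X \<iota> \<and>
     (\<forall>Y \<nu>. is_cocone J C D Y \<nu> \<longrightarrow>
        (\<exists>!h. h \<in> hom C X Y \<and> (\<forall>j \<in> obj J. h \<cdot>\<^bsub>C\<^esub> \<iota> j = \<nu> j)))"

definition filtered :: "('j, 'i) cat \<Rightarrow> bool" where
  "filtered J \<longleftrightarrow> category J \<and> obj J \<noteq> {} \<and>
     (\<forall>A \<in> obj J. \<forall>B \<in> obj J. \<exists>D \<in> obj J. hom J A D \<noteq> {} \<and> hom J B D \<noteq> {}) \<and>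
     (\<forall>A \<in> obj J. \<forall>B \<in> obj J. \<forall>f \<in> hom J A B. \<forall>g \<in> hom J A B.
        \<exists>h \<in> arr J. src J h = B \<and> h \<cdot>\<^bsub>J\<^esub> f = h \<cdot>\<^bsub>J\<^esub> g)"


section \<open>Smallness and the category of sets\<close>

text \<open>Smallness is relative to an uncountable inaccessible cardinal \<open>\<kappa>\<close>, which plays the role of a
  Grothendieck universe: a set is small if its cardinality is less than \<open>\<kappa>\<close>.

  Since \<open>\<kappa>\<close> is a relation on the type \<open>'u\<close>, every small set is equinumerous to a subset of \<open>'u\<close>,
  every small category is isomorphic to one of type \<open>('u, 'u) cat\<close>, and the category of small
  sets is equivalent to that of small subsets of \<open>'u\<close>. The arrows of the categories under study
  are taken in the same type \<open>'u\<close>, so that their hom-sets are objects of the latter; this is no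
  restriction, since arrows and \<open>\<kappa>\<close> can be transported along injections into a common type.\<close>

definition inaccessible :: "'u rel \<Rightarrow> bool" where
  "inaccessible \<kappa> \<longleftrightarrow> Card_order \<kappa> \<and> natLeq <o \<kappa> \<and> regularCard \<kappa> \<and>
     (\<forall>A :: 'u set. |A| <o \<kappa> \<longrightarrow> |Pow A| <o \<kappa>)"

definition small :: "'u rel \<Rightarrow> 'x set \<Rightarrow> bool" where
  "small \<kappa> A \<longleftrightarrow> |A| <o \<kappa>"

definition small_cat :: "'u rel \<Rightarrow> ('o, 'a) cat \<Rightarrow> bool" where
  "small_cat \<kappa> J \<longleftrightarrow> category J \<and> small \<kappa> (obj J) \<and> small \<kappa> (arr J)"

definition locally_small :: "'u rel \<Rightarrow> ('o, 'a) cat \<Rightarrow> bool" where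
  "locally_small \<kappa> C \<longleftrightarrow> (\<forall>A \<in> obj C. \<forall>B \<in> obj C. small \<kappa> (hom C A B))"

type_synonym 'u fn = "'u set \<times> 'u set \<times> ('u \<Rightarrow> 'u)"

definition set_cat :: "'u rel \<Rightarrow> ('u set, 'u fn) cat" where
  "set_cat \<kappa> =
     \<lparr>obj = {A. small \<kappa> A},
      arr = {(A, B, f). small \<kappa> A \<and> small \<kappa> B \<and> f \<in> A \<rightarrow>\<^sub>E B},
      src = (\<lambda>(A, B, f). A),
      tgt = (\<lambda>(A, B, f). B),
      ide = (\<lambda>A. (A, A, \<lambda>x \<in> A. x)),
      cmp = (\<lambda>(B', D, g) (A, B, f). (A, D, compose A g f))\<rparr>"

definition hom_functor :: "('o, 'u) cat \<Rightarrow> 'o \<Rightarrow> ('o, 'u, 'u set, 'u fn) fctr" where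
  "hom_functor C A =
     \<lparr>omap = (\<lambda>X \<in> obj C. hom C A X),
      amap = (\<lambda>f \<in> arr C. (hom C A (src C f), hom C A (tgt C f),
                              \<lambda>g \<in> hom C A (src C f). f \<cdot>\<^bsub>C\<^esub> g))\<rparr>"


section \<open>Locally finitely presentable categories\<close>

definition cocomplete :: "'u rel \<Rightarrow> ('o, 'a) cat \<Rightarrow> bool" where
  "cocomplete \<kappa> C \<longleftrightarrow>
     (\<forall>(J :: ('u, 'u) cat) D. small_cat \<kappa> J \<and> is_functor J C D \<longrightarrow> (\<exists>X \<iota>. is_colimit J C D X \<iota>))"

text \<open>\<open>A\<close> is compact if the functor \<open>C(A, -)\<close> into sets preserves small filtered colimits.\<close>

definition compact_obj :: "'u rel \<Rightarrow> ('o, 'u) cat \<Rightarrow> 'o \<Rightarrow> bool" where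
  "compact_obj \<kappa> C A \<longleftrightarrow> A \<in> obj C \<and>
     (\<forall>(J :: ('u, 'u) cat) D X \<iota>. small_cat \<kappa> J \<and> filtered J \<and> is_colimit J C D X \<iota> \<longrightarrow>
        is_colimit J (set_cat \<kappa>) (fcomp J (hom_functor C A) D)
          (omap (hom_functor C A) X) (\<lambda>j. amap (hom_functor C A) (\<iota> j)))"

definition locally_finitely_presentable :: "'u rel \<Rightarrow> ('o, 'u) cat \<Rightarrow> bool" where
  "locally_finitely_presentable \<kappa> C \<longleftrightarrow>
     category C \<and> locally_small \<kappa> C \<and> cocomplete \<kappa> C \<and>
     (\<exists>G. small \<kappa> G \<and> (\<forall>A \<in> G. compact_obj \<kappa> C A) \<and>
       (\<forall>X \<in> obj C. \<exists>(J :: ('u, 'u) cat) D \<iota>.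
          small_cat \<kappa> J \<and> filtered J \<and> is_colimit J C D X \<iota> \<and> (\<forall>j \<in> obj J. omap D j \<in> G)))"


section \<open>Weak factorization systems\<close>

definition lifts :: "('o, 'a) cat \<Rightarrow> 'a \<Rightarrow> 'a \<Rightarrow> bool" where
  "lifts C l r \<longleftrightarrow>
     (\<forall>u \<in> hom C (src C l) (src C r). \<forall>v \<in> hom C (tgt C l) (tgt C r).
        r \<cdot>\<^bsub>C\<^esub> u = v \<cdot>\<^bsub>C\<^esub> l \<longrightarrow>
        (\<exists>h \<in> hom C (tgt C l) (src C r). h \<cdot>\<^bsub>C\<^esub> l = u \<and> r \<cdot>\<^bsub>C\<^esub> h = v))"

definition llp :: "('o, 'a) cat \<Rightarrow> 'a set \<Rightarrow> 'a set" where
  "llp C R = {l \<in> arr C. \<forall>r \<in> R. lifts C l r}"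

definition rlp :: "('o, 'a) cat \<Rightarrow> 'a set \<Rightarrow> 'a set" where
  "rlp C L = {r \<in> arr C. \<forall>l \<in> L. lifts C l r}"

definition weak_factorization_system :: "('o, 'a) cat \<Rightarrow> 'a set \<Rightarrow> 'a set \<Rightarrow> bool" where
  "weak_factorization_system C L R \<longleftrightarrow>
     L \<subseteq> arr C \<and> R \<subseteq> arr C \<and> L = llp C R \<and> R = rlp C L \<and>
     (\<forall>f \<in> arr C. \<exists>l \<in> L. \<exists>r \<in> R. tgt C l = src C r \<and> f = r \<cdot>\<^bsub>C\<^esub> l)"


section \<open>Clan-algebraic categories\<close>

definition EF_category :: "'u rel \<Rightarrow> ('o, 'u) cat \<Rightarrow> 'u set \<Rightarrow> 'u set \<Rightarrow> bool" where
  "EF_category \<kappa> L E F \<longleftrightarrow> locally_finitely_presentable \<kappa> L \<and> weak_factorization_system L E F"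

definition zero_extension :: "('o, 'a) cat \<Rightarrow> 'a set \<Rightarrow> 'o \<Rightarrow> bool" where
  "zero_extension L E A \<longleftrightarrow> A \<in> obj L \<and> (\<exists>I. initial L I \<and> (\<exists>e \<in> E. e \<in> hom L I A))"

definition compact_0_exts :: "'u rel \<Rightarrow> ('o, 'u) cat \<Rightarrow> 'u set \<Rightarrow> 'o set" where
  "compact_0_exts \<kappa> L E = {A. compact_obj \<kappa> L A \<and> zero_extension L E A}"

text \<open>The comma category \<open>J \<down> X\<close> for the inclusion \<open>J\<close> of the full subcategory of \<open>C\<close> on \<open>S\<close>: an
  arrow \<open>(f, h, g)\<close> from \<open>f : A \<rightarrow> X\<close> to \<open>g : B \<rightarrow> X\<close> is an arrow \<open>h : A \<rightarrow> B\<close> with \<open>g \<cdot> h = f\<close>.\<close>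

definition comma :: "('o, 'a) cat \<Rightarrow> 'o set \<Rightarrow> 'o \<Rightarrow> ('a, 'a \<times> 'a \<times> 'a) cat" where
  "comma C S X =
     \<lparr>obj = {f \<in> arr C. src C f \<in> S \<and> tgt C f = X},
      arr = {(f, h, g). f \<in> arr C \<and> src C f \<in> S \<and> tgt C f = X \<and>
                        g \<in> arr C \<and> src C g \<in> S \<and> tgt C g = X \<and>
                        h \<in> hom C (src C f) (src C g) \<and> g \<cdot>\<^bsub>C\<^esub> h = f},
      src = (\<lambda>(f, h, g). f),
      tgt = (\<lambda>(f, h, g). g),
      ide = (\<lambda>f. (f, ide C (src C f), f)),
      cmp = (\<lambda>(g', k, l) (f, h, g). (f, k \<cdot>\<^bsub>C\<^esub> h, l))\<rparr>"

definition comma_proj :: "('o, 'a) cat \<Rightarrow> 'o set \<Rightarrow> 'o \<Rightarrow> ('a, 'a \<times> 'a \<times> 'a, 'o, 'a) fctr" where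
  "comma_proj C S X =
     \<lparr>omap = (\<lambda>f \<in> obj (comma C S X). src C f),
      amap = (\<lambda>t \<in> arr (comma C S X). case t of (f, h, g) \<Rightarrow> h)\<rparr>"

text \<open>The inclusion of the full subcategory on \<open>S\<close> is dense if every object is the colimit of its
  canonical diagram, with the canonical cocone: the component at \<open>f : A \<rightarrow> X\<close> is \<open>f\<close> itself.\<close>

definition dense_inclusion :: "('o, 'a) cat \<Rightarrow> 'o set \<Rightarrow> bool" where
  "dense_inclusion C S \<longleftrightarrow>
     (\<forall>X \<in> obj C. is_colimit (comma C S X) C (comma_proj C S X) X (\<lambda>f. f))"

text \<open>The first conjunct of the universal statement on \<open>X\<close> says that \<open>p, q : R \<rightarrow> A\<close> are jointly
  monic, i.e. that \<open>\<langle>p, q\<rangle> : R \<rightarrow> A \<times> A\<close> is a monomorphism; the second that it represents an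
  equivalence relation on each \<open>C(X, A)\<close>.\<close>

definition equivalence_relation :: "('o, 'a) cat \<Rightarrow> 'a \<Rightarrow> 'a \<Rightarrow> bool" where
  "equivalence_relation C p q \<longleftrightarrow>
     p \<in> arr C \<and> q \<in> arr C \<and> src C p = src C q \<and> tgt C p = tgt C q \<and>
     (\<forall>X \<in> obj C.
        (\<forall>u \<in> hom C X (src C p). \<forall>v \<in> hom C X (src C p).
           p \<cdot>\<^bsub>C\<^esub> u = p \<cdot>\<^bsub>C\<^esub> v \<and> q \<cdot>\<^bsub>C\<^esub> u = q \<cdot>\<^bsub>C\<^esub> v \<longrightarrow> u = v) \<and>
        equiv (hom C X (tgt C p)) ((\<lambda>u. (p \<cdot>\<^bsub>C\<^esub> u, q \<cdot>\<^bsub>C\<^esub> u)) ` hom C X (src C p)))"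

definition clan_algebraic :: "'u rel \<Rightarrow> ('o, 'u) cat \<Rightarrow> 'u set \<Rightarrow> 'u set \<Rightarrow> bool" where
  "clan_algebraic \<kappa> L E F \<longleftrightarrow> EF_category \<kappa> L E F \<and>
     \<comment> \<open>(D)\<close>
     dense_inclusion L (compact_0_exts \<kappa> L E) \<and>
     \<comment> \<open>(CG)\<close>
     F = rlp L {e \<in> E. src L e \<in> compact_0_exts \<kappa> L E \<and> tgt L e \<in> compact_0_exts \<kappa> L E} \<and>
     \<comment> \<open>(FQ)\<close>
     (\<forall>p \<in> F. \<forall>q \<in> F. equivalence_relation L p q \<longrightarrow>
        (\<exists>c. coequalizer L p q c \<and> pullback L c c p q \<and> c \<in> F))"

text \<open>The category of compact 0-extensions is only essentially small. As usual it is replaced by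
  an equivalent small category: the full subcategory on a small set \<open>S\<close> of compact 0-extensions
  that contains, up to isomorphism, all of them.\<close>

definition small_replacement :: "'u rel \<Rightarrow> ('o, 'a) cat \<Rightarrow> 'o set \<Rightarrow> 'o set \<Rightarrow> bool" where
  "small_replacement \<kappa> C P S \<longleftrightarrow>
     S \<subseteq> P \<and> small \<kappa> S \<and> (\<forall>A \<in> P. \<exists>B \<in> S. isomorphic C A B)"


text \<open>Small replacements exist: a compact object is a retract of a member of the small generating
  set, hence determined up to isomorphism by an idempotent on such a member.\<close>

lemma category_set_cat: "category (set_cat \<kappa>)"
  by unfold_locales (force simp: set_cat_def hom_def compose_def fun_eq_iff PiE_def Pi_def extensional_def)+

lemma small_Sigma:
  assumes "inaccessible \<kappa>" "small \<kappa> I" "\<And>i. i \<in> I \<Longrightarrow> small \<kappa> (X i)"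
  shows "small \<kappa> (Sigma I X)"
proof -
  have "\<not> finite (Field \<kappa>)"
    using assms(1) natLeq_ordLeq_cinfinite[of \<kappa>] ordLess_imp_ordLeq
    by (metis inaccessible_def card_of_Field_ordIso card_of_ordLeq_finite infinite_iff_natLeq_ordLeq ordIso_symmetric ordLeq_ordIso_trans)
  then have "stable \<kappa>" using assms(1) regularCard_stable unfolding inaccessible_def by blast
  then show ?thesis using assms(2,3) stable_elim unfolding small_def by blast
qed

lemma small_image: "small \<kappa> A \<Longrightarrow> small \<kappa> (f ` A)"
  unfolding small_def using card_of_image ordLeq_ordLess_trans by blast

lemma small_subset: "small \<kappa> B \<Longrightarrow> A \<subseteq> B \<Longrightarrow> small \<kappa> A"
  unfolding small_def using card_of_mono1 ordLeq_ordLess_trans by blast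

lemma small_finite: "inaccessible \<kappa> \<Longrightarrow> finite A \<Longrightarrow> small \<kappa> A"
  unfolding small_def inaccessible_def
  by (meson finite_iff_ordLess_natLeq ordLess_transitive)

lemma set_colimit_covers:
  fixes \<kappa> :: "'u rel"
  assumes \<kappa>: "inaccessible \<kappa>" and J: "category J"
    and col: "is_colimit J (set_cat \<kappa>) D Z \<iota>" and z: "z \<in> Z"
  shows "\<exists>j \<in> obj J. \<exists>x \<in> omap D j. snd (snd (\<iota> j)) x = z"
proof (rule ccontr)
  assume no: "\<not> ?thesis"
  have coc: "is_cocone J (set_cat \<kappa>) D Z \<iota>" using col by (simp add: is_colimit_def)
  have inf: "infinite (UNIV :: 'u set)"
  proof
    assume "finite (UNIV :: 'u set)"
    then have "finite (Field \<kappa>)" by (rule finite_subset[OF subset_UNIV])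
    then have "|Field \<kappa>| <o natLeq" using finite_iff_ordLess_natLeq by blast
    moreover have "natLeq <o |Field \<kappa>|"
      using \<kappa> card_of_Field_ordIso ordIso_symmetric ordLess_ordIso_trans unfolding inaccessible_def by blast
    ultimately show False using ordLess_transitive ordLess_irreflexive by blast
  qed
  obtain b :: 'u where b: "z \<noteq> b" using inf by (metis UNIV_I ex_new_if_finite finite.emptyI finite.insertI insertI1)
  let ?Y = "{z, b}"
  have Y: "small \<kappa> ?Y" using \<kappa> by (simp add: small_finite)
  have Z: "small \<kappa> Z" using coc by (simp add: is_cocone_def set_cat_def)
  define k1 where "k1 = (Z, ?Y, \<lambda>x \<in> Z. b)"
  define k2 where "k2 = (Z, ?Y, \<lambda>x \<in> Z. if x = z then z else b)"
  interpret S: category "set_cat \<kappa>" by (rule category_set_cat)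
  have k: "k1 \<in> hom (set_cat \<kappa>) Z ?Y" "k2 \<in> hom (set_cat \<kappa>) Z ?Y"
    using Y Z by (auto simp: k1_def k2_def hom_def set_cat_def)
  have i: "\<iota> j \<in> hom (set_cat \<kappa>) (omap D j) Z" if "j \<in> obj J" for j
    using coc that by (simp add: is_cocone_def)
  have eq: "k1 \<cdot>\<^bsub>set_cat \<kappa>\<^esub> \<iota> j = k2 \<cdot>\<^bsub>set_cat \<kappa>\<^esub> \<iota> j" if j: "j \<in> obj J" for j
    using i[OF j] no j by (force simp: k1_def k2_def hom_def set_cat_def compose_def fun_eq_iff)
  have D: "is_functor J (set_cat \<kappa>) D" using coc by (simp add: is_cocone_def)
  have ks1: "k1 \<cdot>\<^bsub>set_cat \<kappa>\<^esub> \<iota> j \<in> hom (set_cat \<kappa>) (omap D j) ?Y" if "j \<in> obj J" for j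
    by (rule S.cmp_hom[OF i[OF that] k(1)])
  have ks2: "(k1 \<cdot>\<^bsub>set_cat \<kappa>\<^esub> \<iota> (tgt J u)) \<cdot>\<^bsub>set_cat \<kappa>\<^esub> amap D u = k1 \<cdot>\<^bsub>set_cat \<kappa>\<^esub> \<iota> (src J u)"
    if u: "u \<in> arr J" for u
  proof -
    have o: "tgt J u \<in> obj J" by (rule category.tgt_obj[OF J u])
    have "amap D u \<in> hom (set_cat \<kappa>) (omap D (src J u)) (omap D (tgt J u))"
      using D u by (simp add: is_functor_def hom_def PiE_iff)
    then have "(k1 \<cdot>\<^bsub>set_cat \<kappa>\<^esub> \<iota> (tgt J u)) \<cdot>\<^bsub>set_cat \<kappa>\<^esub> amap D u
        = k1 \<cdot>\<^bsub>set_cat \<kappa>\<^esub> (\<iota> (tgt J u) \<cdot>\<^bsub>set_cat \<kappa>\<^esub> amap D u)"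
      by (rule S.assoc[OF _ i[OF o] k(1)])
    also have "\<iota> (tgt J u) \<cdot>\<^bsub>set_cat \<kappa>\<^esub> amap D u = \<iota> (src J u)"
      using coc u by (simp add: is_cocone_def)
    finally show ?thesis .
  qed
  have "?Y \<in> obj (set_cat \<kappa>)" using Y by (simp add: set_cat_def)
  then have "is_cocone J (set_cat \<kappa>) D ?Y (\<lambda>j. k1 \<cdot>\<^bsub>set_cat \<kappa>\<^esub> \<iota> j)"
    unfolding is_cocone_def using D ks1 ks2 by blast
  then have "\<exists>!h. h \<in> hom (set_cat \<kappa>) Z ?Y \<and> (\<forall>j \<in> obj J. h \<cdot>\<^bsub>set_cat \<kappa>\<^esub> \<iota> j = k1 \<cdot>\<^bsub>set_cat \<kappa>\<^esub> \<iota> j)"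
    using col by (simp add: is_colimit_def)
  then have "k1 = k2" by (rule ex1E) (metis k eq)
  then have "b = z" using z by (auto simp: k1_def k2_def fun_eq_iff dest: spec[of _ z])
  then show False using b by simp
qed

lemma (in category) assoc4:
  assumes "a \<in> hom C A B" "b \<in> hom C B D" "c \<in> hom C D E" "d \<in> hom C E G"
  shows "(d \<cdot> c) \<cdot> (b \<cdot> a) = d \<cdot> ((c \<cdot> b) \<cdot> a)"
  using assoc[OF cmp_hom[OF assms(1,2)] assms(3,4)] assoc[OF assms(1-3)] by simp

lemma ex_small_replacement:
  assumes \<kappa>: "inaccessible \<kappa>" and L: "locally_finitely_presentable \<kappa> L"
    and P: "\<And>A. A \<in> P \<Longrightarrow> compact_obj \<kappa> L A"
  shows "\<exists>S. small_replacement \<kappa> L P S"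
proof -
  interpret category L using L by (simp add: locally_finitely_presentable_def)
  obtain G where G: "small \<kappa> G" "\<And>A. A \<in> G \<Longrightarrow> compact_obj \<kappa> L A"
    and gen: "\<And>X. X \<in> obj L \<Longrightarrow> \<exists>(J :: ('a, 'a) cat) D \<iota>.
        small_cat \<kappa> J \<and> filtered J \<and> is_colimit J L D X \<iota> \<and> (\<forall>j \<in> obj J. omap D j \<in> G)"
    using L unfolding locally_finitely_presentable_def by blast
  define R where "R A g r s \<longleftrightarrow> r \<in> hom L g A \<and> s \<in> hom L A g \<and> r \<cdot>\<^bsub>L\<^esub> s = ide L A" for A g r s
  have retract: "\<exists>g \<in> G. \<exists>r s. R A g r s" if A: "A \<in> P" for A
  proof -
    have Aobj: "A \<in> obj L" using P[OF A] by (simp add: compact_obj_def)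
    obtain J :: "('a, 'a) cat" and D \<iota> where J: "small_cat \<kappa> J" "filtered J" "is_colimit J L D A \<iota>"
      and DG: "\<And>j. j \<in> obj J \<Longrightarrow> omap D j \<in> G"
      using gen[OF Aobj] by blast
    have col: "is_colimit J (set_cat \<kappa>) (fcomp J (hom_functor L A) D)
          (omap (hom_functor L A) A) (\<lambda>j. amap (hom_functor L A) (\<iota> j))"
      using P[OF A] J unfolding compact_obj_def by blast
    have D: "omap D j \<in> obj L" "\<iota> j \<in> hom L (omap D j) A" if "j \<in> obj J" for j
      using J(3) that by (auto simp: is_colimit_def is_cocone_def is_functor_def)
    have "ide L A \<in> omap (hom_functor L A) A"
      using ide_hom Aobj by (simp add: hom_functor_def)
    then have "\<exists>j \<in> obj J. \<exists>s \<in> omap (fcomp J (hom_functor L A) D) j.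
        snd (snd (amap (hom_functor L A) (\<iota> j))) s = ide L A"
      using J(1) by (intro set_colimit_covers[OF \<kappa> _ col]) (simp_all add: small_cat_def)
    then obtain j s where j: "j \<in> obj J" and s: "s \<in> omap (fcomp J (hom_functor L A) D) j"
      and eq: "snd (snd (amap (hom_functor L A) (\<iota> j))) s = ide L A"
      by (elim bexE)
    have s': "s \<in> hom L A (omap D j)"
      using s j D[OF j] by (simp add: fcomp_def hom_functor_def)
    have "\<iota> j \<cdot>\<^bsub>L\<^esub> s = ide L A"
      using eq D[OF j] s' by (auto simp: hom_functor_def hom_def)
    then have "R A (omap D j) (\<iota> j) s" using s' D[OF j] unfolding R_def by (intro conjI)
    then show ?thesis using DG[OF j] by blast
  qed
  let ?I = "Sigma G (\<lambda>g. hom L g g)"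
  have I: "small \<kappa> ?I"
    using small_Sigma[OF \<kappa> G(1), of "\<lambda>g. hom L g g"] L G(2)
    by (auto simp: locally_finitely_presentable_def locally_small_def compact_obj_def)
  define Q where "Q A i \<longleftrightarrow> A \<in> P \<and> (\<exists>r s. R A (fst i) r s \<and> snd i = s \<cdot>\<^bsub>L\<^esub> r)" for A i
  let ?S = "(\<lambda>i. SOME A. Q A i) ` {i \<in> ?I. \<exists>A. Q A i}"
  have "?S \<subseteq> P"
  proof
    fix B assume "B \<in> ?S"
    then obtain i where "B = (SOME A. Q A i)" "\<exists>A. Q A i" by blast
    then have "Q B i" by (metis someI_ex)
    then show "B \<in> P" by (simp add: Q_def)
  qed
  moreover have "small \<kappa> ?S" by (rule small_image, rule small_subset[OF I]) auto
  moreover have "\<exists>B \<in> ?S. isomorphic L A B" if A: "A \<in> P" for A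
  proof -
    obtain g r s where g: "g \<in> G" and rs: "R A g r s" using retract[OF A] by blast
    let ?i = "(g, s \<cdot>\<^bsub>L\<^esub> r)"
    have i: "?i \<in> ?I" "Q A ?i" using g rs A cmp_hom by (auto simp: R_def Q_def)
    define B where "B = (SOME A. Q A ?i)"
    have "Q B ?i" unfolding B_def using i(2) by (rule someI)
    then obtain r' s' where rs': "R B g r' s'" and e: "s \<cdot>\<^bsub>L\<^esub> r = s' \<cdot>\<^bsub>L\<^esub> r'"
      by (auto simp: Q_def)
    have h: "r \<in> hom L g A" "s \<in> hom L A g" "r \<cdot>\<^bsub>L\<^esub> s = ide L A"
      "r' \<in> hom L g B" "s' \<in> hom L B g" "r' \<cdot>\<^bsub>L\<^esub> s' = ide L B"
      using rs rs' by (auto simp: R_def)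
    have f: "r' \<cdot>\<^bsub>L\<^esub> s \<in> hom L A B" "r \<cdot>\<^bsub>L\<^esub> s' \<in> hom L B A"
      by (rule cmp_hom[OF h(2) h(4)], rule cmp_hom[OF h(5) h(1)])
    have A: "ide L A \<in> hom L A A" and B: "ide L B \<in> hom L B B"
      using cmp_hom[OF h(2) h(1)] cmp_hom[OF h(5) h(4)] h(3,6) by simp_all
    have 1: "(r \<cdot>\<^bsub>L\<^esub> s') \<cdot>\<^bsub>L\<^esub> (r' \<cdot>\<^bsub>L\<^esub> s) = ide L A"
    proof -
      have "(r \<cdot>\<^bsub>L\<^esub> s') \<cdot>\<^bsub>L\<^esub> (r' \<cdot>\<^bsub>L\<^esub> s) = r \<cdot>\<^bsub>L\<^esub> ((s' \<cdot>\<^bsub>L\<^esub> r') \<cdot>\<^bsub>L\<^esub> s)"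
        by (rule assoc4[OF h(2) h(4) h(5) h(1)])
      also have "\<dots> = r \<cdot>\<^bsub>L\<^esub> ((s \<cdot>\<^bsub>L\<^esub> r) \<cdot>\<^bsub>L\<^esub> s)" by (simp only: e)
      also have "\<dots> = (r \<cdot>\<^bsub>L\<^esub> s) \<cdot>\<^bsub>L\<^esub> (r \<cdot>\<^bsub>L\<^esub> s)"
        by (rule assoc4[OF h(2) h(1) h(2) h(1), symmetric])
      also have "\<dots> = ide L A" by (simp only: h(3) cmp_ide[OF A])
      finally show ?thesis .
    qed
    have 2: "(r' \<cdot>\<^bsub>L\<^esub> s) \<cdot>\<^bsub>L\<^esub> (r \<cdot>\<^bsub>L\<^esub> s') = ide L B"
    proof -
      have "(r' \<cdot>\<^bsub>L\<^esub> s) \<cdot>\<^bsub>L\<^esub> (r \<cdot>\<^bsub>L\<^esub> s') = r' \<cdot>\<^bsub>L\<^esub> ((s \<cdot>\<^bsub>L\<^esub> r) \<cdot>\<^bsub>L\<^esub> s')"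
        by (rule assoc4[OF h(5) h(1) h(2) h(4)])
      also have "\<dots> = r' \<cdot>\<^bsub>L\<^esub> ((s' \<cdot>\<^bsub>L\<^esub> r') \<cdot>\<^bsub>L\<^esub> s')" by (simp only: e)
      also have "\<dots> = (r' \<cdot>\<^bsub>L\<^esub> s') \<cdot>\<^bsub>L\<^esub> (r' \<cdot>\<^bsub>L\<^esub> s')"
        by (rule assoc4[OF h(5) h(4) h(5) h(4), symmetric])
      also have "\<dots> = ide L B" by (simp only: h(6) cmp_ide[OF B])
      finally show ?thesis .
    qed
    have "isomorphic L A B"
      unfolding isomorphic_def
    proof (rule bexI[OF _ f(1)])
      have st: "r' \<cdot>\<^bsub>L\<^esub> s \<in> arr L" "src L (r' \<cdot>\<^bsub>L\<^esub> s) = A" "tgt L (r' \<cdot>\<^bsub>L\<^esub> s) = B"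
        using f(1) by (simp_all add: hom_def)
      show "is_iso L (r' \<cdot>\<^bsub>L\<^esub> s)"
        unfolding is_iso_def st(2,3) using st(1) f(2) 1 2 by blast
    qed
    moreover have "B \<in> ?S" unfolding B_def by (rule imageI) (use i in blast)
    ultimately show ?thesis by (rule bexI)
  qed
  ultimately have "small_replacement \<kappa> L P ?S" unfolding small_replacement_def by (intro conjI ballI)
  then show ?thesis by (rule exI)
qed

section \<open>Clans and their models\<close>

record ('o, 'a) clan =
  ucat :: "('o, 'a) cat"
  display :: "'a set"

definition is_clan :: "'u rel \<Rightarrow> ('o, 'a) clan \<Rightarrow> bool" where
  "is_clan \<kappa> T \<longleftrightarrow> small_cat \<kappa> (ucat T) \<and> display T \<subseteq> arr (ucat T) \<and>
     (\<forall>f. is_iso (ucat T) f \<longrightarrow> f \<in> display T) \<and>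
     (\<forall>p \<in> display T. \<forall>q \<in> display T. tgt (ucat T) p = src (ucat T) q \<longrightarrow>
        q \<cdot>\<^bsub>ucat T\<^esub> p \<in> display T) \<and>
     (\<forall>p \<in> display T. \<forall>f \<in> arr (ucat T). tgt (ucat T) f = tgt (ucat T) p \<longrightarrow>
        (\<exists>f' p'. pullback (ucat T) p f f' p') \<and>
        (\<forall>f' p'. pullback (ucat T) p f f' p' \<longrightarrow> p' \<in> display T)) \<and>
     (\<exists>t. terminal (ucat T) t) \<and>
     (\<forall>t. terminal (ucat T) t \<longrightarrow> (\<forall>A \<in> obj (ucat T). hom (ucat T) A t \<subseteq> display T))"

definition is_model :: "'u rel \<Rightarrow> ('o, 'a) clan \<Rightarrow> ('o, 'a, 'u set, 'u fn) fctr \<Rightarrow> bool" where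
  "is_model \<kappa> T M \<longleftrightarrow> is_functor (ucat T) (set_cat \<kappa>) M \<and>
     (\<forall>t. terminal (ucat T) t \<longrightarrow> terminal (set_cat \<kappa>) (omap M t)) \<and>
     (\<forall>p \<in> display T. \<forall>f f' p'. pullback (ucat T) p f f' p' \<longrightarrow>
        pullback (set_cat \<kappa>) (amap M p) (amap M f) (amap M f') (amap M p'))"

definition Mod ::
    "'u rel \<Rightarrow> ('o, 'a) clan \<Rightarrow>
     (('o, 'a, 'u set, 'u fn) fctr,
      ('o, 'a, 'u set, 'u fn) fctr \<times> ('o, 'a, 'u set, 'u fn) fctr \<times> ('o \<Rightarrow> 'u fn)) cat" where
  "Mod \<kappa> T = full_sub (functor_cat (ucat T) (set_cat \<kappa>)) {M. is_model \<kappa> T M}"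

definition ext_clan :: "('o, 'a) cat \<Rightarrow> 'a set \<Rightarrow> 'o set \<Rightarrow> ('o, 'a) clan" where
  "ext_clan L E S = \<lparr>ucat = op (full_sub L S), display = E \<inter> arr (full_sub L S)\<rparr>"

definition nerve_obj :: "('o, 'u) cat \<Rightarrow> 'o set \<Rightarrow> 'o \<Rightarrow> ('o, 'u, 'u set, 'u fn) fctr" where
  "nerve_obj L S X =
     \<lparr>omap = (\<lambda>A \<in> S. hom L A X),
      amap = (\<lambda>f \<in> arr (full_sub L S). (hom L (tgt L f) X, hom L (src L f) X,
                                            \<lambda>g \<in> hom L (tgt L f) X. g \<cdot>\<^bsub>L\<^esub> f))\<rparr>"

definition nerve ::
    "('o, 'u) cat \<Rightarrow> 'o set \<Rightarrow>
     ('o, 'u, ('o, 'u, 'u set, 'u fn) fctr,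
      ('o, 'u, 'u set, 'u fn) fctr \<times> ('o, 'u, 'u set, 'u fn) fctr \<times> ('o \<Rightarrow> 'u fn)) fctr" where
  "nerve L S =
     \<lparr>omap = (\<lambda>X \<in> obj L. nerve_obj L S X),
      amap = (\<lambda>h \<in> arr L. (nerve_obj L S (src L h), nerve_obj L S (tgt L h),
                \<lambda>A \<in> S. (hom L A (src L h), hom L A (tgt L h),
                         \<lambda>g \<in> hom L A (src L h). h \<cdot>\<^bsub>L\<^esub> g)))\<rparr>"

end

theory Submission
  imports Defs
begin

text \<open>Density makes the nerve functor fully faithful, so it remains to represent every model \<open>M\<close>.
  Zorn's lemma yields a directed diagram of compact 0-extensions in the category of elements of \<open>M\<close>
  that absorbs every extension out of each of its stages; as compact objects see directed colimits
  stagewise, its colimit \<open>X\<^sub>0\<close> in \<open>L\<close> comes with a full, hence surjective, map \<open>N X\<^sub>0 \<rightarrow> M\<close>.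
  Likewise there is a full map \<open>N X\<^sub>1 \<rightarrow> N X\<^sub>0 \<times>\<^sub>M N X\<^sub>0\<close>, corresponding to a parallel pair
  \<open>X\<^sub>1 \<rightrightarrows> X\<^sub>0\<close>. The kernel pair of \<open>X\<^sub>1 \<rightarrow> X\<^sub>0 \<times> X\<^sub>0\<close> has full legs, so by (FQ) it has a full
  effective quotient \<open>R\<close>, and \<open>N R = N X\<^sub>0 \<times>\<^sub>M N X\<^sub>0\<close>. Hence \<open>R \<rightrightarrows> X\<^sub>0\<close> is again an
  equivalence relation with full legs, and its quotient represents \<open>M\<close>.\<close>

section \<open>Categories\<close>

text \<open>Axiom (FQ) can only divide an object of \<open>L\<close> by a relation that is itself an
  object of \<open>L\<close>, whereas the fibre product of the first cover with itself over
  \<open>M\<close> is a priori only a functor. It is again a model, so the covering construction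
  applies to it too; the regress ends there because the kernel pair of the second cover is cut out
  by equations between arrows of \<open>L\<close> and makes no reference to \<open>M\<close>.
  Fullness does double duty: lifting against an extension from 0 to A gives surjectivity, since
  models send 0 to a point, and lifting against general extensions makes the legs of a kernel pair
  full, as (FQ) demands. Zorn's lemma stands in for the transfinite iteration of the small object
  argument. For the colimit to exist, the vertices must come from a small set fixed beforehand, and
  their names must record enough that a newly attached vertex is never already in use; finite trees
  labelled by arrows of the category of elements achieve both.\<close>

context category
begin

lemma in_hom: "f \<in> hom C A B \<longleftrightarrow> f \<in> arr C \<and> src C f = A \<and> tgt C f = B"
  by (auto simp: hom_def)

lemma cmp_arr [simp]:
  assumes "f \<in> arr C" "g \<in> arr C" "tgt C f = src C g"
  shows "g \<cdot> f \<in> arr C" "src C (g \<cdot> f) = src C f" "tgt C (g \<cdot> f) = tgt C g"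
  using cmp_hom[of f "src C f" "tgt C f" g "tgt C g"] assms by (auto simp: hom_def)

lemma ide_arr [simp]:
  assumes "A \<in> obj C"
  shows "ide C A \<in> arr C" "src C (ide C A) = A" "tgt C (ide C A) = A"
  using ide_hom[OF assms] by (auto simp: hom_def)

lemma cmp_ide_src [simp]: "f \<in> arr C \<Longrightarrow> src C f = A \<Longrightarrow> f \<cdot> ide C A = f"
  by (rule cmp_ide) (auto simp: hom_def)

lemma ide_tgt_cmp [simp]: "f \<in> arr C \<Longrightarrow> tgt C f = A \<Longrightarrow> ide C A \<cdot> f = f"
  by (rule ide_cmp) (auto simp: hom_def)

lemma cmp_assoc:
  assumes "f \<in> arr C" "g \<in> arr C" "h \<in> arr C" "tgt C f = src C g" "tgt C g = src C h"
  shows "(h \<cdot> g) \<cdot> f = h \<cdot> (g \<cdot> f)"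
  by (rule assoc) (use assms in \<open>auto simp: hom_def\<close>)

declare src_obj [simp] tgt_obj [simp]

lemma category_op: "category (op C)"
  by unfold_locales (auto simp: op_def hom_def cmp_assoc)

lemma category_full_sub: "S \<subseteq> obj C \<Longrightarrow> category (full_sub C S)"
  by unfold_locales (auto simp: full_sub_def hom_def cmp_assoc)

end

lemma op_simps [simp]:
  "obj (op C) = obj C" "arr (op C) = arr C" "src (op C) = tgt C" "tgt (op C) = src C"
  "ide (op C) = ide C" "cmp (op C) g f = cmp C f g" "hom (op C) A B = hom C B A"
  by (auto simp: op_def hom_def)

lemma full_sub_simps [simp]:
  "obj (full_sub C S) = S" "src (full_sub C S) = src C" "tgt (full_sub C S) = tgt C"
  "ide (full_sub C S) = ide C" "cmp (full_sub C S) = cmp C"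
  "f \<in> arr (full_sub C S) \<longleftrightarrow> f \<in> arr C \<and> src C f \<in> S \<and> tgt C f \<in> S"
  by (auto simp: full_sub_def)

text \<open>Phrased through \<open>op\<close> so that a pushout of an extension is literally a
  pullback of a display map in the clan. In \<open>pushout C f g p q\<close> the arrow
  \<open>p\<close> leaves the target of \<open>f\<close>, hence \<open>q\<close> is the cobase
  change of \<open>f\<close>.\<close>

abbreviation pushout :: "('o, 'a) cat \<Rightarrow> 'a \<Rightarrow> 'a \<Rightarrow> 'a \<Rightarrow> 'a \<Rightarrow> bool" where
  "pushout C f g p q \<equiv> pullback (op C) f g p q"

context category
begin

lemma pushoutD:
  assumes "pushout C f g p q"
  shows "f \<in> arr C" "g \<in> arr C" "p \<in> arr C" "q \<in> arr C" "src C g = src C f"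
    "src C p = tgt C f" "src C q = tgt C g" "tgt C q = tgt C p" "q \<cdot> g = p \<cdot> f"
  using assms by (auto simp: pullback_def)

lemma pushout_map:
  assumes "pushout C f g p q" "u \<in> arr C" "v \<in> arr C" "src C u = tgt C f" "src C v = tgt C g"
    "tgt C u = tgt C v" "u \<cdot> f = v \<cdot> g"
  obtains h where "h \<in> arr C" "src C h = tgt C p" "tgt C h = tgt C u" "h \<cdot> p = u" "h \<cdot> q = v"
  using assms unfolding pullback_def by (force simp: in_hom)

lemma pushout_unique:
  assumes "pushout C f g p q" "h \<in> arr C" "k \<in> arr C" "src C h = tgt C p" "src C k = tgt C p"
    "tgt C h = tgt C k" "h \<cdot> p = k \<cdot> p" "h \<cdot> q = k \<cdot> q"
  shows "h = k"
proof -
  note P = pushoutD[OF assms(1)]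
  have "\<exists>!m. m \<in> hom C (tgt C p) (tgt C h) \<and> m \<cdot> p = h \<cdot> p \<and> m \<cdot> q = h \<cdot> q"
    using assms(1) unfolding pullback_def
    apply (elim conjE)
    apply (drule bspec[of _ _ "tgt C h"])
    using assms P by (auto simp: in_hom cmp_assoc)
  then show ?thesis using assms by (auto simp: in_hom)
qed

lemma pushoutI:
  assumes "f \<in> arr C" "g \<in> arr C" "p \<in> arr C" "q \<in> arr C" "src C g = src C f"
    "src C p = tgt C f" "src C q = tgt C g" "tgt C q = tgt C p" "q \<cdot> g = p \<cdot> f"
    and "\<And>u v. u \<in> arr C \<Longrightarrow> v \<in> arr C \<Longrightarrow> src C u = tgt C f \<Longrightarrow> src C v = tgt C g \<Longrightarrow>
      tgt C v = tgt C u \<Longrightarrow> u \<cdot> f = v \<cdot> g \<Longrightarrow>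
      \<exists>h. h \<in> arr C \<and> src C h = tgt C p \<and> tgt C h = tgt C u \<and> h \<cdot> p = u \<and> h \<cdot> q = v"
    and "\<And>h k. h \<in> arr C \<Longrightarrow> k \<in> arr C \<Longrightarrow> src C h = tgt C p \<Longrightarrow> src C k = tgt C p \<Longrightarrow>
      tgt C k = tgt C h \<Longrightarrow> h \<cdot> p = k \<cdot> p \<Longrightarrow> h \<cdot> q = k \<cdot> q \<Longrightarrow> h = k"
  shows "pushout C f g p q"
  unfolding pullback_def
  apply (simp add: assms(1-9))
  apply (intro ballI impI)
  apply (rule ex_ex1I)
  using assms(10) apply (force simp: in_hom)
  using assms(11) by (force simp: in_hom)

lemma functorD:
  assumes "is_functor C D G"
  shows "A \<in> obj C \<Longrightarrow> omap G A \<in> obj D" "f \<in> arr C \<Longrightarrow> amap G f \<in> arr D"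
    "f \<in> arr C \<Longrightarrow> src D (amap G f) = omap G (src C f)"
    "f \<in> arr C \<Longrightarrow> tgt D (amap G f) = omap G (tgt C f)"
    "A \<in> obj C \<Longrightarrow> amap G (ide C A) = ide D (omap G A)"
    "f \<in> arr C \<Longrightarrow> g \<in> arr C \<Longrightarrow> tgt C f = src C g \<Longrightarrow> amap G (g \<cdot> f) = amap G g \<cdot>\<^bsub>D\<^esub> amap G f"
  using assms by (auto simp: is_functor_def)

end

section \<open>Preorders as categories\<close>

definition thin :: "'n set \<Rightarrow> ('n \<times> 'n) set \<Rightarrow> ('n, 'n \<times> 'n) cat" where
  "thin P r = \<lparr>obj = P, arr = r, src = fst, tgt = snd, ide = (\<lambda>p. (p, p)),
     cmp = (\<lambda>v u. (fst u, snd v))\<rparr>"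

lemma thin_simps [simp]:
  "obj (thin P r) = P" "arr (thin P r) = r" "src (thin P r) = fst" "tgt (thin P r) = snd"
  "ide (thin P r) p = (p, p)" "cmp (thin P r) v u = (fst u, snd v)"
  by (auto simp: thin_def)

lemma category_thin:
  assumes "r \<subseteq> P \<times> P" "\<And>p. p \<in> P \<Longrightarrow> (p, p) \<in> r" "trans r"
  shows "category (thin P r)"
  using assms by unfold_locales (auto simp: hom_def dest: transD)

lemma filtered_thin:
  assumes "r \<subseteq> P \<times> P" "\<And>p. p \<in> P \<Longrightarrow> (p, p) \<in> r" "trans r" "P \<noteq> {}"
    and "\<And>p q. p \<in> P \<Longrightarrow> q \<in> P \<Longrightarrow> \<exists>s. (p, s) \<in> r \<and> (q, s) \<in> r"
  shows "filtered (thin P r)"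
  unfolding filtered_def
proof (intro conjI ballI)
  show "category (thin P r)" by (rule category_thin[OF assms(1-3)])
  show "obj (thin P r) \<noteq> {}" using assms(4) by simp
next
  fix p q assume "p \<in> obj (thin P r)" "q \<in> obj (thin P r)"
  then obtain s where "(p, s) \<in> r" "(q, s) \<in> r" using assms(5) by auto
  then show "\<exists>s \<in> obj (thin P r). hom (thin P r) p s \<noteq> {} \<and> hom (thin P r) q s \<noteq> {}"
    using assms(1) by (intro bexI[of _ s]) (auto simp: hom_def)
next
  fix p q f g assume "p \<in> obj (thin P r)" "q \<in> obj (thin P r)" "f \<in> hom (thin P r) p q" "g \<in> hom (thin P r) p q"
  then show "\<exists>h \<in> arr (thin P r). src (thin P r) h = q \<and> h \<cdot>\<^bsub>thin P r\<^esub> f = h \<cdot>\<^bsub>thin P r\<^esub> g"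
    using assms(2) by (intro bexI[of _ "(q, q)"]) (auto simp: hom_def)
qed

text \<open>Smallness only concerns cardinalities, so the index categories in the definitions of
  cocompleteness and compactness may be of any type.\<close>

definition transport :: "('j \<Rightarrow> 'k) \<Rightarrow> ('i \<Rightarrow> 'l) \<Rightarrow> ('j, 'i) cat \<Rightarrow> ('k, 'l) cat" where
  "transport \<phi> \<psi> J = \<lparr>obj = \<phi> ` obj J, arr = \<psi> ` arr J,
     src = (\<lambda>u. \<phi> (src J (inv_into (arr J) \<psi> u))), tgt = (\<lambda>u. \<phi> (tgt J (inv_into (arr J) \<psi> u))),
     ide = (\<lambda>j. \<psi> (ide J (inv_into (obj J) \<phi> j))),
     cmp = (\<lambda>v u. \<psi> (cmp J (inv_into (arr J) \<psi> v) (inv_into (arr J) \<psi> u)))\<rparr>"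

definition transport_fctr ::
    "('j \<Rightarrow> 'k) \<Rightarrow> ('i \<Rightarrow> 'l) \<Rightarrow> ('j, 'i) cat \<Rightarrow> ('j, 'i, 'o, 'a) fctr \<Rightarrow> ('k, 'l, 'o, 'a) fctr" where
  "transport_fctr \<phi> \<psi> J D = \<lparr>omap = (\<lambda>j \<in> \<phi> ` obj J. omap D (inv_into (obj J) \<phi> j)),
     amap = (\<lambda>u \<in> \<psi> ` arr J. amap D (inv_into (arr J) \<psi> u))\<rparr>"

locale transported = J: category J for J :: "('j, 'i) cat" +
  fixes \<phi> :: "'j \<Rightarrow> 'k" and \<psi> :: "'i \<Rightarrow> 'l"
  assumes inj_\<phi>: "inj_on \<phi> (obj J)" and inj_\<psi>: "inj_on \<psi> (arr J)"
begin

abbreviation "J' \<equiv> transport \<phi> \<psi> J"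

lemma transport_simps [simp]:
  "obj J' = \<phi> ` obj J" "arr J' = \<psi> ` arr J"
  "u \<in> arr J \<Longrightarrow> src J' (\<psi> u) = \<phi> (src J u)" "u \<in> arr J \<Longrightarrow> tgt J' (\<psi> u) = \<phi> (tgt J u)"
  "j \<in> obj J \<Longrightarrow> ide J' (\<phi> j) = \<psi> (ide J j)"
  "u \<in> arr J \<Longrightarrow> v \<in> arr J \<Longrightarrow> cmp J' (\<psi> v) (\<psi> u) = \<psi> (cmp J v u)"
  "j \<in> obj J \<Longrightarrow> omap (transport_fctr \<phi> \<psi> J D) (\<phi> j) = omap D j"
  "u \<in> arr J \<Longrightarrow> amap (transport_fctr \<phi> \<psi> J D) (\<psi> u) = amap D u"
  using inj_\<phi> inj_\<psi> by (auto simp: transport_def transport_fctr_def)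

lemma eq_simps [simp]:
  "i \<in> obj J \<Longrightarrow> j \<in> obj J \<Longrightarrow> \<phi> i = \<phi> j \<longleftrightarrow> i = j"
  "u \<in> arr J \<Longrightarrow> v \<in> arr J \<Longrightarrow> \<psi> u = \<psi> v \<longleftrightarrow> u = v"
  using inj_\<phi> inj_\<psi> by (auto simp: inj_on_eq_iff)

lemma hom_transport [simp]: "i \<in> obj J \<Longrightarrow> j \<in> obj J \<Longrightarrow> hom J' (\<phi> i) (\<phi> j) = \<psi> ` hom J i j"
  by (auto simp: hom_def)

lemma category_transport: "category J'"
  by unfold_locales (auto simp: hom_def J.cmp_assoc)

lemma filtered_transport: "filtered J \<Longrightarrow> filtered J'"
  unfolding filtered_def
  apply (auto simp: category_transport)
  apply (metis J.in_hom J.cmp_arr transport_simps(6) transport_simps(3))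
  done

lemma functor_transport:
  assumes "is_functor J C D"
  shows "is_functor J' C (transport_fctr \<phi> \<psi> J D)"
proof -
  have "omap (transport_fctr \<phi> \<psi> J D) \<in> extensional (obj J')"
    "amap (transport_fctr \<phi> \<psi> J D) \<in> extensional (arr J')"
    by (simp_all add: transport_fctr_def)
  then show ?thesis using assms unfolding is_functor_def by (simp add: PiE_iff)
qed

lemma cocone_transport:
  assumes "is_functor J C D"
  shows "is_cocone J' C (transport_fctr \<phi> \<psi> J D) X \<nu> \<longleftrightarrow> is_cocone J C D X (\<lambda>j. \<nu> (\<phi> j))"
  using assms by (auto simp: is_cocone_def functor_transport)

text \<open>Cocones over the two diagrams correspond by reindexing along the bijection \<phi>. A
  cocone is only constrained on the objects of its index category, so precomposing with
  \<open>inv_into\<close> loses nothing.\<close>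

lemma colimit_transport:
  assumes D: "is_functor J C D"
  shows "is_colimit J' C (transport_fctr \<phi> \<psi> J D) X \<nu> \<longleftrightarrow> is_colimit J C D X (\<lambda>j. \<nu> (\<phi> j))"
proof -
  have "(\<forall>Y \<mu>. is_cocone J' C (transport_fctr \<phi> \<psi> J D) Y \<mu> \<longrightarrow>
          (\<exists>!h. h \<in> hom C X Y \<and> (\<forall>j \<in> obj J. h \<cdot>\<^bsub>C\<^esub> \<nu> (\<phi> j) = \<mu> (\<phi> j)))) \<longleftrightarrow>
      (\<forall>Y \<mu>. is_cocone J C D Y \<mu> \<longrightarrow> (\<exists>!h. h \<in> hom C X Y \<and> (\<forall>j \<in> obj J. h \<cdot>\<^bsub>C\<^esub> \<nu> (\<phi> j) = \<mu> j)))"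
    (is "?l = ?r")
  proof
    assume l: ?l
    show ?r
    proof (intro allI impI)
      fix Y \<mu> assume \<mu>: "is_cocone J C D Y \<mu>"
      have e: "\<mu> (inv_into (obj J) \<phi> (\<phi> j)) = \<mu> j" if "j \<in> obj J" for j using inj_\<phi> that by simp
      have "is_cocone J C D Y (\<lambda>j. \<mu> (inv_into (obj J) \<phi> (\<phi> j)))"
        using \<mu> by (auto simp: is_cocone_def e)
      then show "\<exists>!h. h \<in> hom C X Y \<and> (\<forall>j \<in> obj J. h \<cdot>\<^bsub>C\<^esub> \<nu> (\<phi> j) = \<mu> j)"
        using l[rule_format, of Y "\<mu> \<circ> inv_into (obj J) \<phi>"] by (simp add: cocone_transport[OF D] e)
    qed
  next
    assume ?r
    then show ?l by (simp add: cocone_transport[OF D])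
  qed
  then show ?thesis unfolding is_colimit_def by (simp add: cocone_transport[OF D])
qed

end

text \<open>A small set has fewer elements than \<kappa>, and \<kappa> is a well-order on a subset
  of the type \<open>'u\<close>, so objects and arrows embed into \<open>'u\<close>.\<close>

lemma ex_transport:
  fixes \<kappa> :: "'u rel" and J :: "('j, 'i) cat"
  assumes \<kappa>: "inaccessible \<kappa>" and "small_cat \<kappa> J"
  obtains \<phi> :: "'j \<Rightarrow> 'u" and \<psi> :: "'i \<Rightarrow> 'u"
  where "transported J \<phi> \<psi>" "small_cat \<kappa> (transport \<phi> \<psi> J)"
proof -
  have *: "\<exists>f :: 'x \<Rightarrow> 'u. inj_on f A" if "small \<kappa> A" for A :: "'x set"
  proof -
    have "|A| \<le>o \<kappa>" using that by (simp add: small_def ordLess_imp_ordLeq)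
    moreover have "\<kappa> =o |Field \<kappa>|"
      using \<kappa> by (simp add: inaccessible_def card_of_Field_ordIso ordIso_symmetric)
    ultimately have "|A| \<le>o |UNIV :: 'u set|"
      by (intro ordLeq_transitive[OF ordLeq_ordIso_trans card_of_mono1[OF subset_UNIV]])
    then show ?thesis using card_of_ordLeq[of A "UNIV :: 'u set"] by auto
  qed
  obtain \<phi> :: "'j \<Rightarrow> 'u" and \<psi> :: "'i \<Rightarrow> 'u" where "inj_on \<phi> (obj J)" "inj_on \<psi> (arr J)"
    using *[of "obj J"] *[of "arr J"] assms by (auto simp: small_cat_def)
  moreover have "category J" using assms by (simp add: small_cat_def)
  ultimately interpret transported J \<phi> \<psi> by (simp add: transported_def transported_axioms_def)
  show ?thesis
    by (rule that) (use assms category_transport in \<open>auto intro: transported_axioms simp: small_cat_def small_image\<close>)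
qed

lemma ex_colimit:
  fixes \<kappa> :: "'u rel" and J :: "('j, 'i) cat"
  assumes "inaccessible \<kappa>" "cocomplete \<kappa> C" "small_cat \<kappa> J" "is_functor J C D"
  obtains X \<iota> where "is_colimit J C D X \<iota>"
proof -
  from assms(1,3) obtain \<phi> :: "'j \<Rightarrow> 'u" and \<psi> :: "'i \<Rightarrow> 'u"
    where t: "transported J \<phi> \<psi>" "small_cat \<kappa> (transport \<phi> \<psi> J)"
    by (rule ex_transport)
  interpret transported J \<phi> \<psi> by (rule t)
  obtain X \<iota> where "is_colimit J' C (transport_fctr \<phi> \<psi> J D) X \<iota>"
    using assms(2)[unfolded cocomplete_def, rule_format, OF conjI[OF t(2) functor_transport[OF assms(4)]]]
    by auto
  then show ?thesis using that unfolding colimit_transport[OF assms(4)] by simp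
qed

section \<open>Compact objects\<close>

lemma set_cat_simps [simp]:
  "A \<in> obj (set_cat \<kappa>) \<longleftrightarrow> small \<kappa> A"
  "(A, B, f) \<in> arr (set_cat \<kappa>) \<longleftrightarrow> small \<kappa> A \<and> small \<kappa> B \<and> f \<in> A \<rightarrow>\<^sub>E B"
  "src (set_cat \<kappa>) (A, B, f) = A" "tgt (set_cat \<kappa>) (A, B, f) = B"
  "ide (set_cat \<kappa>) A = (A, A, \<lambda>x \<in> A. x)"
  "cmp (set_cat \<kappa>) (B', D, g) (A, B, f) = (A, D, compose A g f)"
  by (auto simp: set_cat_def)

lemma hom_set_cat:
  "\<phi> \<in> hom (set_cat \<kappa>) A B \<longleftrightarrow> small \<kappa> A \<and> small \<kappa> B \<and> (\<exists>f \<in> A \<rightarrow>\<^sub>E B. \<phi> = (A, B, f))"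
  by (cases \<phi>) (auto simp: hom_def)

lemma fcomp_simps [simp]:
  "A \<in> obj C \<Longrightarrow> omap (fcomp C G F) A = omap G (omap F A)"
  "f \<in> arr C \<Longrightarrow> amap (fcomp C G F) f = amap G (amap F f)"
  by (auto simp: fcomp_def)

lemma functor_fcomp:
  assumes "category C" "is_functor C D F" "is_functor D E G"
  shows "is_functor C E (fcomp C G F)"
proof -
  interpret category C by fact
  have "omap (fcomp C G F) \<in> extensional (obj C)" "amap (fcomp C G F) \<in> extensional (arr C)"
    by (simp_all add: fcomp_def)
  then show ?thesis using assms(2,3) unfolding is_functor_def by (simp add: PiE_iff)
qed

context category
begin

lemma hom_functor_simps [simp]:
  "X \<in> obj C \<Longrightarrow> omap (hom_functor C A) X = hom C A X"
  "f \<in> arr C \<Longrightarrow> amap (hom_functor C A) f = (hom C A (src C f), hom C A (tgt C f),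
      \<lambda>g \<in> hom C A (src C f). f \<cdot> g)"
  by (auto simp: hom_functor_def)

lemma functor_hom_functor:
  assumes "locally_small \<kappa> C" "A \<in> obj C"
  shows "is_functor C (set_cat \<kappa>) (hom_functor C A)"
proof -
  have "omap (hom_functor C A) \<in> extensional (obj C)" "amap (hom_functor C A) \<in> extensional (arr C)"
    by (simp_all add: hom_functor_def)
  then show ?thesis
    using assms unfolding is_functor_def
    by (auto simp: PiE_iff locally_small_def in_hom cmp_assoc compose_def fun_eq_iff)
qed

lemma coconeD:
  assumes "is_cocone J C D X \<iota>"
  shows "X \<in> obj C" "j \<in> obj J \<Longrightarrow> \<iota> j \<in> arr C" "j \<in> obj J \<Longrightarrow> src C (\<iota> j) = omap D j"
    "j \<in> obj J \<Longrightarrow> tgt C (\<iota> j) = X" "u \<in> arr J \<Longrightarrow> \<iota> (tgt J u) \<cdot> amap D u = \<iota> (src J u)"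
  using assms by (auto simp: is_cocone_def in_hom)

lemma cocone_cmp:
  assumes "category J" "is_functor J C D" "is_cocone J C D X \<iota>" "u \<in> arr J" "b \<in> arr C" "tgt C b = omap D (src J u)"
  shows "\<iota> (tgt J u) \<cdot> (amap D u \<cdot> b) = \<iota> (src J u) \<cdot> b"
proof -
  interpret J: category J by fact
  show ?thesis
    using coconeD[OF assms(3)] assms(4-)
    by (subst coconeD(5)[OF assms(3,4), symmetric], subst cmp_assoc)
      (auto simp: category.functorD[OF assms(1,2)])
qed

end

section \<open>Elementwise description of compactness\<close>

lemma ex_two_elements:
  fixes \<kappa> :: "'u rel"
  assumes "inaccessible \<kappa>"
  shows "\<exists>x y :: 'u. x \<noteq> y"
proof (rule ccontr)
  assume "\<nexists>x y :: 'u. x \<noteq> y"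
  then have "Field \<kappa> \<subseteq> {undefined}" by blast
  then have "finite (Field \<kappa>)" by (rule finite_subset) simp
  then have "|Field \<kappa>| <o natLeq" using finite_iff_ordLess_natLeq by blast
  moreover have "natLeq <o |Field \<kappa>|"
    using assms card_of_Field_ordIso ordIso_symmetric ordLess_ordIso_trans unfolding inaccessible_def by blast
  ultimately show False using ordLess_transitive ordLess_irreflexive by blast
qed

text \<open>The usual elementwise description of a filtered colimit of sets, applied to
  \<open>C(A, -)\<close>. Equality is tested within one stage, since elements of two stages can
  always be moved to a common one.\<close>

definition hom_preserves ::
    "('o, 'a) cat \<Rightarrow> 'o \<Rightarrow> ('j, 'i) cat \<Rightarrow> ('j, 'i, 'o, 'a) fctr \<Rightarrow> 'o \<Rightarrow> ('j \<Rightarrow> 'a) \<Rightarrow> bool" where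
  "hom_preserves C A J D X \<iota> \<longleftrightarrow>
     (\<forall>a \<in> hom C A X. \<exists>j \<in> obj J. \<exists>b \<in> hom C A (omap D j). \<iota> j \<cdot>\<^bsub>C\<^esub> b = a) \<and>
     (\<forall>j \<in> obj J. \<forall>b \<in> hom C A (omap D j). \<forall>b' \<in> hom C A (omap D j).
        \<iota> j \<cdot>\<^bsub>C\<^esub> b = \<iota> j \<cdot>\<^bsub>C\<^esub> b' \<longrightarrow>
        (\<exists>u \<in> arr J. src J u = j \<and> amap D u \<cdot>\<^bsub>C\<^esub> b = amap D u \<cdot>\<^bsub>C\<^esub> b'))"

locale filtered_cat = J: category J for J :: "('j, 'i) cat" +
  assumes filtered: "filtered J"
begin

lemma upper_bound:
  assumes "j \<in> obj J" "k \<in> obj J"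
  obtains u v where "u \<in> arr J" "v \<in> arr J" "src J u = j" "src J v = k" "tgt J u = tgt J v"
proof -
  have "\<exists>l \<in> obj J. hom J j l \<noteq> {} \<and> hom J k l \<noteq> {}"
    using filtered assms by (simp add: filtered_def)
  then obtain l u v where "u \<in> hom J j l" "v \<in> hom J k l" by blast
  then show ?thesis by (intro that[of u v]) (auto simp: J.in_hom)
qed

lemma coequalize:
  assumes "u \<in> arr J" "v \<in> arr J" "src J u = src J v" "tgt J u = tgt J v"
  obtains w where "w \<in> arr J" "src J w = tgt J u" "cmp J w u = cmp J w v"
proof -
  have *: "\<forall>A \<in> obj J. \<forall>B \<in> obj J. \<forall>f \<in> hom J A B. \<forall>g \<in> hom J A B.
        \<exists>h \<in> arr J. src J h = B \<and> cmp J h f = cmp J h g"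
    using filtered by (simp add: filtered_def)
  have "\<exists>h \<in> arr J. src J h = tgt J u \<and> cmp J h u = cmp J h v"
    using assms by (intro *[rule_format, of "src J u" "tgt J u"]) (simp_all add: J.in_hom)
  then show ?thesis using that by blast
qed

lemma complete_span:
  assumes "u \<in> arr J" "v \<in> arr J" "src J u = src J v"
  obtains s t where "s \<in> arr J" "t \<in> arr J" "src J s = tgt J u" "src J t = tgt J v"
    "tgt J s = tgt J t" "cmp J s u = cmp J t v"
proof -
  obtain s t where st: "s \<in> arr J" "t \<in> arr J" "src J s = tgt J u" "src J t = tgt J v" "tgt J s = tgt J t"
    using upper_bound[of "tgt J u" "tgt J v"] assms by auto
  obtain w where w: "w \<in> arr J" "src J w = tgt J s" "cmp J w (cmp J s u) = cmp J w (cmp J t v)"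
    using coequalize[of "cmp J s u" "cmp J t v"] st assms by auto
  show ?thesis
    using that[of "cmp J w s" "cmp J w t"] st w assms by (simp add: J.cmp_assoc)
qed

end

context category
begin

text \<open>The colimit of sets is probed with two-element sets. Surjectivity is
  \<open>set_colimit_covers\<close>; for injectivity a cocone colours the elements according to
  whether they eventually merge with a given one.\<close>

lemma compact_hom_preserves_aux:
  fixes \<kappa> :: "'a rel" and J :: "('a, 'a) cat"
  assumes \<kappa>: "inaccessible \<kappa>" and A: "compact_obj \<kappa> C A"
    and J: "small_cat \<kappa> J" "filtered J" and col: "is_colimit J C D X \<iota>"
  shows "hom_preserves C A J D X \<iota>"
proof -
  interpret J: filtered_cat J
    using J by (simp add: filtered_cat_def filtered_cat_axioms_def small_cat_def)
  have coc: "is_cocone J C D X \<iota>" using col by (simp add: is_colimit_def)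
  have D: "is_functor J C D" using coc by (simp add: is_cocone_def)
  note D' = J.J.functorD[OF D]
  note \<iota> = coconeD[OF coc]
  let ?H = "fcomp J (hom_functor C A) D"
  have colS: "is_colimit J (set_cat \<kappa>) ?H (hom C A X) (\<lambda>j. amap (hom_functor C A) (\<iota> j))"
    using A J col \<iota>(1) unfolding compact_obj_def by (metis hom_functor_simps(1))
  then have cocS: "is_cocone J (set_cat \<kappa>) ?H (hom C A X) (\<lambda>j. amap (hom_functor C A) (\<iota> j))"
    by (simp add: is_colimit_def)
  have Hfun: "is_functor J (set_cat \<kappa>) ?H" using cocS by (simp add: is_cocone_def)
  have sm: "small \<kappa> (hom C A (omap D j))" if "j \<in> obj J" for j
    using J.J.functorD(1)[OF Hfun that] that D' by simp
  have cov: "\<exists>j \<in> obj J. \<exists>b \<in> hom C A (omap D j). \<iota> j \<cdot> b = a" if a: "a \<in> hom C A X" for a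
  proof -
    obtain j b where jb: "j \<in> obj J" "b \<in> omap ?H j"
        "snd (snd (amap (hom_functor C A) (\<iota> j))) b = a"
      using set_colimit_covers[OF \<kappa> J.J.category_axioms colS a] by (elim bexE)
    then have "b \<in> hom C A (omap D j)" by (simp add: D')
    moreover from this jb have "\<iota> j \<cdot> b = a" by (simp add: \<iota>)
    ultimately show ?thesis using jb(1) by blast
  qed
  have inj: "\<exists>u \<in> arr J. src J u = p \<and> amap D u \<cdot> a = amap D u \<cdot> a'"
    if p: "p \<in> obj J" and a: "a \<in> hom C A (omap D p)" and a': "a' \<in> hom C A (omap D p)"
      and eq: "\<iota> p \<cdot> a = \<iota> p \<cdot> a'" for p a a'
  proof -
    \<comment> \<open>\<open>Q q x\<close>: the element \<open>x\<close> of stage \<open>q\<close>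
      becomes equal to \<open>a\<close> of stage \<open>p\<close> at some common later stage. This
      is the class of \<open>a\<close> in the explicit construction of a filtered colimit of
      sets.\<close>
    define Q where "Q q x \<longleftrightarrow> (\<exists>u \<in> arr J. \<exists>v \<in> arr J. src J u = q \<and> src J v = p \<and> tgt J u = tgt J v
        \<and> amap D u \<cdot> x = amap D v \<cdot> a)" for q x
    obtain z b :: 'a where zb: "z \<noteq> b" using ex_two_elements[OF \<kappa>] by blast
    define \<nu> where "\<nu> q = (hom C A (omap D q), {z, b}, \<lambda>x \<in> hom C A (omap D q). if Q q x then z else b)" for q
    have Y: "small \<kappa> {z, b}" using \<kappa> by (simp add: small_finite)
    \<comment> \<open>Membership in the class is invariant under transitions, so its characteristic
      function \<nu> is a cocone. Passing from the source to the target of \<open>w\<close> requires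
      completing the span of \<open>u\<close> and \<open>w\<close> to a square.\<close>
    have Q: "Q (tgt J w) (amap D w \<cdot> x) \<longleftrightarrow> Q (src J w) x"
      if w: "w \<in> arr J" and x: "x \<in> hom C A (omap D (src J w))" for w x
    proof
      assume "Q (tgt J w) (amap D w \<cdot> x)"
      then obtain u v where uv: "u \<in> arr J" "v \<in> arr J" "src J u = tgt J w" "src J v = p"
        "tgt J u = tgt J v" "amap D u \<cdot> (amap D w \<cdot> x) = amap D v \<cdot> a" by (auto simp: Q_def)
      then have "amap D (cmp J u w) \<cdot> x = amap D v \<cdot> a"
        using w x by (simp add: D' cmp_assoc in_hom)
      then show "Q (src J w) x" unfolding Q_def
        using uv w by (intro bexI[of _ "cmp J u w"] bexI[of _ v]) auto
    next
      assume "Q (src J w) x"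
      then obtain u v where uv: "u \<in> arr J" "v \<in> arr J" "src J u = src J w" "src J v = p"
        "tgt J u = tgt J v" "amap D u \<cdot> x = amap D v \<cdot> a" by (auto simp: Q_def)
      obtain s t where st: "s \<in> arr J" "t \<in> arr J" "src J s = tgt J u" "src J t = tgt J w"
          "tgt J s = tgt J t" "cmp J s u = cmp J t w"
        using J.complete_span[of u w] uv w by auto
      have "amap D t \<cdot> (amap D w \<cdot> x) = amap D (cmp J s u) \<cdot> x"
        using st w x by (simp add: D' cmp_assoc in_hom)
      also have "\<dots> = amap D (cmp J s v) \<cdot> a"
        using st(1-5) uv w x a by (simp add: D' cmp_assoc in_hom)
      finally show "Q (tgt J w) (amap D w \<cdot> x)" unfolding Q_def
        using uv w st by (intro bexI[of _ t] bexI[of _ "cmp J s v"]) auto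
    qed
    have "is_cocone J (set_cat \<kappa>) ?H {z, b} \<nu>"
      unfolding is_cocone_def
    proof (intro conjI ballI Hfun)
      show "{z, b} \<in> obj (set_cat \<kappa>)" using Y by simp
      show "\<nu> j \<in> hom (set_cat \<kappa>) (omap ?H j) {z, b}" if "j \<in> obj J" for j
        using that Y sm[OF that] by (auto simp: \<nu>_def hom_set_cat D')
      show "\<nu> (tgt J u) \<cdot>\<^bsub>set_cat \<kappa>\<^esub> amap ?H u = \<nu> (src J u)" if "u \<in> arr J" for u
        using that Q[OF that] by (auto simp: \<nu>_def D' compose_def fun_eq_iff in_hom)
    qed
    then obtain h where h: "h \<in> hom (set_cat \<kappa>) (hom C A X) {z, b}"
        "h \<cdot>\<^bsub>set_cat \<kappa>\<^esub> amap (hom_functor C A) (\<iota> p) = \<nu> p"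
      using colS p unfolding is_colimit_def by blast
    obtain k where k: "h = (hom C A X, {z, b}, k)" using h(1) by (auto simp: hom_set_cat)
    have "snd (snd (\<nu> p)) a = snd (snd (\<nu> p)) a'"
      using a a' eq by (simp add: h(2)[symmetric] k \<iota> p compose_def)
    moreover have "Q p a"
      unfolding Q_def using p a by (intro bexI[of _ "ide J p"]) auto
    ultimately have "Q p a'" using a a' zb by (simp add: \<nu>_def split: if_splits)
    then obtain u v where uv: "u \<in> arr J" "v \<in> arr J" "src J u = p" "src J v = p"
        "tgt J u = tgt J v" "amap D u \<cdot> a' = amap D v \<cdot> a" by (auto simp: Q_def)
    \<comment> \<open>\<open>u\<close> and \<open>v\<close> may be different arrows out of
      \<open>p\<close>; filteredness makes them equal further on.\<close>
    obtain w where w: "w \<in> arr J" "src J w = tgt J u" "cmp J w u = cmp J w v"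
      using J.coequalize[of u v] uv by auto
    have "amap D (cmp J w u) \<cdot> a' = amap D w \<cdot> (amap D v \<cdot> a)"
      using w(1,2) uv a' by (simp add: D' cmp_assoc in_hom)
    also have "\<dots> = amap D (cmp J w v) \<cdot> a"
      using w(1,2) uv a by (simp add: D' cmp_assoc in_hom)
    finally show ?thesis using w uv by (intro bexI[of _ "cmp J w u"]) auto
  qed
  show ?thesis unfolding hom_preserves_def using cov inj by blast
qed

lemma compact_hom_preserves:
  fixes \<kappa> :: "'a rel" and J :: "('j, 'i) cat"
  assumes \<kappa>: "inaccessible \<kappa>" and A: "compact_obj \<kappa> C A"
    and J: "small_cat \<kappa> J" "filtered J" and col: "is_colimit J C D X \<iota>"
  shows "hom_preserves C A J D X \<iota>"
proof -
  from \<kappa> J(1) obtain \<phi> :: "'j \<Rightarrow> 'a" and \<psi> :: "'i \<Rightarrow> 'a"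
    where t: "transported J \<phi> \<psi>" "small_cat \<kappa> (transport \<phi> \<psi> J)"
    by (rule ex_transport)
  interpret transported J \<phi> \<psi> by (rule t)
  have D: "is_functor J C D" using col by (simp add: is_colimit_def is_cocone_def)
  define \<nu> where "\<nu> j = \<iota> (inv_into (obj J) \<phi> j)" for j
  have \<nu>: "\<nu> (\<phi> j) = \<iota> j" if "j \<in> obj J" for j using that inj_\<phi> by (simp add: \<nu>_def)
  have "is_colimit J C D X (\<lambda>j. \<nu> (\<phi> j))"
    using col by (simp add: is_colimit_def is_cocone_def \<nu>)
  then have "is_colimit J' C (transport_fctr \<phi> \<psi> J D) X \<nu>"
    by (simp only: colimit_transport[OF D])
  from compact_hom_preserves_aux[OF \<kappa> A t(2) filtered_transport[OF J(2)] this]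
  show ?thesis by (simp add: hom_preserves_def \<nu>)
qed

text \<open>Converse of \<open>compact_hom_preserves\<close>, for one colimit at a time. The map out
  of \<open>hom C A X\<close> evaluates a cocone at any factorization of the given arrow through a
  stage.\<close>

lemma hom_preserves_filtered_colimit:
  fixes \<kappa> :: "'a rel" and J :: "('j, 'i) cat"
  assumes ls: "locally_small \<kappa> C" and A: "A \<in> obj C" and J: "filtered J"
    and col: "is_colimit J C D X \<iota>" and pres: "hom_preserves C A J D X \<iota>"
  shows "is_colimit J (set_cat \<kappa>) (fcomp J (hom_functor C A) D)
          (omap (hom_functor C A) X) (\<lambda>j. amap (hom_functor C A) (\<iota> j))"
proof -
  interpret J: filtered_cat J
    using J by (simp add: filtered_cat_def filtered_cat_axioms_def filtered_def)
  have coc: "is_cocone J C D X \<iota>" using col by (simp add: is_colimit_def)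
  have D: "is_functor J C D" using coc by (simp add: is_cocone_def)
  note D' = J.J.functorD[OF D]
  note \<iota> = coconeD[OF coc]
  let ?H = "fcomp J (hom_functor C A) D"
  have Hfun: "is_functor J (set_cat \<kappa>) ?H"
    by (rule functor_fcomp[OF J.J.category_axioms D functor_hom_functor[OF ls A]])
  have sm: "small \<kappa> (hom C A Z)" if "Z \<in> obj C" for Z
    using ls A that by (simp add: locally_small_def)
  have \<iota>c: "\<iota> (tgt J u) \<cdot> (amap D u \<cdot> b) = \<iota> (src J u) \<cdot> b"
    if "u \<in> arr J" "b \<in> hom C A (omap D (src J u))" for u b
    using cocone_cmp[OF J.J.category_axioms D coc] that by (simp add: in_hom)
  have cocS: "is_cocone J (set_cat \<kappa>) ?H (hom C A X) (\<lambda>j. amap (hom_functor C A) (\<iota> j))"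
    unfolding is_cocone_def
  proof (intro conjI ballI Hfun)
    show "hom C A X \<in> obj (set_cat \<kappa>)" using sm \<iota> by simp
    show "amap (hom_functor C A) (\<iota> j) \<in> hom (set_cat \<kappa>) (omap ?H j) (hom C A X)" if "j \<in> obj J" for j
      using that sm \<iota> D' by (auto simp: hom_set_cat in_hom)
    show "amap (hom_functor C A) (\<iota> (tgt J u)) \<cdot>\<^bsub>set_cat \<kappa>\<^esub> amap ?H u = amap (hom_functor C A) (\<iota> (src J u))"
      if "u \<in> arr J" for u
      using that \<iota>c[OF that] by (auto simp: D' \<iota> compose_def fun_eq_iff in_hom)
  qed
  have cov: "\<exists>j \<in> obj J. \<exists>b \<in> hom C A (omap D j). \<iota> j \<cdot> b = a" if "a \<in> hom C A X" for a
    using pres that by (simp add: hom_preserves_def)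
  have "\<exists>!h. h \<in> hom (set_cat \<kappa>) (hom C A X) Y \<and>
      (\<forall>j \<in> obj J. h \<cdot>\<^bsub>set_cat \<kappa>\<^esub> amap (hom_functor C A) (\<iota> j) = \<nu> j)"
    if \<nu>: "is_cocone J (set_cat \<kappa>) ?H Y \<nu>" for Y \<nu>
  proof -
    define n where "n j = snd (snd (\<nu> j))" for j
    have Y: "small \<kappa> Y" using \<nu> by (simp add: is_cocone_def)
    have \<nu>n: "\<nu> j = (hom C A (omap D j), Y, n j)" and nE: "n j \<in> hom C A (omap D j) \<rightarrow>\<^sub>E Y"
      if "j \<in> obj J" for j
      using \<nu> that unfolding is_cocone_def n_def by (auto simp: hom_set_cat D' dest!: bspec[of _ _ j])
    have nc: "n (tgt J u) (amap D u \<cdot> b) = n (src J u) b"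
      if u: "u \<in> arr J" and b: "b \<in> hom C A (omap D (src J u))" for u b
    proof -
      have "\<nu> (tgt J u) \<cdot>\<^bsub>set_cat \<kappa>\<^esub> amap ?H u = \<nu> (src J u)"
        using \<nu> u by (simp add: is_cocone_def)
      then have "compose (hom C A (omap D (src J u))) (n (tgt J u))
          (\<lambda>g \<in> hom C A (omap D (src J u)). amap D u \<cdot> g) = n (src J u)"
        using u by (simp add: \<nu>n D')
      then show ?thesis using b by (auto simp: compose_def fun_eq_iff split: if_splits)
    qed
    \<comment> \<open>Independence of the factorization: moved to a common stage, the two
      representatives agree in the colimit, hence already at some later stage.\<close>
    have wd: "n j b = n k b'"
      if j: "j \<in> obj J" and k: "k \<in> obj J" and b: "b \<in> hom C A (omap D j)" and b': "b' \<in> hom C A (omap D k)"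
        and eq: "\<iota> j \<cdot> b = \<iota> k \<cdot> b'" for j k b b'
    proof -
      obtain u v where uv: "u \<in> arr J" "v \<in> arr J" "src J u = j" "src J v = k" "tgt J u = tgt J v"
        using J.upper_bound[OF j k] .
      let ?x = "amap D u \<cdot> b" and ?y = "amap D v \<cdot> b'"
      have xy: "?x \<in> hom C A (omap D (tgt J u))" "?y \<in> hom C A (omap D (tgt J u))"
        using uv b b' by (auto simp: in_hom D')
      have "\<iota> (tgt J u) \<cdot> ?x = \<iota> (tgt J u) \<cdot> ?y"
        using \<iota>c[of u b] \<iota>c[of v b'] uv b b' eq by simp
      then obtain w where w: "w \<in> arr J" "src J w = tgt J u" "amap D w \<cdot> ?x = amap D w \<cdot> ?y"
        using pres xy uv(1) J.J.tgt_obj[of u] unfolding hom_preserves_def by blast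
      have "n j b = n (tgt J u) ?x" using nc[of u b] uv b by simp
      also have "\<dots> = n (tgt J w) (amap D w \<cdot> ?x)" using nc[of w ?x] w xy by simp
      also have "\<dots> = n (tgt J w) (amap D w \<cdot> ?y)" using w by simp
      also have "\<dots> = n (tgt J u) ?y" using nc[of w ?y] w xy by simp
      also have "\<dots> = n k b'" using nc[of v b'] uv b' by simp
      finally show ?thesis .
    qed
    have "\<exists>y. \<forall>j \<in> obj J. \<forall>b \<in> hom C A (omap D j). \<iota> j \<cdot> b = a \<longrightarrow> n j b = y" for a
      using wd by metis
    then obtain m where m: "\<And>a j b. j \<in> obj J \<Longrightarrow> b \<in> hom C A (omap D j) \<Longrightarrow> \<iota> j \<cdot> b = a \<Longrightarrow> n j b = m a"
      by metis
    have mY: "m a \<in> Y" if "a \<in> hom C A X" for a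
      using cov[OF that] m nE by (metis PiE_mem)
    let ?h = "(hom C A X, Y, restrict m (hom C A X))"
    have \<iota>b: "\<iota> j \<cdot> b \<in> hom C A X" if "j \<in> obj J" "b \<in> hom C A (omap D j)" for j b
      using that \<iota> by (simp add: in_hom)
    show ?thesis
    proof (rule ex1I[of _ ?h])
      show "?h \<in> hom (set_cat \<kappa>) (hom C A X) Y \<and>
          (\<forall>j \<in> obj J. ?h \<cdot>\<^bsub>set_cat \<kappa>\<^esub> amap (hom_functor C A) (\<iota> j) = \<nu> j)"
      proof (intro conjI ballI)
        show "?h \<in> hom (set_cat \<kappa>) (hom C A X) Y"
          using mY sm \<iota>(1) Y by (simp add: hom_set_cat)
        fix j assume j: "j \<in> obj J"
        have "compose (hom C A (omap D j)) (restrict m (hom C A X)) (\<lambda>g \<in> hom C A (omap D j). \<iota> j \<cdot> g) = n j"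
          using \<iota>b[OF j] m[OF j] nE[OF j] by (auto simp: compose_def fun_eq_iff PiE_iff extensional_def)
        then show "?h \<cdot>\<^bsub>set_cat \<kappa>\<^esub> amap (hom_functor C A) (\<iota> j) = \<nu> j"
          using j by (simp add: \<iota> \<nu>n)
      qed
    next
      fix h assume h: "h \<in> hom (set_cat \<kappa>) (hom C A X) Y \<and>
          (\<forall>j \<in> obj J. h \<cdot>\<^bsub>set_cat \<kappa>\<^esub> amap (hom_functor C A) (\<iota> j) = \<nu> j)"
      then obtain k where k: "h = (hom C A X, Y, k)" "k \<in> hom C A X \<rightarrow>\<^sub>E Y" by (auto simp: hom_set_cat)
      have "k a = m a" if a: "a \<in> hom C A X" for a
      proof -
        obtain j b where jb: "j \<in> obj J" "b \<in> hom C A (omap D j)" "\<iota> j \<cdot> b = a" using cov[OF a] by blast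
        have "h \<cdot>\<^bsub>set_cat \<kappa>\<^esub> amap (hom_functor C A) (\<iota> j) = \<nu> j" using h jb(1) by blast
        then have "compose (hom C A (omap D j)) k (\<lambda>g \<in> hom C A (omap D j). \<iota> j \<cdot> g) = n j"
          using jb(1) by (simp add: k \<iota> \<nu>n)
        then have "k (\<iota> j \<cdot> b) = n j b" using jb(2) by (auto simp: compose_def fun_eq_iff split: if_splits)
        then show ?thesis using m[OF jb] jb(3) by simp
      qed
      then have "k = restrict m (hom C A X)" using k(2) by (auto simp: fun_eq_iff PiE_iff extensional_def)
      then show "h = ?h" using k by simp
    qed
  qed
  then show ?thesis using cocS \<iota>(1) unfolding is_colimit_def by simp
qed

lemma compact_objI:
  fixes \<kappa> :: "'a rel"
  assumes "locally_small \<kappa> C" "A \<in> obj C"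
    and "\<And>(J :: ('a, 'a) cat) D X \<iota>. small_cat \<kappa> J \<Longrightarrow> filtered J \<Longrightarrow> is_colimit J C D X \<iota> \<Longrightarrow>
      hom_preserves C A J D X \<iota>"
  shows "compact_obj \<kappa> C A"
  unfolding compact_obj_def
proof (intro conjI allI impI assms(2))
  fix J :: "('a, 'a) cat" and D X \<iota>
  assume J: "small_cat \<kappa> J \<and> filtered J \<and> is_colimit J C D X \<iota>"
  then have "hom_preserves C A J D X \<iota>" by (intro assms(3)) simp_all
  then show "is_colimit J (set_cat \<kappa>) (fcomp J (hom_functor C A) D)
          (omap (hom_functor C A) X) (\<lambda>j. amap (hom_functor C A) (\<iota> j))"
    using J by (intro hom_preserves_filtered_colimit[OF assms(1,2)]) simp_all
qed

end

section \<open>Pushouts and initial objects, and their compactness\<close>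

context category
begin

lemma ex_pushout:
  fixes \<kappa> :: "'u rel"
  assumes \<kappa>: "inaccessible \<kappa>" and cc: "cocomplete \<kappa> C"
    and f: "f \<in> arr C" "g \<in> arr C" "src C g = src C f"
  obtains p q where "pushout C f g p q"
proof -
  \<comment> \<open>The walking span: 0 is the apex, 1 and 2 are the feet.\<close>
  let ?P = "{0, 1, 2 :: nat}" and ?r = "{(0, 0), (1, 1), (2, 2), (0, 1), (0, 2)} :: (nat \<times> nat) set"
  let ?J = "thin ?P ?r"
  have cat: "category ?J" by (rule category_thin) (auto simp: trans_def)
  have sm: "small_cat \<kappa> ?J" using cat \<kappa> by (simp add: small_cat_def small_finite)
  define D where "D = \<lparr>omap = (\<lambda>j \<in> ?P. if j = 0 then src C f else if j = 1 then tgt C f else tgt C g),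
    amap = (\<lambda>u \<in> ?r. if u = (0, 1) then f else if u = (0, 2) then g
      else if u = (0, 0) then ide C (src C f) else if u = (1, 1) then ide C (tgt C f)
      else ide C (tgt C g))\<rparr>"
  have D [simp]: "omap D 0 = src C f" "omap D (Suc 0) = tgt C f" "omap D 2 = tgt C g"
    "amap D (0, Suc 0) = f" "amap D (0, 2) = g" "amap D (0, 0) = ide C (src C f)"
    "amap D (Suc 0, Suc 0) = ide C (tgt C f)" "amap D (2, 2) = ide C (tgt C g)"
    by (simp_all add: D_def)
  have "omap D \<in> extensional ?P" "amap D \<in> extensional ?r" by (simp_all add: D_def)
  then have fD: "is_functor ?J C D" using f by (simp add: is_functor_def PiE_iff)
  have coc: "is_cocone ?J C D X \<nu> \<longleftrightarrow> \<nu> 1 \<in> hom C (tgt C f) X \<and> \<nu> 2 \<in> hom C (tgt C g) X \<and>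
      \<nu> 0 = \<nu> 1 \<cdot> f \<and> \<nu> 2 \<cdot> g = \<nu> 1 \<cdot> f" for X \<nu>
    using f fD by (auto simp: is_cocone_def in_hom)
  obtain Q \<iota> where col: "is_colimit ?J C D Q \<iota>" using ex_colimit[OF \<kappa> cc sm fD] by blast
  then have "is_cocone ?J C D Q \<iota>" by (simp only: is_colimit_def)
  then have \<iota>: "\<iota> 1 \<in> hom C (tgt C f) Q" "\<iota> 2 \<in> hom C (tgt C g) Q" "\<iota> 1 \<cdot> f = \<iota> 0" "\<iota> 2 \<cdot> g = \<iota> 0"
    unfolding coc by simp_all
  have univ: "\<exists>!h. h \<in> hom C Q X \<and> h \<cdot> \<iota> 0 = u \<cdot> f \<and> h \<cdot> \<iota> 1 = u \<and> h \<cdot> \<iota> 2 = v"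
    if "u \<in> hom C (tgt C f) X" "v \<in> hom C (tgt C g) X" "u \<cdot> f = v \<cdot> g" for u v X
  proof -
    let ?\<nu> = "\<lambda>j :: nat. if j = 0 then u \<cdot> f else if j = 1 then u else v"
    have "is_cocone ?J C D X ?\<nu>" unfolding coc using that by simp
    then have "\<exists>!h. h \<in> hom C Q X \<and> (\<forall>j \<in> obj ?J. h \<cdot> \<iota> j = ?\<nu> j)"
      using col unfolding is_colimit_def by blast
    then show ?thesis by simp
  qed
  have "pushout C f g (\<iota> 1) (\<iota> 2)"
  proof (rule pushoutI)
    fix u v assume "u \<in> arr C" "v \<in> arr C" "src C u = tgt C f" "src C v = tgt C g"
      "tgt C v = tgt C u" "u \<cdot> f = v \<cdot> g"
    then show "\<exists>h. h \<in> arr C \<and> src C h = tgt C (\<iota> 1) \<and> tgt C h = tgt C u \<and> h \<cdot> \<iota> 1 = u \<and> h \<cdot> \<iota> 2 = v"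
      using univ[of u "tgt C u" v] \<iota> by (auto simp: in_hom)
  next
    fix h k assume hk: "h \<in> arr C" "k \<in> arr C" "src C h = tgt C (\<iota> 1)" "src C k = tgt C (\<iota> 1)"
      "tgt C k = tgt C h" "h \<cdot> \<iota> 1 = k \<cdot> \<iota> 1" "h \<cdot> \<iota> 2 = k \<cdot> \<iota> 2"
    have *: "(m \<cdot> \<iota> 1) \<cdot> f = m \<cdot> \<iota> 0" "(m \<cdot> \<iota> 2) \<cdot> g = m \<cdot> \<iota> 0"
      if "m \<in> arr C" "src C m = Q" for m
      using that \<iota> f by (auto simp: in_hom cmp_assoc)
    show "h = k"
      using univ[of "k \<cdot> \<iota> 1" "tgt C h" "k \<cdot> \<iota> 2"] hk \<iota> *[of h] *[of k] by (auto simp: in_hom)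
  qed (use f \<iota> in \<open>auto simp: in_hom\<close>)
  then show ?thesis by (rule that)
qed

lemma ex_initial:
  fixes \<kappa> :: "'u rel"
  assumes \<kappa>: "inaccessible \<kappa>" and cc: "cocomplete \<kappa> C"
  obtains I where "initial C I"
proof -
  let ?J = "thin ({} :: nat set) {}"
  have cat: "category ?J" by (rule category_thin) auto
  have sm: "small_cat \<kappa> ?J" using cat \<kappa> by (simp add: small_cat_def small_finite)
  let ?D = "\<lparr>omap = \<lambda>_. undefined, amap = \<lambda>_. undefined\<rparr>"
  have fD: "is_functor ?J C ?D" by (simp add: is_functor_def)
  obtain I \<iota> where col: "is_colimit ?J C ?D I \<iota>" using ex_colimit[OF \<kappa> cc sm fD] by blast
  have coc: "is_cocone ?J C ?D X \<nu> \<longleftrightarrow> X \<in> obj C" for X \<nu> by (simp add: is_cocone_def fD)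
  have "initial C I" using col by (auto simp: is_colimit_def coc initial_def)
  then show ?thesis by (rule that)
qed

lemma initial_arrow:
  assumes "initial C I" "A \<in> obj C"
  obtains f where "f \<in> arr C" "src C f = I" "tgt C f = A"
  using assms unfolding initial_def by (auto simp: in_hom)

lemma initial_unique:
  assumes "initial C I" "f \<in> arr C" "g \<in> arr C" "src C f = I" "src C g = I" "tgt C g = tgt C f"
  shows "f = g"
proof -
  have "\<exists>!h. h \<in> hom C I (tgt C f)" using assms by (simp add: initial_def)
  then show ?thesis using assms by (auto simp: in_hom)
qed

text \<open>Each stage receives exactly one arrow from \<open>I\<close>. Factorizations exist
  because a filtered category has an object, and equality of arrows out of \<open>I\<close> is
  automatic.\<close>

lemma compact_initial:
  fixes \<kappa> :: "'a rel"
  assumes "locally_small \<kappa> C" "initial C I"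
  shows "compact_obj \<kappa> C I"
proof (rule compact_objI[OF assms(1)])
  show I: "I \<in> obj C" using assms by (simp add: initial_def)
  fix J :: "('a, 'a) cat" and D X \<iota>
  assume J: "filtered J" and col: "is_colimit J C D X \<iota>"
  interpret J: filtered_cat J using J by (simp add: filtered_cat_def filtered_cat_axioms_def filtered_def)
  have coc: "is_cocone J C D X \<iota>" using col by (simp add: is_colimit_def)
  have D: "is_functor J C D" using coc by (simp add: is_cocone_def)
  note D' = J.J.functorD[OF D]
  note \<iota> = coconeD[OF coc]
  obtain j where j: "j \<in> obj J" using J by (auto simp: filtered_def)
  obtain b where b: "b \<in> arr C" "src C b = I" "tgt C b = omap D j"
    using initial_arrow[OF assms(2)] D'(1)[OF j] by blast
  have "\<iota> j \<cdot> b = a" if "a \<in> hom C I X" for a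
    by (rule initial_unique[OF assms(2)]) (use that b j \<iota> in \<open>auto simp: in_hom\<close>)
  moreover have "b \<in> hom C I (omap D j)" using b by (simp add: in_hom)
  moreover have "\<exists>u \<in> arr J. src J u = k \<and> amap D u \<cdot> c = amap D u \<cdot> c'"
    if "k \<in> obj J" "c \<in> hom C I (omap D k)" "c' \<in> hom C I (omap D k)" for k c c'
    using that initial_unique[OF assms(2), of c c'] by (intro bexI[of _ "ide J k"]) (auto simp: in_hom)
  ultimately show "hom_preserves C I J D X \<iota>" using j unfolding hom_preserves_def by blast
qed

text \<open>Arrows out of a pushout are compatible pairs. Both components factor through a common
  stage, and compactness of \<open>src C e\<close> makes them compatible at a later one.\<close>

lemma compact_pushout:
  fixes \<kappa> :: "'a rel"
  assumes \<kappa>: "inaccessible \<kappa>" and ls: "locally_small \<kappa> C" and po: "pushout C e f p q"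
    and cpt: "compact_obj \<kappa> C (src C e)" "compact_obj \<kappa> C (tgt C e)" "compact_obj \<kappa> C (tgt C f)"
  shows "compact_obj \<kappa> C (tgt C p)"
proof (rule compact_objI[OF ls])
  note P = pushoutD[OF po]
  show "tgt C p \<in> obj C" using P by simp
  fix J :: "('a, 'a) cat" and D X \<iota>
  assume J: "small_cat \<kappa> J" "filtered J" and col: "is_colimit J C D X \<iota>"
  interpret J: filtered_cat J using J by (simp add: filtered_cat_def filtered_cat_axioms_def filtered_def)
  have coc: "is_cocone J C D X \<iota>" using col by (simp add: is_colimit_def)
  have D: "is_functor J C D" using coc by (simp add: is_cocone_def)
  note D' = J.J.functorD[OF D]
  note \<iota> = coconeD[OF coc]
  note \<iota>c = cocone_cmp[OF J.J.category_axioms D coc]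
  have cov: "\<exists>j b. j \<in> obj J \<and> b \<in> arr C \<and> src C b = A \<and> tgt C b = omap D j \<and> \<iota> j \<cdot> b = a"
    if "compact_obj \<kappa> C A" "a \<in> arr C" "src C a = A" "tgt C a = X" for A a
  proof -
    note cpt' = that(1)
    have "a \<in> hom C A X" using that by (simp add: in_hom)
    then obtain j b where "j \<in> obj J" "b \<in> hom C A (omap D j)" "\<iota> j \<cdot> b = a"
      using compact_hom_preserves[OF \<kappa> cpt' J col] unfolding hom_preserves_def by blast
    then show ?thesis by (auto simp: in_hom)
  qed
  have inj: "\<exists>u \<in> arr J. src J u = j \<and> amap D u \<cdot> b = amap D u \<cdot> b'"
    if "compact_obj \<kappa> C (src C b)" "j \<in> obj J" "b \<in> arr C" "b' \<in> arr C" "src C b' = src C b"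
      "tgt C b = omap D j" "tgt C b' = omap D j" "\<iota> j \<cdot> b = \<iota> j \<cdot> b'" for j b b'
    using compact_hom_preserves[OF \<kappa> that(1) J col] that unfolding hom_preserves_def
    by (simp add: in_hom)
  show "hom_preserves C (tgt C p) J D X \<iota>"
    unfolding hom_preserves_def
  proof (intro conjI ballI impI)
    fix a assume "a \<in> hom C (tgt C p) X"
    then have a: "a \<in> arr C" "src C a = tgt C p" "tgt C a = X" by (auto simp: in_hom)
    obtain j b where b: "j \<in> obj J" "b \<in> arr C" "src C b = tgt C e" "tgt C b = omap D j" "\<iota> j \<cdot> b = a \<cdot> p"
      using cov[OF cpt(2), of "a \<cdot> p"] a P by auto
    obtain k c where c: "k \<in> obj J" "c \<in> arr C" "src C c = tgt C f" "tgt C c = omap D k" "\<iota> k \<cdot> c = a \<cdot> q"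
      using cov[OF cpt(3), of "a \<cdot> q"] a P by auto
    obtain u v where uv: "u \<in> arr J" "v \<in> arr J" "src J u = j" "src J v = k" "tgt J u = tgt J v"
      using J.upper_bound[OF b(1) c(1)] .
    define l where "l = tgt J v"
    define b1 where "b1 = amap D u \<cdot> b"
    define c1 where "c1 = amap D v \<cdot> c"
    have l: "l \<in> obj J" using uv by (simp add: l_def)
    have b1: "b1 \<in> arr C" "src C b1 = tgt C e" "tgt C b1 = omap D l" "\<iota> l \<cdot> b1 = a \<cdot> p"
      using b uv D' \<iota>c[of u b] by (auto simp: b1_def l_def)
    have c1: "c1 \<in> arr C" "src C c1 = tgt C f" "tgt C c1 = omap D l" "\<iota> l \<cdot> c1 = a \<cdot> q"
      using c uv D' \<iota>c[of v c] by (auto simp: c1_def l_def)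
    \<comment> \<open>The factorizations \<open>b1\<close> and \<open>c1\<close> agree on
      \<open>src C e\<close> only in the colimit; \<open>w\<close> leads to a stage where they
      agree.\<close>
    have "\<iota> l \<cdot> (b1 \<cdot> e) = (\<iota> l \<cdot> b1) \<cdot> e" using b1(1-3) P \<iota> l by (simp add: cmp_assoc)
    also have "\<dots> = a \<cdot> (q \<cdot> f)" using a P by (simp add: b1 cmp_assoc)
    also have "\<dots> = (\<iota> l \<cdot> c1) \<cdot> f" using a P by (simp add: c1 cmp_assoc)
    also have "\<dots> = \<iota> l \<cdot> (c1 \<cdot> f)" using c1(1-3) P \<iota> l by (simp add: cmp_assoc)
    finally obtain w where w: "w \<in> arr J" "src J w = l" "amap D w \<cdot> (b1 \<cdot> e) = amap D w \<cdot> (c1 \<cdot> f)"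
      using inj[of "b1 \<cdot> e" l "c1 \<cdot> f"] b1 c1 P cpt l by auto
    obtain h where h: "h \<in> arr C" "src C h = tgt C p" "tgt C h = omap D (tgt J w)"
        "h \<cdot> p = amap D w \<cdot> b1" "h \<cdot> q = amap D w \<cdot> c1"
      by (rule pushout_map[OF po, of "amap D w \<cdot> b1" "amap D w \<cdot> c1"])
        (use w b1 c1 P D' in \<open>auto simp: cmp_assoc\<close>)
    have "\<iota> (tgt J w) \<cdot> h = a"
    proof (rule pushout_unique[OF po])
      show "(\<iota> (tgt J w) \<cdot> h) \<cdot> p = a \<cdot> p"
        using h w P \<iota>c[of w b1] b1 \<iota> by (simp add: cmp_assoc)
      show "(\<iota> (tgt J w) \<cdot> h) \<cdot> q = a \<cdot> q"
        using h w P \<iota>c[of w c1] c1 \<iota> by (simp add: cmp_assoc)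
    qed (use a h w \<iota> in auto)
    then show "\<exists>j \<in> obj J. \<exists>b \<in> hom C (tgt C p) (omap D j). \<iota> j \<cdot> b = a"
      using h w by (intro bexI[of _ "tgt J w"] bexI[of _ h]) (auto simp: in_hom)
  next
    fix j b b' assume j: "j \<in> obj J" and "b \<in> hom C (tgt C p) (omap D j)" "b' \<in> hom C (tgt C p) (omap D j)"
      and eq: "\<iota> j \<cdot> b = \<iota> j \<cdot> b'"
    then have b: "b \<in> arr C" "src C b = tgt C p" "tgt C b = omap D j"
      "b' \<in> arr C" "src C b' = tgt C p" "tgt C b' = omap D j" by (auto simp: in_hom)
    have eq': "\<iota> j \<cdot> (b \<cdot> x) = \<iota> j \<cdot> (b' \<cdot> x)" if "x \<in> arr C" "tgt C x = tgt C p" for x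
      using that eq b j \<iota> by (simp add: cmp_assoc[symmetric])
    obtain u where u: "u \<in> arr J" "src J u = j" "amap D u \<cdot> (b \<cdot> p) = amap D u \<cdot> (b' \<cdot> p)"
      using inj[of "b \<cdot> p" j "b' \<cdot> p"] b P cpt j eq'[of p] by auto
    \<comment> \<open>The second component is compared only after \<open>u\<close> has identified
      the first, so that the composite transition identifies both.\<close>
    let ?c = "amap D u \<cdot> (b \<cdot> q)" and ?c' = "amap D u \<cdot> (b' \<cdot> q)"
    have "\<iota> (tgt J u) \<cdot> ?c = \<iota> (tgt J u) \<cdot> ?c'"
      using \<iota>c[of u "b \<cdot> q"] \<iota>c[of u "b' \<cdot> q"] u b P eq'[of q] by simp
    then obtain v where v: "v \<in> arr J" "src J v = tgt J u" "amap D v \<cdot> ?c = amap D v \<cdot> ?c'"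
      using inj[of ?c "tgt J u" ?c'] b P cpt u D' by auto
    have "amap D (cmp J v u) \<cdot> b = amap D (cmp J v u) \<cdot> b'"
    proof (rule pushout_unique[OF po])
      show "(amap D (cmp J v u) \<cdot> b) \<cdot> p = (amap D (cmp J v u) \<cdot> b') \<cdot> p"
        using u v b P D' by (simp add: cmp_assoc)
      show "(amap D (cmp J v u) \<cdot> b) \<cdot> q = (amap D (cmp J v u) \<cdot> b') \<cdot> q"
        using u v b P D' by (simp add: cmp_assoc)
    qed (use u v b D' in auto)
    then show "\<exists>w \<in> arr J. src J w = j \<and> amap D w \<cdot> b = amap D w \<cdot> b'"
      using u v by (intro bexI[of _ "cmp J v u"]) auto
  qed
qed

section \<open>Lifting properties and closure of left classes\<close>

lemma liftsI:
  assumes "\<And>u v. u \<in> arr C \<Longrightarrow> v \<in> arr C \<Longrightarrow> src C u = src C l \<Longrightarrow> tgt C u = src C r \<Longrightarrow>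
      src C v = tgt C l \<Longrightarrow> tgt C v = tgt C r \<Longrightarrow> r \<cdot> u = v \<cdot> l \<Longrightarrow>
      \<exists>h. h \<in> arr C \<and> src C h = tgt C l \<and> tgt C h = src C r \<and> h \<cdot> l = u \<and> r \<cdot> h = v"
  shows "lifts C l r"
  using assms by (force simp: lifts_def in_hom)

lemma liftsE:
  assumes "lifts C l r" "u \<in> arr C" "v \<in> arr C" "src C u = src C l" "tgt C u = src C r"
    "src C v = tgt C l" "tgt C v = tgt C r" "r \<cdot> u = v \<cdot> l"
  obtains h where "h \<in> arr C" "src C h = tgt C l" "tgt C h = src C r" "h \<cdot> l = u" "r \<cdot> h = v"
  using assms by (force simp: lifts_def in_hom)

lemma isoE:
  assumes "is_iso C f"
  obtains g where "f \<in> arr C" "g \<in> arr C" "src C g = tgt C f" "tgt C g = src C f"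
    "g \<cdot> f = ide C (src C f)" "f \<cdot> g = ide C (tgt C f)"
  using assms by (auto simp: is_iso_def in_hom)

lemma llp_iso:
  assumes "is_iso C f" "R \<subseteq> arr C"
  shows "f \<in> llp C R"
proof -
  obtain g where g: "f \<in> arr C" "g \<in> arr C" "src C g = tgt C f" "tgt C g = src C f"
    "g \<cdot> f = ide C (src C f)" "f \<cdot> g = ide C (tgt C f)" using isoE[OF assms(1)] .
  have "lifts C f r" if "r \<in> R" for r
  proof (rule liftsI)
    fix u v assume uv: "u \<in> arr C" "v \<in> arr C" "src C u = src C f" "tgt C u = src C r"
      "src C v = tgt C f" "tgt C v = tgt C r" "r \<cdot> u = v \<cdot> f"
    have "r \<in> arr C" using assms(2) that by blast
    then have "r \<cdot> (u \<cdot> g) = (v \<cdot> f) \<cdot> g" using uv g by (simp add: cmp_assoc[symmetric])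
    also have "\<dots> = v" using uv g by (simp add: cmp_assoc)
    finally show "\<exists>h. h \<in> arr C \<and> src C h = tgt C f \<and> tgt C h = src C r \<and> h \<cdot> f = u \<and> r \<cdot> h = v"
      using uv g by (intro exI[of _ "u \<cdot> g"]) (simp add: cmp_assoc)
  qed
  then show ?thesis using g by (simp add: llp_def)
qed

lemma llp_cmp:
  assumes e: "e \<in> llp C R" "e' \<in> llp C R" "tgt C e = src C e'" and R: "R \<subseteq> arr C"
  shows "e' \<cdot> e \<in> llp C R"
proof -
  have a: "e \<in> arr C" "e' \<in> arr C" using e by (auto simp: llp_def)
  have "lifts C (e' \<cdot> e) r" if "r \<in> R" for r
  proof (rule liftsI)
    fix u v assume uv: "u \<in> arr C" "v \<in> arr C" "src C u = src C (e' \<cdot> e)" "tgt C u = src C r"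
      "src C v = tgt C (e' \<cdot> e)" "tgt C v = tgt C r" "r \<cdot> u = v \<cdot> (e' \<cdot> e)"
    have r: "r \<in> arr C" "lifts C e r" "lifts C e' r" using R that e by (auto simp: llp_def)
    obtain h where h: "h \<in> arr C" "src C h = tgt C e" "tgt C h = src C r" "h \<cdot> e = u" "r \<cdot> h = v \<cdot> e'"
      by (rule liftsE[OF r(2), of u "v \<cdot> e'"]) (use uv a e r in \<open>auto simp: cmp_assoc\<close>)
    obtain k where k: "k \<in> arr C" "src C k = tgt C e'" "tgt C k = src C r" "k \<cdot> e' = h" "r \<cdot> k = v"
      by (rule liftsE[OF r(3), of h v]) (use uv a e r h in auto)
    have "k \<cdot> (e' \<cdot> e) = u" using k a e h by (simp add: cmp_assoc[symmetric])
    then show "\<exists>h. h \<in> arr C \<and> src C h = tgt C (e' \<cdot> e) \<and> tgt C h = src C r \<and> h \<cdot> (e' \<cdot> e) = u \<and> r \<cdot> h = v"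
      using k a e by auto
  qed
  then show ?thesis using a e by (simp add: llp_def)
qed

lemma llp_pushout:
  assumes e: "e \<in> llp C R" and po: "pushout C e f p q" and R: "R \<subseteq> arr C"
  shows "q \<in> llp C R"
proof -
  note P = pushoutD[OF po]
  have "lifts C q r" if "r \<in> R" for r
  proof (rule liftsI)
    fix u v assume uv: "u \<in> arr C" "v \<in> arr C" "src C u = src C q" "tgt C u = src C r"
      "src C v = tgt C q" "tgt C v = tgt C r" "r \<cdot> u = v \<cdot> q"
    have r: "r \<in> arr C" "lifts C e r" using R that e by (auto simp: llp_def)
    have "r \<cdot> (u \<cdot> f) = (v \<cdot> q) \<cdot> f" using uv P r by (simp add: cmp_assoc[symmetric])
    also have "\<dots> = (v \<cdot> p) \<cdot> e" using uv P r by (simp add: cmp_assoc)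
    finally have eq: "r \<cdot> (u \<cdot> f) = (v \<cdot> p) \<cdot> e" .
    obtain h where h: "h \<in> arr C" "src C h = tgt C e" "tgt C h = src C r" "h \<cdot> e = u \<cdot> f" "r \<cdot> h = v \<cdot> p"
      by (rule liftsE[OF r(2), of "u \<cdot> f" "v \<cdot> p"]) (use uv P r eq in auto)
    obtain k where k: "k \<in> arr C" "src C k = tgt C p" "tgt C k = src C r" "k \<cdot> p = h" "k \<cdot> q = u"
      by (rule pushout_map[OF po, of h u]) (use uv P h in auto)
    have "r \<cdot> k = v"
      by (rule pushout_unique[OF po]) (use uv P h k r in \<open>auto simp: cmp_assoc\<close>)
    then show "\<exists>h. h \<in> arr C \<and> src C h = tgt C q \<and> tgt C h = src C r \<and> h \<cdot> q = u \<and> r \<cdot> h = v"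
      using k P by auto
  qed
  then show ?thesis using P by (simp add: llp_def)
qed

text \<open>Serves to replace the apex of a pushout by an isomorphic object of the small
  replacement.\<close>

lemma pushout_iso:
  assumes po: "pushout C f g p q" and i: "is_iso C i" "src C i = tgt C p"
  shows "pushout C f g (i \<cdot> p) (i \<cdot> q)"
proof -
  note P = pushoutD[OF po]
  obtain j where j: "i \<in> arr C" "j \<in> arr C" "src C j = tgt C i" "tgt C j = src C i"
    "j \<cdot> i = ide C (src C i)" "i \<cdot> j = ide C (tgt C i)" using isoE[OF i(1)] .
  show ?thesis
  proof (rule pushoutI)
    fix u v assume uv: "u \<in> arr C" "v \<in> arr C" "src C u = tgt C f" "src C v = tgt C g"
      "tgt C v = tgt C u" "u \<cdot> f = v \<cdot> g"
    obtain h where h: "h \<in> arr C" "src C h = tgt C p" "tgt C h = tgt C u" "h \<cdot> p = u" "h \<cdot> q = v"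
      by (rule pushout_map[OF po, of u v]) (use uv in auto)
    have *: "(h \<cdot> j) \<cdot> (i \<cdot> x) = h \<cdot> x" if "x \<in> arr C" "tgt C x = tgt C p" for x
      using that h i j by (simp add: assoc4[of x "src C x" "tgt C p" i "tgt C i" j "tgt C p" h "tgt C h"] in_hom)
    show "\<exists>h. h \<in> arr C \<and> src C h = tgt C (i \<cdot> p) \<and> tgt C h = tgt C u \<and> h \<cdot> (i \<cdot> p) = u \<and> h \<cdot> (i \<cdot> q) = v"
      using h i j P * by (intro exI[of _ "h \<cdot> j"]) simp
  next
    fix h k assume hk: "h \<in> arr C" "k \<in> arr C" "src C h = tgt C (i \<cdot> p)" "src C k = tgt C (i \<cdot> p)"
      "tgt C k = tgt C h" "h \<cdot> (i \<cdot> p) = k \<cdot> (i \<cdot> p)" "h \<cdot> (i \<cdot> q) = k \<cdot> (i \<cdot> q)"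
    have "h \<cdot> i = k \<cdot> i"
      by (rule pushout_unique[OF po]) (use hk i j P in \<open>auto simp: cmp_assoc\<close>)
    then have "(h \<cdot> i) \<cdot> j = (k \<cdot> i) \<cdot> j" by simp
    then show "h = k" using hk i j P by (simp add: cmp_assoc)
  qed (use P i j in \<open>auto simp: cmp_assoc\<close>)
qed

end

section \<open>Small replacements of the compact zero-extensions\<close>

locale clan_algebraic_category = category L for L :: "('o, 'u) cat" (structure) +
  fixes \<kappa> :: "'u rel" and E F :: "'u set" and S :: "'o set"
  assumes inacc: "inaccessible \<kappa>"
    and clan_alg: "clan_algebraic \<kappa> L E F"
    and replacement: "small_replacement \<kappa> L (compact_0_exts \<kappa> L E) S"
begin

abbreviation "P \<equiv> compact_0_exts \<kappa> L E"

lemma locally_small: "locally_small \<kappa> L" and cocomplete: "cocomplete \<kappa> L"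
  and E_eq: "E = llp L F" and F_eq: "F = rlp L E" and E_arr: "E \<subseteq> arr L" and F_arr: "F \<subseteq> arr L"
  using clan_alg unfolding clan_algebraic_def EF_category_def locally_finitely_presentable_def
    weak_factorization_system_def by blast+

lemma E_iso: "is_iso L f \<Longrightarrow> f \<in> E"
  and E_cmp: "e \<in> E \<Longrightarrow> e' \<in> E \<Longrightarrow> tgt L e = src L e' \<Longrightarrow> e' \<cdot> e \<in> E"
  and E_pushout: "e \<in> E \<Longrightarrow> pushout L e f p q \<Longrightarrow> q \<in> E"
  using llp_iso[of f F] llp_cmp[of e F e'] llp_pushout[of e F f p q] F_arr unfolding E_eq[symmetric] by simp_all

lemma S_P: "A \<in> S \<Longrightarrow> A \<in> P" and S_small: "small \<kappa> S"
  using replacement by (auto simp: small_replacement_def)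

lemma P_obj: "A \<in> P \<Longrightarrow> A \<in> obj L"
  by (simp add: compact_0_exts_def zero_extension_def)

lemma S_obj [simp]: "A \<in> S \<Longrightarrow> A \<in> obj L"
  by (simp add: S_P P_obj)

lemma S_subset: "S \<subseteq> obj L"
  by auto

lemma S_compact: "A \<in> S \<Longrightarrow> compact_obj \<kappa> L A"
  using S_P by (simp add: compact_0_exts_def)

lemma is_isoI:
  assumes "f \<in> arr L" "g \<in> arr L" "src L g = tgt L f" "tgt L g = src L f"
    "g \<cdot> f = ide L (src L f)" "f \<cdot> g = ide L (tgt L f)"
  shows "is_iso L f"
  using assms by (auto simp: is_iso_def in_hom)

lemma S_replace:
  assumes "A \<in> P"
  obtains i j where "i \<in> arr L" "j \<in> arr L" "src L i = A" "tgt L i \<in> S" "src L j = tgt L i" "tgt L j = A"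
    "j \<cdot> i = ide L A" "i \<cdot> j = ide L (tgt L i)" "is_iso L i" "is_iso L j"
proof -
  obtain B i where B: "B \<in> S" "i \<in> hom L A B" "is_iso L i"
    using assms replacement unfolding small_replacement_def isomorphic_def by blast
  obtain j where j: "i \<in> arr L" "j \<in> arr L" "src L j = tgt L i" "tgt L j = src L i"
    "j \<cdot> i = ide L (src L i)" "i \<cdot> j = ide L (tgt L i)" using isoE[OF B(3)] .
  have "is_iso L j" by (rule is_isoI[of j i]) (use j in auto)
  then show ?thesis using that j B by (auto simp: in_hom)
qed

lemma initial_P: "initial L I \<Longrightarrow> I \<in> P"
proof -
  assume I: "initial L I"
  then have "I \<in> obj L" by (simp add: initial_def)
  then have "ide L I \<in> E" using E_iso is_isoI[of "ide L I" "ide L I"] by simp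
  then show ?thesis
    using I compact_initial[OF locally_small I] \<open>I \<in> obj L\<close> ide_hom
    unfolding compact_0_exts_def zero_extension_def by blast
qed

text \<open>Extensions are stable under pushout and composition, so \<open>q\<close> after an
  extension from an initial object to \<open>tgt L f\<close> is again an extension; compactness
  comes from \<open>compact_pushout\<close>.\<close>

lemma pushout_P:
  assumes "e \<in> E" "src L e \<in> P" "tgt L e \<in> P" "tgt L f \<in> P" and po: "pushout L e f p q"
  shows "tgt L p \<in> P"
proof -
  note D = pushoutD[OF po]
  have "compact_obj \<kappa> L (tgt L p)"
    using compact_pushout[OF inacc locally_small po] assms(2-4) by (simp add: compact_0_exts_def)
  moreover obtain I d where d: "initial L I" "d \<in> E" "d \<in> hom L I (tgt L f)"
    using assms(4) by (auto simp: compact_0_exts_def zero_extension_def)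
  then have "q \<cdot> d \<in> E" "q \<cdot> d \<in> hom L I (tgt L p)"
    using E_cmp[of d q] E_pushout[OF assms(1) po] D by (auto simp: in_hom)
  ultimately show ?thesis
    using d(1) D by (auto simp: compact_0_exts_def zero_extension_def)
qed

lemma initial_iso:
  assumes "initial L I" "is_iso L i" "src L i = I"
  shows "initial L (tgt L i)"
proof -
  obtain j where j: "i \<in> arr L" "j \<in> arr L" "src L j = tgt L i" "tgt L j = src L i"
    "j \<cdot> i = ide L (src L i)" "i \<cdot> j = ide L (tgt L i)" using isoE[OF assms(2)] .
  show ?thesis
    unfolding initial_def
  proof (intro conjI ballI)
    show "tgt L i \<in> obj L" using j by simp
    fix A assume A: "A \<in> obj L"
    obtain f where f: "f \<in> arr L" "src L f = I" "tgt L f = A"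
      using initial_arrow[OF assms(1) A] .
    show "\<exists>!f. f \<in> hom L (tgt L i) A"
    proof (rule ex1I[of _ "f \<cdot> j"])
      show "f \<cdot> j \<in> hom L (tgt L i) A" using f j assms(3) by (simp add: in_hom)
      fix g assume g: "g \<in> hom L (tgt L i) A"
      have "g \<cdot> i = f"
        by (rule initial_unique[OF assms(1)]) (use g f j assms(3) in \<open>auto simp: in_hom\<close>)
      then have "(g \<cdot> i) \<cdot> j = f \<cdot> j" by simp
      then show "g = f \<cdot> j" using g j by (simp add: in_hom cmp_assoc)
    qed
  qed
qed

lemma S_initial:
  obtains I where "I \<in> S" "initial L I"
proof -
  obtain I where I: "initial L I" using ex_initial[OF inacc cocomplete] .
  obtain i j where "src L i = I" "tgt L i \<in> S" "is_iso L i" using S_replace[OF initial_P[OF I]] .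
  then show ?thesis using that initial_iso[OF I] by blast
qed

lemma S_zero_extension:
  assumes "A \<in> S"
  obtains e where "e \<in> E" "src L e \<in> S" "initial L (src L e)" "tgt L e = A"
proof -
  obtain I d where d: "initial L I" "d \<in> E" "d \<in> hom L I A"
    using S_P[OF assms] by (auto simp: compact_0_exts_def zero_extension_def)
  obtain i j where i: "i \<in> arr L" "j \<in> arr L" "src L i = I" "tgt L i \<in> S" "src L j = tgt L i" "tgt L j = I"
    "is_iso L i" "is_iso L j" using S_replace[OF initial_P[OF d(1)]] .
  have "d \<cdot> j \<in> E" using i d E_cmp[of j d] E_iso by (auto simp: in_hom)
  then show ?thesis using that[of "d \<cdot> j"] i d initial_iso[OF d(1) i(7) i(3)] by (auto simp: in_hom)
qed

lemma S_pushout: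
  assumes e: "e \<in> E" "src L e \<in> S" "tgt L e \<in> S" and f: "f \<in> arr L" "src L f = src L e" "tgt L f \<in> S"
  obtains p q where "pushout L e f p q" "tgt L p \<in> S"
proof -
  obtain p q where po: "pushout L e f p q"
    using ex_pushout[OF inacc cocomplete, of e f] e f E_arr by auto
  have "tgt L p \<in> P" by (rule pushout_P[OF e(1) _ _ _ po]) (use e f S_P in auto)
  then obtain i j where i: "i \<in> arr L" "src L i = tgt L p" "tgt L i \<in> S" "is_iso L i"
    by (rule S_replace)
  show ?thesis
    using that[OF pushout_iso[OF po i(4) i(2)]] i pushoutD[OF po] by simp
qed

section \<open>Density and full maps, tested on objects of \<open>S\<close>\<close>

lemma dense: "X \<in> obj L \<Longrightarrow> is_colimit (comma L P X) L (comma_proj L P X) X (\<lambda>f. f)"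
  using clan_alg by (simp add: clan_algebraic_def dense_inclusion_def)

text \<open>Density without comma categories: a natural family \<psi> on the arrows from
  \<open>P\<close> into \<open>X\<close> is a cocone on the canonical diagram, whose colimit is
  \<open>X\<close>.\<close>

lemma comma_cocone:
  assumes X: "X \<in> obj L" and Y: "Y \<in> obj L"
    and \<psi>: "\<And>a. a \<in> arr L \<Longrightarrow> src L a \<in> P \<Longrightarrow> tgt L a = X \<Longrightarrow> \<psi> a \<in> hom L (src L a) Y"
    and nat: "\<And>a f. a \<in> arr L \<Longrightarrow> f \<in> arr L \<Longrightarrow> tgt L a = X \<Longrightarrow> tgt L f = src L a \<Longrightarrow> src L a \<in> P \<Longrightarrow>
      src L f \<in> P \<Longrightarrow> \<psi> (a \<cdot> f) = \<psi> a \<cdot> f"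
  shows "\<exists>!h. h \<in> hom L X Y \<and> (\<forall>a \<in> arr L. src L a \<in> P \<longrightarrow> tgt L a = X \<longrightarrow> h \<cdot> a = \<psi> a)"
proof -
  have "is_functor (comma L P X) L (comma_proj L P X)"
    using dense[OF X] by (simp add: is_colimit_def is_cocone_def)
  then have "is_cocone (comma L P X) L (comma_proj L P X) Y \<psi>"
    unfolding is_cocone_def
  proof (intro conjI ballI)
    fix t assume "t \<in> arr (comma L P X)"
    then obtain f h g where t: "t = (f, h, g)" "(f, h, g) \<in> arr (comma L P X)"
      by (cases t) (auto simp: comma_def)
    then have "g \<cdot> h = f" "h \<in> hom L (src L f) (src L g)" "g \<in> arr L" "tgt L g = X"
      "src L g \<in> P" "src L f \<in> P" by (simp_all add: comma_def)
    then have "\<psi> g \<cdot> h = \<psi> f" using nat[of g h] by (simp add: in_hom)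
    then show "\<psi> (tgt (comma L P X) t) \<cdot> amap (comma_proj L P X) t = \<psi> (src (comma L P X) t)"
      using t by (simp add: comma_proj_def) (simp add: comma_def)
  qed (use Y \<psi> in \<open>simp_all add: comma_proj_def comma_def\<close>)
  then have "\<exists>!h. h \<in> hom L X Y \<and> (\<forall>a \<in> obj (comma L P X). h \<cdot> a = \<psi> a)"
    using dense[OF X, unfolded is_colimit_def, THEN conjunct2] by simp
  then show ?thesis by (simp add: comma_def imp_conjL Ball_def)
qed

text \<open>The uniqueness half of density. An arrow out of an object of \<open>P\<close> is
  determined by its composite with an isomorphism from an object of \<open>S\<close>, so
  \<open>f\<close> and \<open>g\<close> induce the same cocone on the whole canonical
  diagram.\<close>

lemma S_separating:
  assumes fg: "f \<in> arr L" "g \<in> arr L" "src L g = src L f" "tgt L g = tgt L f"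
    and eq: "\<And>a. a \<in> arr L \<Longrightarrow> src L a \<in> S \<Longrightarrow> tgt L a = src L f \<Longrightarrow> f \<cdot> a = g \<cdot> a"
  shows "f = g"
proof -
  have eq': "f \<cdot> a = g \<cdot> a" if a: "a \<in> arr L" "src L a \<in> P" "tgt L a = src L f" for a
  proof -
    obtain i j where i: "i \<in> arr L" "j \<in> arr L" "src L i = src L a" "tgt L i \<in> S" "src L j = tgt L i"
      "tgt L j = src L a" "j \<cdot> i = ide L (src L a)" using S_replace[OF a(2)] .
    have "f \<cdot> (a \<cdot> j) = g \<cdot> (a \<cdot> j)" by (rule eq) (use a i in auto)
    then have "(f \<cdot> (a \<cdot> j)) \<cdot> i = (g \<cdot> (a \<cdot> j)) \<cdot> i" by simp
    then show ?thesis using a i fg by (simp add: cmp_assoc)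
  qed
  define H where "H h \<longleftrightarrow> h \<in> hom L (src L f) (tgt L f) \<and>
      (\<forall>a \<in> arr L. src L a \<in> P \<longrightarrow> tgt L a = src L f \<longrightarrow> h \<cdot> a = f \<cdot> a)" for h
  have "\<exists>!h. H h"
    unfolding H_def by (rule comma_cocone) (use fg in \<open>auto simp: in_hom cmp_assoc\<close>)
  moreover have "H f" "H g"
    using fg eq' by (auto simp: H_def in_hom)
  ultimately show ?thesis by blast
qed

text \<open>The existence half of density: it turns transformations between nerves into arrows of
  \<open>L\<close>, and is the source of every arrow below that is assembled from its values on
  \<open>S\<close>.\<close>

lemma S_dense:
  assumes X: "X \<in> obj L" and Y: "Y \<in> obj L"
    and \<phi>: "\<And>a. a \<in> arr L \<Longrightarrow> src L a \<in> S \<Longrightarrow> tgt L a = X \<Longrightarrow>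
      \<phi> a \<in> arr L \<and> src L (\<phi> a) = src L a \<and> tgt L (\<phi> a) = Y"
    and nat: "\<And>a f. a \<in> arr L \<Longrightarrow> f \<in> arr L \<Longrightarrow> tgt L a = X \<Longrightarrow> tgt L f = src L a \<Longrightarrow> src L a \<in> S \<Longrightarrow>
      src L f \<in> S \<Longrightarrow> \<phi> (a \<cdot> f) = \<phi> a \<cdot> f"
  obtains h where "h \<in> arr L" "src L h = X" "tgt L h = Y"
    "\<And>a. a \<in> arr L \<Longrightarrow> src L a \<in> S \<Longrightarrow> tgt L a = X \<Longrightarrow> h \<cdot> a = \<phi> a"
proof -
  define Q where "Q A i j \<longleftrightarrow> i \<in> arr L \<and> j \<in> arr L \<and> src L i = A \<and> tgt L i \<in> S \<and>
      src L j = tgt L i \<and> tgt L j = A \<and> j \<cdot> i = ide L A" for A i j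
  have "\<exists>i j. Q A i j" if "A \<in> P" for A
    using S_replace[OF that] unfolding Q_def by blast
  then obtain i j where Q: "\<And>A. A \<in> P \<Longrightarrow> Q A (i A) (j A)" by metis
  have ij: "i A \<in> arr L" "j A \<in> arr L" "src L (i A) = A" "tgt L (i A) \<in> S" "src L (j A) = tgt L (i A)"
    "tgt L (j A) = A" "j A \<cdot> i A = ide L A" if "A \<in> P" for A
    using Q[OF that] by (simp_all add: Q_def)
  \<comment> \<open>The family is given on \<open>S\<close> only. It is extended to \<open>P\<close>
    by means of chosen isomorphisms \<open>i A\<close> from \<open>A\<close> to an object of
    \<open>S\<close>, with inverses \<open>j A\<close>.\<close>
  define \<psi> where "\<psi> a = \<phi> (a \<cdot> j (src L a)) \<cdot> i (src L a)" for a
  have \<phi>j: "\<phi> (a \<cdot> j (src L a)) \<in> arr L" "src L (\<phi> (a \<cdot> j (src L a))) = tgt L (i (src L a))"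
    "tgt L (\<phi> (a \<cdot> j (src L a))) = Y" if "a \<in> arr L" "src L a \<in> P" "tgt L a = X" for a
  proof -
    note i = ij[OF that(2)]
    have "a \<cdot> j (src L a) \<in> arr L" "src L (a \<cdot> j (src L a)) = tgt L (i (src L a))"
      "tgt L (a \<cdot> j (src L a)) = X" using that i(2,5,6) by simp_all
    with \<phi>[of "a \<cdot> j (src L a)"] i(4)
    show "\<phi> (a \<cdot> j (src L a)) \<in> arr L" "src L (\<phi> (a \<cdot> j (src L a))) = tgt L (i (src L a))"
      "tgt L (\<phi> (a \<cdot> j (src L a))) = Y" by simp_all
  qed
  have "\<exists>!h. h \<in> hom L X Y \<and> (\<forall>a \<in> arr L. src L a \<in> P \<longrightarrow> tgt L a = X \<longrightarrow> h \<cdot> a = \<psi> a)"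
  proof (rule comma_cocone[OF X Y])
    fix a assume a: "a \<in> arr L" "src L a \<in> P" "tgt L a = X"
    then show "\<psi> a \<in> hom L (src L a) Y" using \<phi>j[OF a] ij[OF a(2)] by (simp add: \<psi>_def in_hom)
  next
    fix a f assume af: "a \<in> arr L" "f \<in> arr L" "tgt L a = X" "tgt L f = src L a" "src L a \<in> P" "src L f \<in> P"
    note i1 = ij[OF af(5)] and i2 = ij[OF af(6)]
    \<comment> \<open>The arrow between the chosen representatives that corresponds to
      \<open>f\<close>; naturality of \<phi> is available for it.\<close>
    let ?g = "i (src L a) \<cdot> (f \<cdot> j (src L f))"
    have g: "?g \<in> arr L" "src L ?g = tgt L (i (src L f))" "tgt L ?g = tgt L (i (src L a))"
      using af i1 i2 by auto
    have "(a \<cdot> j (src L a)) \<cdot> ?g = a \<cdot> ((j (src L a) \<cdot> i (src L a)) \<cdot> (f \<cdot> j (src L f)))"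
      using af i1(1-6) i2(1-6) by (simp add: cmp_assoc)
    also have "\<dots> = a \<cdot> (f \<cdot> j (src L f))" using af i1 i2 by simp
    finally have "(a \<cdot> f) \<cdot> j (src L f) = (a \<cdot> j (src L a)) \<cdot> ?g" using af i1 i2 by (simp add: cmp_assoc)
    then have "\<psi> (a \<cdot> f) = \<phi> ((a \<cdot> j (src L a)) \<cdot> ?g) \<cdot> i (src L f)" using af by (simp add: \<psi>_def)
    also have "\<dots> = (\<phi> (a \<cdot> j (src L a)) \<cdot> ?g) \<cdot> i (src L f)"
      by (subst nat) (use af i1 i2 g in auto)
    also have "\<dots> = \<phi> (a \<cdot> j (src L a)) \<cdot> (i (src L a) \<cdot> (f \<cdot> (j (src L f) \<cdot> i (src L f))))"
      using \<phi>j[OF af(1,5,3)] af i1(1-6) i2(1-6) by (simp add: cmp_assoc)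
    also have "\<dots> = \<psi> a \<cdot> f" using \<phi>j[OF af(1,5,3)] af i1 i2 by (simp add: cmp_assoc \<psi>_def)
    finally show "\<psi> (a \<cdot> f) = \<psi> a \<cdot> f" .
  qed
  then obtain h where h: "h \<in> hom L X Y" "\<And>a. a \<in> arr L \<Longrightarrow> src L a \<in> P \<Longrightarrow> tgt L a = X \<Longrightarrow> h \<cdot> a = \<psi> a"
    by blast
  \<comment> \<open>For a source already in \<open>S\<close> the chosen isomorphism need not be the
    identity, so agreement with \<phi> uses naturality once more.\<close>
  have "h \<cdot> a = \<phi> a" if a: "a \<in> arr L" "src L a \<in> S" "tgt L a = X" for a
  proof -
    note i = ij[OF S_P[OF a(2)]]
    have "\<psi> a = \<phi> ((a \<cdot> j (src L a)) \<cdot> i (src L a))"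
      unfolding \<psi>_def by (subst nat) (use a i in auto)
    also have "\<dots> = \<phi> a" using a i by (simp add: cmp_assoc)
    finally show ?thesis using h(2)[OF a(1) S_P[OF a(2)] a(3)] by simp
  qed
  then show ?thesis using that h(1) by (auto simp: in_hom)
qed

text \<open>By (CG) full maps are tested on extensions between objects of \<open>P\<close>.
  Composing such an extension with isomorphisms on both sides brings it into \<open>S\<close>, and
  the lift found there is carried back.\<close>

lemma F_iff: "r \<in> F \<longleftrightarrow> r \<in> arr L \<and> (\<forall>e \<in> E. src L e \<in> S \<longrightarrow> tgt L e \<in> S \<longrightarrow> lifts L e r)"
proof
  assume "r \<in> F"
  then show "r \<in> arr L \<and> (\<forall>e \<in> E. src L e \<in> S \<longrightarrow> tgt L e \<in> S \<longrightarrow> lifts L e r)"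
    using F_eq by (auto simp: rlp_def)
next
  assume r: "r \<in> arr L \<and> (\<forall>e \<in> E. src L e \<in> S \<longrightarrow> tgt L e \<in> S \<longrightarrow> lifts L e r)"
  have "lifts L e r" if e: "e \<in> E" "src L e \<in> P" "tgt L e \<in> P" for e
  proof (rule liftsI)
    fix u v assume uv: "u \<in> arr L" "v \<in> arr L" "src L u = src L e" "tgt L u = src L r"
      "src L v = tgt L e" "tgt L v = tgt L r" "r \<cdot> u = v \<cdot> e"
    have ea: "e \<in> arr L" using e E_arr by blast
    obtain i j where i: "i \<in> arr L" "j \<in> arr L" "src L i = src L e" "tgt L i \<in> S" "src L j = tgt L i"
      "tgt L j = src L e" "j \<cdot> i = ide L (src L e)" "is_iso L j" using S_replace[OF e(2)] .
    obtain k l where k: "k \<in> arr L" "l \<in> arr L" "src L k = tgt L e" "tgt L k \<in> S" "src L l = tgt L k"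
      "tgt L l = tgt L e" "l \<cdot> k = ide L (tgt L e)" "is_iso L k" using S_replace[OF e(3)] .
    let ?e = "k \<cdot> (e \<cdot> j)"
    have "e \<cdot> j \<in> E" using E_cmp[OF E_iso[OF i(8)] e(1)] i by simp
    then have "?e \<in> E" using E_cmp[OF _ E_iso[OF k(8)]] i k ea by simp
    then have "lifts L ?e r" using r ea i k by simp
    moreover have "r \<cdot> (u \<cdot> j) = (v \<cdot> l) \<cdot> ?e"
    proof -
      have "(v \<cdot> l) \<cdot> ?e = v \<cdot> ((l \<cdot> k) \<cdot> (e \<cdot> j))" using uv i k(1-6) ea by (simp add: cmp_assoc)
      also have "\<dots> = (v \<cdot> e) \<cdot> j" using uv i k ea by (simp add: cmp_assoc)
      also have "\<dots> = r \<cdot> (u \<cdot> j)" using uv i r by (simp add: uv(7)[symmetric] cmp_assoc)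
      finally show ?thesis by simp
    qed
    ultimately obtain h where h: "h \<in> arr L" "src L h = tgt L k" "tgt L h = src L r" "h \<cdot> ?e = u \<cdot> j" "r \<cdot> h = v \<cdot> l"
      using liftsE[of ?e r "u \<cdot> j" "v \<cdot> l"] uv i k ea r by auto
    have "(h \<cdot> k) \<cdot> e = ((h \<cdot> ?e) \<cdot> i)" using h(1-3) i k ea by (simp add: cmp_assoc)
    also have "\<dots> = u" using h(4) i uv by (simp add: cmp_assoc)
    finally have "(h \<cdot> k) \<cdot> e = u" .
    moreover have "r \<cdot> (h \<cdot> k) = (r \<cdot> h) \<cdot> k" using h(1-3) k r by (simp add: cmp_assoc)
    then have "r \<cdot> (h \<cdot> k) = v" using h(5) k uv by (simp add: cmp_assoc)
    ultimately show "\<exists>h. h \<in> arr L \<and> src L h = tgt L e \<and> tgt L h = src L r \<and> h \<cdot> e = u \<and> r \<cdot> h = v"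
      using h k by (intro exI[of _ "h \<cdot> k"]) auto
  qed
  then have "r \<in> rlp L {e \<in> E. src L e \<in> P \<and> tgt L e \<in> P}" using r by (simp add: rlp_def)
  then show "r \<in> F" using clan_alg by (simp add: clan_algebraic_def)
qed

end

section \<open>Saturated directed diagrams\<close>

text \<open>Names for the vertices of a diagram: \<open>Attach q p e\<close> is the pushout, along the transition
  from stage \<open>p\<close> to stage \<open>q\<close>, of an arrow \<open>e\<close> out of stage \<open>p\<close>.\<close>

datatype (labels: 'a) stage = Base | Attach "'a stage" "'a stage" 'a

text \<open>To be applied to the category of elements of a model, with \<open>T\<close> the arrows
  that lie over extensions; pushouts are available there only along \<open>T\<close>.\<close>

locale attaching = K: category K for K :: "('o, 'a) cat" (structure) +
  fixes T :: "'a set"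
  assumes T_arr: "T \<subseteq> arr K"
    and T_pushout: "e \<in> T \<Longrightarrow> f \<in> arr K \<Longrightarrow> src K f = src K e \<Longrightarrow> \<exists>p q. pushout K e f p q"
begin

text \<open>In the colimit of the diagram this extends the coprojection of stage \<open>p\<close>
  along \<open>e\<close>, which is how lifting problems get their solutions.\<close>

definition solved :: "('a stage \<times> 'a stage \<times> 'a) set \<Rightarrow> 'a stage \<Rightarrow> 'a \<Rightarrow> bool" where
  "solved D p e \<longleftrightarrow> (\<exists>q h g. (p, q, h) \<in> D \<and> g \<in> arr K \<and> src K g = tgt K e \<and> g \<cdot> e = h)"

text \<open>\<open>D\<close> is the graph \<open>(p, q, D(p \<le> q))\<close> of a functor from a directed preorder of stages to \<open>K\<close>.\<close>

definition diagram :: "('a stage \<times> 'a stage \<times> 'a) set \<Rightarrow> bool" where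
  "diagram D \<longleftrightarrow>
     (\<forall>p q f. (p, q, f) \<in> D \<longrightarrow> f \<in> arr K \<and> (p, p, ide K (src K f)) \<in> D \<and>
        (q, q, ide K (tgt K f)) \<in> D \<and> labels p \<subseteq> arr K) \<and>
     (\<forall>p q f g. (p, q, f) \<in> D \<longrightarrow> (p, q, g) \<in> D \<longrightarrow> f = g) \<and>
     (\<forall>p q r f g. (p, q, f) \<in> D \<longrightarrow> (q, r, g) \<in> D \<longrightarrow> (p, r, g \<cdot> f) \<in> D) \<and>
     (\<forall>p q f g. (p, p, f) \<in> D \<longrightarrow> (q, q, g) \<in> D \<longrightarrow> (\<exists>r h k. (p, r, h) \<in> D \<and> (q, r, k) \<in> D)) \<and>
     (\<forall>p q e f. (Attach q p e, Attach q p e, f) \<in> D \<longrightarrow> solved D p e)"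

lemma diagramD:
  assumes "diagram D" "(p, q, f) \<in> D"
  shows "f \<in> arr K" "(p, p, ide K (src K f)) \<in> D" "(q, q, ide K (tgt K f)) \<in> D"
    "labels p \<subseteq> arr K" "(p, q, g) \<in> D \<Longrightarrow> g = f" "(q, r, g) \<in> D \<Longrightarrow> (p, r, g \<cdot> f) \<in> D"
proof -
  show "f \<in> arr K" "(p, p, ide K (src K f)) \<in> D" "(q, q, ide K (tgt K f)) \<in> D" "labels p \<subseteq> arr K"
    using assms by (simp_all add: diagram_def)
  show "g = f" if "(p, q, g) \<in> D" using assms that by (simp add: diagram_def)
  show "(p, r, g \<cdot> f) \<in> D" if "(q, r, g) \<in> D" using assms that by (simp add: diagram_def)
qed

lemma diagram_directed:
  assumes "diagram D" "(p, p, f) \<in> D" "(q, q, g) \<in> D"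
  obtains r h k where "(p, r, h) \<in> D" "(q, r, k) \<in> D"
  using assms(1)[unfolded diagram_def, THEN conjunct2, THEN conjunct2, THEN conjunct2, THEN conjunct1,
      rule_format, OF assms(2,3)] by (elim exE conjE)

text \<open>Stages carry no explicit object: it is read off from the identity recorded at the stage,
  and the graph records only one.\<close>

lemma diagram_composable:
  assumes D: "diagram D" "(p, q, f) \<in> D" "(q, r, g) \<in> D"
  shows "src K g = tgt K f"
proof -
  have "ide K (src K g) = ide K (tgt K f)"
    by (rule diagramD(5)[OF D(1) diagramD(3)[OF D(1,2)] diagramD(2)[OF D(1,3)]])
  moreover have "src K g \<in> obj K" "tgt K f \<in> obj K" using diagramD(1) D by simp_all
  ultimately show ?thesis by (metis K.ide_arr(2))
qed

text \<open>A pushout at \<open>p\<close> alone would have no upper bound with the other stages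
  above \<open>p\<close>. Therefore \<open>e\<close> is attached at every stage \<open>q\<close>
  above \<open>p\<close> at once, along the transition from \<open>p\<close> to
  \<open>q\<close>.\<close>

lemma attach:
  assumes D: "diagram D" and p: "(p, p, ide K (src K e)) \<in> D" and e: "e \<in> T" and uns: "\<not> solved D p e"
  obtains D' where "diagram D'" "D \<subseteq> D'" "solved D' p e"
proof -
  note DD = diagramD[OF D] and Dc = diagram_composable[OF D]
  have ea: "e \<in> arr K" using e T_arr by blast
  define d where "d q = (THE f. (p, q, f) \<in> D)" for q
  have d: "d q = f" if "(p, q, f) \<in> D" for q f
    unfolding d_def using that DD(5) by blast
  define U where "U = {q. \<exists>f. (p, q, f) \<in> D}"
  have U: "(p, q, d q) \<in> D" "d q \<in> arr K" "src K (d q) = src K e" if "q \<in> U" for q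
  proof -
    show 1: "(p, q, d q) \<in> D" using that d by (auto simp: U_def)
    show "d q \<in> arr K" using DD(1)[OF 1] .
    show "src K (d q) = src K e" using Dc[OF p 1] ea by simp
  qed
  have U_up: "q' \<in> U" "f \<cdot> d q = d q'" if "q \<in> U" "(q, q', f) \<in> D" for q q' f
    using DD(6)[OF U(1)[OF that(1)] that(2)] d by (auto simp: U_def)
  \<comment> \<open>The new names are fresh: by the last clause of \<open>diagram\<close>, a stage
    \<open>Attach q p e\<close> present in \<open>D\<close> would mean that \<open>e\<close> is
    already solved at \<open>p\<close>.\<close>
  have new: "x \<noteq> Attach q p e" "y \<noteq> Attach q p e" if "(x, y, f) \<in> D" for x y f q
  proof -
    have "\<And>g. (Attach q p e, Attach q p e, g) \<notin> D" using D uns unfolding diagram_def by blast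
    then show "x \<noteq> Attach q p e" "y \<noteq> Attach q p e" using DD(2,3)[OF that] by auto
  qed
  have "\<forall>q. \<exists>x. q \<in> U \<longrightarrow> pushout K e (d q) (fst x) (snd x)"
    using T_pushout[OF e] U by (metis fst_conv snd_conv)
  then obtain x where x: "\<And>q. q \<in> U \<Longrightarrow> pushout K e (d q) (fst (x q)) (snd (x q))" by metis
  \<comment> \<open>\<open>i q\<close> is the cobase change of \<open>e\<close> and starts at stage
    \<open>q\<close>; \<open>j q\<close> is the cobase change of the transition \<open>d q\<close>
    and starts at the target of \<open>e\<close>.\<close>
  define j where "j q = fst (x q)" for q
  define i where "i q = snd (x q)" for q
  have po: "pushout K e (d q) (j q) (i q)" if "q \<in> U" for q
    using x[OF that] by (simp add: i_def j_def)
  have tgt_d: "tgt K (d q) = src K f" if "q \<in> U" "(q, r, f) \<in> D" for q r f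
    using Dc[OF U(1)[OF that(1)] that(2)] by simp
  have tgt_d': "tgt K (d q) = tgt K f" if "q \<in> U" "(r, q, f) \<in> D" for q r f
  proof -
    have "tgt K (ide K (tgt K f)) = tgt K f" "src K (ide K (tgt K f)) = tgt K f"
      using DD(1)[OF that(2)] by auto
    then show ?thesis using tgt_d[OF that(1) DD(3)[OF that(2)]] by simp
  qed
  have ij: "i q \<in> arr K" "j q \<in> arr K" "src K (i q) = tgt K (d q)" "src K (j q) = tgt K e"
    "tgt K (i q) = tgt K (j q)" "i q \<cdot> d q = j q \<cdot> e" if "q \<in> U" for q
    using K.pushoutD[OF po[OF that]] by simp_all
  define A where "A q = Attach q p e" for q
  have A: "A q = A q' \<longleftrightarrow> q = q'" for q q' by (simp add: A_def)
  have newA: "x \<noteq> A q" "y \<noteq> A q" if "(x, y, f) \<in> D" for x y f q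
    using new[OF that] by (simp_all add: A_def)
  \<comment> \<open>\<open>W\<close> describes transitions between new stages: the maps of pushouts
    induced by a transition of \<open>D\<close>. \<open>V\<close> describes those from an old stage
    to a new one: a transition of \<open>D\<close> followed by \<open>i q'\<close>. Nothing leads
    from a new stage back to an old one.\<close>
  define W where "W q q' w \<longleftrightarrow> q \<in> U \<and> w \<in> arr K \<and> src K w = tgt K (j q) \<and> tgt K w = tgt K (j q') \<and>
      w \<cdot> j q = j q' \<and> (\<exists>f. (q, q', f) \<in> D \<and> w \<cdot> i q = i q' \<cdot> f)" for q q' w
  define V where "V q q' w \<longleftrightarrow> q' \<in> U \<and> (\<exists>f. (q, q', f) \<in> D \<and> w = i q' \<cdot> f)" for q q' w
  define D' where "D' = D \<union> {(A q, A q', w) | q q' w. W q q' w} \<union> {(q, A q', w) | q q' w. V q q' w}"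
  have W_U: "q \<in> U" "q' \<in> U" if "W q q' w" for q q' w
    using that U_up by (auto simp: W_def)
  have V_fact: "w \<in> arr K" "src K w = src K f" "tgt K w = tgt K (j q')"
    if "(q, q', f) \<in> D" "q' \<in> U" "w = i q' \<cdot> f" for q q' w f
    using that ij[OF that(2)] DD(1)[OF that(1)] tgt_d'[OF that(2,1)] by simp_all
  have W_ide: "W q q (ide K (tgt K (j q)))" if "q \<in> U" for q
  proof -
    note I = ij[OF that]
    have "(q, q, ide K (tgt K (d q))) \<in> D" by (rule DD(3)[OF U(1)[OF that]])
    moreover have "i q \<cdot> ide K (tgt K (d q)) = i q" using I by simp
    moreover have "ide K (tgt K (j q)) \<cdot> i q = i q" using I by simp
    ultimately show ?thesis using I that unfolding W_def by auto
  qed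
  have W_ex: "\<exists>w. W q q' w" if "q \<in> U" "(q, q', f) \<in> D" for q q' f
  proof -
    note q' = U_up[OF that] and I = ij[OF that(1)] and po' = po[OF that(1)]
    note I' = ij[OF q'(1)]
    have f: "f \<in> arr K" "src K f = tgt K (d q)" "tgt K f = tgt K (d q')"
      using DD(1)[OF that(2)] tgt_d[OF that] tgt_d'[OF q'(1) that(2)] by simp_all
    have "j q' \<cdot> e = (i q' \<cdot> f) \<cdot> d q" using I' f q'(2) U[OF that(1)] by (simp add: K.cmp_assoc)
    then obtain w where "w \<in> arr K" "src K w = tgt K (j q)" "tgt K w = tgt K (j q')" "w \<cdot> j q = j q'"
      "w \<cdot> i q = i q' \<cdot> f"
      using K.pushout_map[OF po', of "j q'" "i q' \<cdot> f"] I' f I by auto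
    then show ?thesis using that unfolding W_def by blast
  qed
  have W_unique: "w = w'" if "W q q' w" "W q q' w'" for q q' w w'
  proof -
    note h = that
    obtain f f' where f: "(q, q', f) \<in> D" "(q, q', f') \<in> D" "w \<cdot> i q = i q' \<cdot> f" "w' \<cdot> i q = i q' \<cdot> f'"
      using h by (auto simp: W_def)
    then have "f = f'" using DD(5) by blast
    then show ?thesis
      using K.pushout_unique[OF po[OF W_U(1)[OF that(1)]], of w w'] that f by (simp add: W_def)
  qed
  have V_unique: "w = w'" if "V q q' w" "V q q' w'" for q q' w w'
  proof -
    note h = that
    obtain f f' where f: "(q, q', f) \<in> D" "(q, q', f') \<in> D" "w = i q' \<cdot> f" "w' = i q' \<cdot> f'"
      using h by (auto simp: V_def)
    then have "f = f'" using DD(5) by blast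
    then show ?thesis using f by simp
  qed
  have W_W: "W q q'' (w' \<cdot> w)" if "W q q' w" "W q' q'' w'" for q q' q'' w w'
  proof -
    note h = that
    obtain f g where f: "(q, q', f) \<in> D" "w \<cdot> i q = i q' \<cdot> f" and g: "(q', q'', g) \<in> D" "w' \<cdot> i q' = i q'' \<cdot> g"
      using h by (auto simp: W_def)
    have w: "w \<in> arr K" "src K w = tgt K (j q)" "tgt K w = tgt K (j q')" "w \<cdot> j q = j q'"
      "w' \<in> arr K" "src K w' = tgt K (j q')" "tgt K w' = tgt K (j q'')" "w' \<cdot> j q' = j q''"
      using that by (auto simp: W_def)
    note I = ij[OF W_U(1)[OF that(1)]] ij[OF W_U(2)[OF that(1)]] ij[OF W_U(2)[OF that(2)]]
    have t: "src K g = tgt K f" "tgt K f = tgt K (d q')" "tgt K g = tgt K (d q'')" "f \<in> arr K" "g \<in> arr K"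
      using Dc[OF f(1) g(1)] tgt_d'[OF W_U(2)[OF that(1)] f(1)] tgt_d'[OF W_U(2)[OF that(2)] g(1)]
        DD(1)[OF f(1)] DD(1)[OF g(1)] by simp_all
    have "(w' \<cdot> w) \<cdot> i q = w' \<cdot> (i q' \<cdot> f)" using w I f by (simp add: K.cmp_assoc)
    also have "\<dots> = (w' \<cdot> i q') \<cdot> f" using w(1-3,5-7) I t by (simp add: K.cmp_assoc)
    also have "\<dots> = i q'' \<cdot> (g \<cdot> f)" using I t by (simp add: g(2) K.cmp_assoc)
    finally have 1: "(w' \<cdot> w) \<cdot> i q = i q'' \<cdot> (g \<cdot> f)" .
    have 2: "(w' \<cdot> w) \<cdot> j q = j q''" using w I by (simp add: K.cmp_assoc)
    show ?thesis
      unfolding W_def using W_U(1)[OF that(1)] w 1 2 DD(6)[OF f(1) g(1)] by auto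
  qed
  have V_W: "V q q'' (w' \<cdot> w)" if "V q q' w" "W q' q'' w'" for q q' q'' w w'
  proof -
    note h = that
    obtain f g where f: "(q, q', f) \<in> D" "w = i q' \<cdot> f" and g: "(q', q'', g) \<in> D" "w' \<cdot> i q' = i q'' \<cdot> g"
      using h by (auto simp: W_def V_def)
    have w: "w' \<in> arr K" "src K w' = tgt K (j q')" using that by (auto simp: W_def)
    note I = ij[OF W_U(1)[OF that(2)]] ij[OF W_U(2)[OF that(2)]]
    have t: "src K g = tgt K f" "tgt K f = tgt K (d q')" "tgt K g = tgt K (d q'')" "f \<in> arr K" "g \<in> arr K"
      using Dc[OF f(1) g(1)] tgt_d'[OF W_U(1)[OF that(2)] f(1)] tgt_d'[OF W_U(2)[OF that(2)] g(1)]
        DD(1)[OF f(1)] DD(1)[OF g(1)] by simp_all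
    have "w' \<cdot> w = (w' \<cdot> i q') \<cdot> f" using f w I t by (simp add: K.cmp_assoc)
    also have "\<dots> = i q'' \<cdot> (g \<cdot> f)" using I t by (simp add: g(2) K.cmp_assoc)
    finally show ?thesis unfolding V_def using W_U(2)[OF that(2)] DD(6)[OF f(1) g(1)] by blast
  qed
  have D_V: "V q q'' (w \<cdot> g)" if "(q, q', g) \<in> D" "V q' q'' w" for q q' q'' w g
  proof -
    note h = that
    obtain f where f: "(q', q'', f) \<in> D" "w = i q'' \<cdot> f" "q'' \<in> U" using h by (auto simp: V_def)
    have "w \<cdot> g = i q'' \<cdot> (f \<cdot> g)"
      using f ij[OF f(3)] Dc[OF that(1) f(1)] DD(1)[OF f(1)] DD(1)[OF that(1)] tgt_d'[OF f(3,1)]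
      by (simp add: K.cmp_assoc)
    then show ?thesis unfolding V_def using f(3) DD(6)[OF that(1) f(1)] by blast
  qed
  have D'_cases: "(x, y, w) \<in> D' \<longleftrightarrow> (x, y, w) \<in> D \<or> (\<exists>q q'. x = A q \<and> y = A q' \<and> W q q' w) \<or>
      (\<exists>q'. y = A q' \<and> V x q' w)" for x y w
    by (auto simp: D'_def)
  \<comment> \<open>The pushout square at \<open>p\<close> itself rewrites the transition from
    \<open>p\<close> to its new stage as \<open>j p\<close> after \<open>e\<close>.\<close>
  have solvedp: "solved D' p e"
  proof -
    have "p \<in> U" using p by (auto simp: U_def)
    have "V p p (j p \<cdot> e)"
      using \<open>p \<in> U\<close> U(1)[OF \<open>p \<in> U\<close>] ij(6)[OF \<open>p \<in> U\<close>] unfolding V_def by metis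
    then have "(p, A p, j p \<cdot> e) \<in> D'" unfolding D'_cases by blast
    then show ?thesis unfolding solved_def using ij[OF \<open>p \<in> U\<close>] by blast
  qed
  have sub: "D \<subseteq> D'" by (auto simp: D'_def)
  have V_src: "(x, x, ide K (src K w)) \<in> D" if "V x q w" for x q w
  proof -
    note h = that
    obtain f where f: "(x, q, f) \<in> D" "w = i q \<cdot> f" "q \<in> U" using h by (auto simp: V_def)
    then show ?thesis using V_fact(2)[OF f(1,3,2)] DD(2)[OF f(1)] by simp
  qed
  have new_A: "(A q, y, f) \<notin> D" "(x, A q, f) \<notin> D" for x y q f
    using newA by blast+
  have V_A: "\<not> V (A q) q' w" for q q' w
    using V_src new_A(1) by blast
  have V_arr: "w \<in> arr K" "tgt K w = tgt K (j q)" if "V x q w" for x q w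
    using that V_fact by (auto simp: V_def)
  have ideA: "(A q, A q, ide K (tgt K (j q))) \<in> D'" if "q \<in> U" for q
    using W_ide[OF that] by (auto simp: D'_cases)
  have labA: "labels (A q) \<subseteq> arr K" if "q \<in> U" for q
  proof -
    have "labels q \<subseteq> arr K" using DD(4)[OF DD(3)[OF U(1)[OF that]]] .
    then show ?thesis using DD(4)[OF p] ea by (simp add: A_def)
  qed
  have "diagram D'"
    unfolding diagram_def
  proof (intro conjI allI impI)
    fix x y w assume xyw: "(x, y, w) \<in> D'"
    then consider "(x, y, w) \<in> D" | q q' where "x = A q" "y = A q'" "W q q' w" | q' where "y = A q'" "V x q' w"
      unfolding D'_cases by blast
    note cs = this
    show "w \<in> arr K" using cs DD(1) V_arr(1) by cases (auto simp: W_def)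
    show "(x, x, ide K (src K w)) \<in> D'"
    proof (cases rule: cs)
      case 1 then show ?thesis using DD(2) sub by blast
    next
      case (2 q q') then show ?thesis using ideA[OF W_U(1)[OF 2(3)]] by (simp add: W_def)
    next
      case (3 q') then show ?thesis using V_src sub by blast
    qed
    show "(y, y, ide K (tgt K w)) \<in> D'"
    proof (cases rule: cs)
      case 1 then show ?thesis using DD(3) sub by blast
    next
      case (2 q q') then show ?thesis using ideA[OF W_U(2)[OF 2(3)]] by (simp add: W_def)
    next
      case (3 q') then show ?thesis using ideA[of q'] V_arr(2)[OF 3(2)] by (simp add: V_def)
    qed
    show "labels x \<subseteq> arr K"
    proof (cases rule: cs)
      case 1 then show ?thesis by (rule DD(4))
    next
      case (2 q q') then show ?thesis using labA[OF W_U(1)[OF 2(3)]] by simp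
    next
      case (3 q') then show ?thesis using DD(4)[OF V_src[OF 3(2)]] by simp
    qed
  next
    fix x y w w' assume "(x, y, w) \<in> D'" "(x, y, w') \<in> D'"
    then show "w = w'"
      unfolding D'_cases by (elim disjE exE conjE) (auto simp: A new_A V_A intro: DD(5) W_unique V_unique)
  next
    fix x y z w w' assume "(x, y, w) \<in> D'" "(y, z, w') \<in> D'"
    then show "(x, z, w' \<cdot> w) \<in> D'"
      unfolding D'_cases by (elim disjE exE conjE) (auto simp: A new_A V_A intro: DD(6) W_W V_W D_V)
  next
    fix x y w w' assume x: "(x, x, w) \<in> D'" and y: "(y, y, w') \<in> D'"
    have *: "\<exists>q w. (x, q, w) \<in> D \<or> x = A q \<and> q \<in> U" if "(x, x, w) \<in> D'" for x w
      using that W_U V_src unfolding D'_cases by blast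
    have up: "\<exists>r. r \<in> U \<and> (\<exists>h. (q, r, h) \<in> D) \<and> (\<exists>h. (q', r, h) \<in> D)"
      if q: "(q, q, f) \<in> D" and q': "(q', q', f') \<in> D" for q q' f f'
    proof -
      obtain r h k where r: "(q, r, h) \<in> D" "(q', r, k) \<in> D" using diagram_directed[OF D q q'] .
      obtain s l m where s: "(r, s, l) \<in> D" "(p, s, m) \<in> D"
        using diagram_directed[OF D DD(3)[OF r(1)] p] .
      show ?thesis using DD(6)[OF r(1) s(1)] DD(6)[OF r(2) s(1)] s(2) by (auto simp: U_def)
    qed
    \<comment> \<open>Every stage of \<open>D'\<close> has an old stage \<open>q\<close> as
      representative: it lies below the new stage \<open>A r\<close> for all \<open>r\<close> in
      \<open>U\<close> above \<open>q\<close>. Directedness of \<open>D'\<close> thereby reduces to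
      that of \<open>D\<close>.\<close>
    have rep: "\<exists>q f. (q, q, f) \<in> D \<and> (\<forall>r \<in> U. (\<exists>h. (q, r, h) \<in> D) \<longrightarrow> (\<exists>w. (x, A r, w) \<in> D'))"
      if "(x, x, w) \<in> D'" for x w
    proof -
      from * [OF that] consider q w' where "(x, q, w') \<in> D" | q where "x = A q" "q \<in> U" by blast
      then show ?thesis
      proof cases
        case (1 q w')
        have "\<forall>r \<in> U. (\<exists>h. (x, r, h) \<in> D) \<longrightarrow> (\<exists>w. (x, A r, w) \<in> D')"
          unfolding D'_cases V_def by blast
        then show ?thesis using DD(2)[OF 1] by blast
      next
        case (2 q)
        have "\<forall>r \<in> U. (\<exists>h. (q, r, h) \<in> D) \<longrightarrow> (\<exists>w. (x, A r, w) \<in> D')"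
          using W_ex[OF 2(2)] 2(1) unfolding D'_cases by blast
        then show ?thesis using DD(3)[OF U(1)[OF 2(2)]] by blast
      qed
    qed
    obtain q f where q: "(q, q, f) \<in> D"
        "\<And>r h. r \<in> U \<Longrightarrow> (q, r, h) \<in> D \<Longrightarrow> \<exists>w. (x, A r, w) \<in> D'" using rep[OF x] by blast
    obtain q' f' where q': "(q', q', f') \<in> D"
        "\<And>r h. r \<in> U \<Longrightarrow> (q', r, h) \<in> D \<Longrightarrow> \<exists>w. (y, A r, w) \<in> D'" using rep[OF y] by blast
    show "\<exists>r h k. (x, r, h) \<in> D' \<and> (y, r, k) \<in> D'"
      using up[OF q(1) q'(1)] q(2) q'(2) by blast
  next
    fix p' q e' f assume "(Attach q p' e', Attach q p' e', f) \<in> D'"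
    then consider "(Attach q p' e', Attach q p' e', f) \<in> D" | "p' = p" "e' = e"
      unfolding D'_cases A_def by blast
    then show "solved D' p' e'"
    proof cases
      case 1
      then have "solved D p' e'" using D unfolding diagram_def by blast
      then show ?thesis using sub unfolding solved_def by blast
    next
      case 2 then show ?thesis using solvedp by simp
    qed
  qed
  then show ?thesis using that sub solvedp by blast
qed

text \<open>Each clause of \<open>diagram\<close> concerns at most two given triples, which lie in a
  common member of a chain, so unions of chains are diagrams. At a maximal diagram
  \<open>attach\<close> rules out unsolved problems.\<close>

lemma saturated_diagram:
  assumes k: "k \<in> obj K"
  obtains D where "diagram D" "D \<noteq> {}"
    "\<And>p e. (p, p, ide K (src K e)) \<in> D \<Longrightarrow> e \<in> T \<Longrightarrow> solved D p e"
proof -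
  let ?\<D> = "{D. diagram D \<and> D \<noteq> {}}"
  have "\<exists>M \<in> ?\<D>. \<forall>X \<in> ?\<D>. M \<subseteq> X \<longrightarrow> X = M"
  proof (rule subset_Zorn_nonempty)
    have "diagram {(Base, Base, ide K k)}"
      using k by (auto simp: diagram_def)
    then show "?\<D> \<noteq> {}" by blast
  next
    fix \<C> assume ne: "\<C> \<noteq> {}" and ch: "subset.chain ?\<D> \<C>"
    have mem: "diagram X" if "X \<in> \<C>" for X using ch that by (auto simp: subset_chain_def)
    have two: "\<exists>X \<in> \<C>. s \<in> X \<and> t \<in> X" if "s \<in> \<Union>\<C>" "t \<in> \<Union>\<C>" for s t
    proof -
      obtain X Y where XY: "X \<in> \<C>" "Y \<in> \<C>" "s \<in> X" "t \<in> Y" using \<open>s \<in> \<Union>\<C>\<close> \<open>t \<in> \<Union>\<C>\<close> by blast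
      then have "X \<subseteq> Y \<or> Y \<subseteq> X" using ch by (auto simp: subset_chain_def)
      then show ?thesis using XY by blast
    qed
    have "diagram (\<Union>\<C>)"
      unfolding diagram_def
    proof (intro conjI allI impI)
      fix p q f assume "(p, q, f) \<in> \<Union>\<C>"
      then obtain X where X: "X \<in> \<C>" "(p, q, f) \<in> X" by blast
      note dX = diagramD[OF mem[OF X(1)] X(2)]
      show "f \<in> arr K" "labels p \<subseteq> arr K" by (rule dX)+
      show "(p, p, ide K (src K f)) \<in> \<Union>\<C>" "(q, q, ide K (tgt K f)) \<in> \<Union>\<C>"
        using dX(2,3) X(1) by blast+
    next
      fix p q f g assume "(p, q, f) \<in> \<Union>\<C>" "(p, q, g) \<in> \<Union>\<C>"
      from two[OF this] obtain X where "X \<in> \<C>" "(p, q, f) \<in> X" "(p, q, g) \<in> X" by (elim bexE conjE)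
      then show "f = g" using diagramD(5)[OF mem] by blast
    next
      fix p q r f g assume "(p, q, f) \<in> \<Union>\<C>" "(q, r, g) \<in> \<Union>\<C>"
      from two[OF this] obtain X where "X \<in> \<C>" "(p, q, f) \<in> X" "(q, r, g) \<in> X" by (elim bexE conjE)
      then show "(p, r, g \<cdot> f) \<in> \<Union>\<C>" using diagramD(6)[OF mem] by blast
    next
      fix p q f g assume "(p, p, f) \<in> \<Union>\<C>" "(q, q, g) \<in> \<Union>\<C>"
      from two[OF this] obtain X where X: "X \<in> \<C>" "(p, p, f) \<in> X" "(q, q, g) \<in> X" by (elim bexE conjE)
      obtain r h k where "(p, r, h) \<in> X" "(q, r, k) \<in> X"
        using diagram_directed[OF mem[OF X(1)] X(2,3)] .
      then show "\<exists>r h k. (p, r, h) \<in> \<Union>\<C> \<and> (q, r, k) \<in> \<Union>\<C>" using X(1) by blast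
    next
      fix p q e f assume "(Attach q p e, Attach q p e, f) \<in> \<Union>\<C>"
      then obtain X where X: "X \<in> \<C>" "(Attach q p e, Attach q p e, f) \<in> X" by blast
      then have "solved X p e" using mem[OF X(1)] unfolding diagram_def by blast
      then show "solved (\<Union>\<C>) p e" using X(1) unfolding solved_def by blast
    qed
    moreover have "\<Union>\<C> \<noteq> {}" using ne ch unfolding subset_chain_def by blast
    ultimately show "\<Union>\<C> \<in> ?\<D>" by blast
  qed
  then obtain D where D: "diagram D" "D \<noteq> {}" and max: "\<And>X. diagram X \<Longrightarrow> D \<subseteq> X \<Longrightarrow> X = D" by blast
  have "solved D p e" if pe: "(p, p, ide K (src K e)) \<in> D" "e \<in> T" for p e
  proof (rule ccontr)
    assume uns: "\<not> solved D p e"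
    obtain D' where "diagram D'" "D \<subseteq> D'" "solved D' p e" using attach[OF D(1) pe uns] .
    then show False using max uns by blast
  qed
  then show ?thesis using that D by blast
qed

text \<open>Repackages the graph as a preorder \<open>r\<close> with objects \<open>ob\<close> and
  transitions \<open>d\<close>, the form in which a colimit can be taken.\<close>

lemma saturated:
  assumes k: "k \<in> obj K"
  obtains P r ob d where "P \<noteq> {}" "P \<subseteq> {p. labels p \<subseteq> arr K}" "r \<subseteq> P \<times> P" "\<And>p. p \<in> P \<Longrightarrow> (p, p) \<in> r" "trans r"
    "\<And>p q. p \<in> P \<Longrightarrow> q \<in> P \<Longrightarrow> \<exists>s. (p, s) \<in> r \<and> (q, s) \<in> r"
    "\<And>p. p \<in> P \<Longrightarrow> d p p = ide K (ob p)" "\<And>p. p \<in> P \<Longrightarrow> ob p \<in> obj K"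
    "\<And>p q. (p, q) \<in> r \<Longrightarrow> d p q \<in> arr K \<and> src K (d p q) = ob p \<and> tgt K (d p q) = ob q"
    "\<And>p q s. (p, q) \<in> r \<Longrightarrow> (q, s) \<in> r \<Longrightarrow> d q s \<cdot> d p q = d p s"
    "\<And>p e. p \<in> P \<Longrightarrow> e \<in> T \<Longrightarrow> src K e = ob p \<Longrightarrow>
       \<exists>q g. (p, q) \<in> r \<and> g \<in> arr K \<and> src K g = tgt K e \<and> g \<cdot> e = d p q"
proof -
  obtain D where D: "diagram D" "D \<noteq> {}"
    and sat: "\<And>p e. (p, p, ide K (src K e)) \<in> D \<Longrightarrow> e \<in> T \<Longrightarrow> solved D p e"
    by (rule saturated_diagram[OF k]) (rule that, assumption+)
  note DD = diagramD[OF D(1)]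
  define r where "r = {(p, q). \<exists>f. (p, q, f) \<in> D}"
  define P where "P = {p. (p, p) \<in> r}"
  define d where "d p q = (THE f. (p, q, f) \<in> D)" for p q
  define ob where "ob p = src K (d p p)" for p
  have d: "d p q = f" if "(p, q, f) \<in> D" for p q f
    unfolding d_def using that DD(5) by blast
  have dr: "(p, q, d p q) \<in> D" if "(p, q) \<in> r" for p q using that d by (auto simp: r_def)
  have src: "src K f = ob p" and tgt: "tgt K f = ob q" if f: "(p, q, f) \<in> D" for p q f
  proof -
    have "f \<in> arr K" by (rule DD(1)[OF f])
    then show "src K f = ob p" "tgt K f = ob q"
      using d[OF DD(2)[OF f]] d[OF DD(3)[OF f]] by (simp_all add: ob_def)
  qed
  have ide: "d p p = ide K (ob p)" if "p \<in> P" for p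
  proof -
    have "(p, p, d p p) \<in> D" using that dr by (simp add: P_def)
    then show ?thesis using DD(2)[of p p "d p p"] d[of p p "ide K (src K (d p p))"] by (simp add: ob_def)
  qed
  show ?thesis
  proof (rule that[of P r d ob])
    show "P \<noteq> {}" using D(2) DD(2) by (auto simp: P_def r_def)
    show "P \<subseteq> {p. labels p \<subseteq> arr K}" using DD(4) by (auto simp: P_def r_def)
    show "r \<subseteq> P \<times> P" using DD(2,3) unfolding P_def r_def by blast
    show "trans r" unfolding r_def trans_def using DD(6) by blast
    show "\<exists>s. (p, s) \<in> r \<and> (q, s) \<in> r" if "p \<in> P" "q \<in> P" for p q
    proof -
      obtain s h k where "(p, s, h) \<in> D" "(q, s, k) \<in> D"
        using diagram_directed[OF D(1), of p "d p p" q "d q q"] dr \<open>p \<in> P\<close> \<open>q \<in> P\<close>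
        unfolding P_def by blast
      then show ?thesis unfolding r_def by blast
    qed
    show "ob p \<in> obj K" if "p \<in> P" for p
      using DD(1)[OF dr, of p p] that by (simp add: P_def ob_def)
    show "d p q \<in> arr K \<and> src K (d p q) = ob p \<and> tgt K (d p q) = ob q" if "(p, q) \<in> r" for p q
      using dr[OF that] DD(1) src tgt by blast
    show "d q s \<cdot> d p q = d p s" if "(p, q) \<in> r" "(q, s) \<in> r" for p q s
      using d[OF DD(6)[OF dr[OF that(1)] dr[OF that(2)]]] by simp
    show "\<exists>q g. (p, q) \<in> r \<and> g \<in> arr K \<and> src K g = tgt K e \<and> g \<cdot> e = d p q"
      if "p \<in> P" "e \<in> T" "src K e = ob p" for p e
    proof -
      have "(p, p, ide K (src K e)) \<in> D" using that(1,3) ide[OF that(1)] dr[of p p] by (simp add: P_def)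
      from sat[OF this that(2)] obtain q h g where "(p, q, h) \<in> D" "g \<in> arr K" "src K g = tgt K e" "g \<cdot> e = h"
        by (auto simp: solved_def)
      then have "(p, q) \<in> r" "g \<cdot> e = d p q" using d[of p q h] by (auto simp: r_def)
      with \<open>g \<in> arr K\<close> \<open>src K g = tgt K e\<close> show ?thesis by blast
    qed
    show "(p, p) \<in> r" if "p \<in> P" for p using that by (simp add: P_def)
  qed (rule ide)
qed

end

section \<open>Smallness of the set of stage names\<close>

lemma small_UN:
  assumes "inaccessible \<kappa>" "small \<kappa> I" "\<And>i. i \<in> I \<Longrightarrow> small \<kappa> (X i)"
  shows "small \<kappa> (\<Union>i \<in> I. X i)"
proof -
  have "(\<Union>i \<in> I. X i) = snd ` Sigma I X" by force
  then show ?thesis using small_image[OF small_Sigma[OF assms]] by simp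
qed

lemma small_insert:
  assumes "inaccessible \<kappa>" "small \<kappa> X"
  shows "small \<kappa> (insert x X)"
proof -
  have "insert x X = (\<Union>b \<in> {True, False}. if b then {x} else X)" by auto
  then show ?thesis using small_UN[OF assms(1), of "{True, False}" "\<lambda>b. if b then {x} else X"] assms
    by (simp add: small_finite)
qed

lemma small_nat:
  assumes "inaccessible \<kappa>"
  shows "small \<kappa> (UNIV :: nat set)"
proof -
  have "natLeq <o \<kappa>" using assms unfolding inaccessible_def by (elim conjE)
  then show ?thesis unfolding small_def by (rule ordIso_ordLess_trans[OF card_of_nat])
qed

text \<open>Stages are finite trees, so countably many iterates of the operator \<open>G\<close>
  exhaust them; each iterate is small, and \<kappa> is regular and uncountable.\<close>

lemma small_stages:
  assumes \<kappa>: "inaccessible \<kappa>" and A: "small \<kappa> A"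
  shows "small \<kappa> {p. labels p \<subseteq> A}"
proof -
  define G where "G X = insert Base ((\<lambda>(p, q, e). Attach p q e) ` (X \<times> X \<times> A))" for X
  define N where "N n = (G ^^ n) {}" for n
  have N: "N (Suc n) = G (N n)" for n by (simp add: N_def)
  have sm: "small \<kappa> (N n)" for n
    by (induction n) (auto simp: N_def G_def \<kappa> A small_finite intro!: small_insert small_image small_Sigma)
  have "mono G" by (rule monoI) (force simp: G_def)
  have mono: "N n \<subseteq> N m" if "n \<le> m" for n m
  proof (rule lift_Suc_mono_le[OF _ that])
    show "N n \<subseteq> N (Suc n)" for n
      by (induction n) (simp_all add: N monoD[OF \<open>mono G\<close>], simp add: N_def)
  qed
  have "\<exists>n. p \<in> N n" if "labels p \<subseteq> A" for p
    using that
  proof (induction p)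
    case Base
    have "Base \<in> N (Suc 0)" by (simp add: N G_def)
    then show ?case by blast
  next
    case (Attach p q e)
    then obtain n m where nm: "p \<in> N n" "q \<in> N m" by auto
    have "p \<in> N (max n m)" "q \<in> N (max n m)" using nm mono[of n "max n m"] mono[of m "max n m"] by auto
    then have "Attach p q e \<in> N (Suc (max n m))" using Attach.prems by (force simp: N G_def)
    then show ?case by blast
  qed
  then have "{p. labels p \<subseteq> A} \<subseteq> (\<Union>n. N n)" by blast
  then show ?thesis using small_subset[OF small_UN[OF \<kappa> small_nat[OF \<kappa>]]] sm by blast
qed

section \<open>Full covers of models\<close>

context clan_algebraic_category
begin

abbreviation "S_arr \<equiv> {f \<in> arr L. src L f \<in> S \<and> tgt L f \<in> S}"

lemma small_S_arr: "small \<kappa> S_arr"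
proof -
  have "S_arr \<subseteq> (\<Union>A \<in> S. \<Union>B \<in> S. hom L A B)" by (auto simp: in_hom)
  moreover have "small \<kappa> (\<Union>A \<in> S. \<Union>B \<in> S. hom L A B)"
    using locally_small by (intro small_UN inacc S_small) (auto simp: locally_small_def)
  ultimately show ?thesis by (rule small_subset[rotated])
qed

end

text \<open>The values live in an arbitrary type \<open>'x\<close> because the same constructions
  are applied to the elements of a model and to pairs of arrows of \<open>L\<close>.\<close>

locale presheaf = clan_algebraic_category L \<kappa> E F S
  for L :: "('o, 'u) cat" (structure) and \<kappa> :: "'u rel" and E F :: "'u set" and S :: "'o set" +
  fixes Mo :: "'o \<Rightarrow> 'x set" and Ma :: "'u \<Rightarrow> 'x \<Rightarrow> 'x"
  assumes Ma_in: "f \<in> arr L \<Longrightarrow> src L f \<in> S \<Longrightarrow> tgt L f \<in> S \<Longrightarrow> x \<in> Mo (tgt L f) \<Longrightarrow> Ma f x \<in> Mo (src L f)"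
    and Ma_ide: "A \<in> S \<Longrightarrow> x \<in> Mo A \<Longrightarrow> Ma (ide L A) x = x"
    and Ma_cmp: "f \<in> arr L \<Longrightarrow> g \<in> arr L \<Longrightarrow> tgt L f = src L g \<Longrightarrow> src L f \<in> S \<Longrightarrow> src L g \<in> S \<Longrightarrow>
      tgt L g \<in> S \<Longrightarrow> x \<in> Mo (tgt L g) \<Longrightarrow> Ma (g \<cdot> f) x = Ma f (Ma g x)"
    and Mo_small: "A \<in> S \<Longrightarrow> small \<kappa> (Mo A)"
begin

text \<open>An arrow \<open>(A, Ma f y) \<rightarrow> (B, y)\<close> given by \<open>f : A \<rightarrow> B\<close> is determined by \<open>f\<close> and \<open>y\<close>.\<close>

definition elements :: "('o \<times> 'x, 'u \<times> 'x) cat" where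
  "elements = \<lparr>obj = Sigma S Mo, arr = {(f, y). f \<in> S_arr \<and> y \<in> Mo (tgt L f)},
     src = (\<lambda>(f, y). (src L f, Ma f y)), tgt = (\<lambda>(f, y). (tgt L f, y)),
     ide = (\<lambda>(A, x). (ide L A, x)), cmp = (\<lambda>(g, z) (f, y). (g \<cdot> f, z))\<rparr>"

lemma elements_simps [simp]:
  "obj elements = Sigma S Mo"
  "(f, y) \<in> arr elements \<longleftrightarrow> f \<in> S_arr \<and> y \<in> Mo (tgt L f)"
  "src elements (f, y) = (src L f, Ma f y)" "tgt elements (f, y) = (tgt L f, y)"
  "ide elements (A, x) = (ide L A, x)" "cmp elements (g, z) (f, y) = (g \<cdot> f, z)"
  by (auto simp: elements_def)

lemma category_elements: "category elements"
  by unfold_locales (auto simp: hom_def Ma_in Ma_ide Ma_cmp cmp_assoc)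

lemma small_elements: "small_cat \<kappa> elements"
proof -
  have "small \<kappa> (obj elements)" by (simp add: small_Sigma inacc S_small Mo_small)
  moreover have "arr elements = Sigma S_arr (\<lambda>f. Mo (tgt L f))" by (auto simp: elements_def)
  moreover have "small \<kappa> (Sigma S_arr (\<lambda>f. Mo (tgt L f)))"
    by (rule small_Sigma[OF inacc small_S_arr]) (simp add: Mo_small)
  ultimately show ?thesis using category_elements by (simp only: small_cat_def)
qed

definition elements_proj :: "('o \<times> 'x, 'u \<times> 'x, 'o, 'u) fctr" where
  "elements_proj = \<lparr>omap = restrict fst (obj elements), amap = restrict fst (arr elements)\<rparr>"

lemma functor_elements_proj: "is_functor elements L elements_proj"
  by (auto simp: is_functor_def elements_proj_def Ma_in Ma_ide Ma_cmp)

text \<open>A natural transformation \<theta> from the nerve of \<open>X\<close> to the presheaf. By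
  the Yoneda lemma the last clause is its right lifting property against the extensions in
  \<open>S\<close>.\<close>

definition full_cover :: "'o \<Rightarrow> ('u \<Rightarrow> 'x) \<Rightarrow> bool" where
  "full_cover X \<theta> \<longleftrightarrow> X \<in> obj L \<and>
     (\<forall>a \<in> arr L. src L a \<in> S \<longrightarrow> tgt L a = X \<longrightarrow> \<theta> a \<in> Mo (src L a)) \<and>
     (\<forall>a \<in> arr L. \<forall>f \<in> arr L. src L a \<in> S \<longrightarrow> tgt L a = X \<longrightarrow> src L f \<in> S \<longrightarrow> tgt L f = src L a \<longrightarrow>
        \<theta> (a \<cdot> f) = Ma f (\<theta> a)) \<and>
     (\<forall>e \<in> E. \<forall>a \<in> arr L. \<forall>b \<in> Mo (tgt L e). src L e \<in> S \<longrightarrow> tgt L e \<in> S \<longrightarrow> src L a = src L e \<longrightarrow>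
        tgt L a = X \<longrightarrow> Ma e b = \<theta> a \<longrightarrow>
        (\<exists>c \<in> arr L. src L c = tgt L e \<and> tgt L c = X \<and> c \<cdot> e = a \<and> \<theta> c = b))"

end

locale model = presheaf +
  assumes Mo_initial: "initial L I \<Longrightarrow> I \<in> S \<Longrightarrow> \<exists>x. Mo I = {x}"
    and Mo_pushout: "e \<in> E \<Longrightarrow> pushout L e f p q \<Longrightarrow> src L e \<in> S \<Longrightarrow> tgt L e \<in> S \<Longrightarrow> tgt L f \<in> S \<Longrightarrow>
      tgt L p \<in> S \<Longrightarrow> x \<in> Mo (tgt L e) \<Longrightarrow> y \<in> Mo (tgt L f) \<Longrightarrow> Ma e x = Ma f y \<Longrightarrow>
      \<exists>!z. z \<in> Mo (tgt L p) \<and> Ma p z = x \<and> Ma q z = y"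
begin

text \<open>The model axiom glues \<open>x\<close> and \<open>y\<close> to an element over the apex
  of the pushout in \<open>L\<close>; the uniqueness of that element is what makes the mediating
  arrow compatible with elements.\<close>

lemma elements_pushout:
  assumes e: "(e, x) \<in> arr elements" "e \<in> E" and f: "(f, y) \<in> arr elements"
    and eq: "src elements (f, y) = src elements (e, x)"
  shows "\<exists>p q. pushout elements (e, x) (f, y) p q"
proof -
  interpret el: category elements by (rule category_elements)
  obtain p q where po: "pushout L e f p q" "tgt L p \<in> S"
    using S_pushout[of e f] e f eq by auto
  note P = pushoutD[OF po(1)]
  have "\<exists>!z. z \<in> Mo (tgt L p) \<and> Ma p z = x \<and> Ma q z = y"
    using Mo_pushout[OF e(2) po(1)] e f eq po(2) by simp
  then obtain z where z: "z \<in> Mo (tgt L p)" "Ma p z = x" "Ma q z = y"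
      and zu: "\<And>z'. z' \<in> Mo (tgt L p) \<Longrightarrow> Ma p z' = x \<Longrightarrow> Ma q z' = y \<Longrightarrow> z' = z"
    by (elim ex1E) blast
  have "pushout elements (e, x) (f, y) (p, z) (q, z)"
  proof (rule el.pushoutI)
    fix u v assume uv: "u \<in> arr elements" "v \<in> arr elements" "src elements u = tgt elements (e, x)"
      "src elements v = tgt elements (f, y)" "tgt elements v = tgt elements u"
      "u \<cdot>\<^bsub>elements\<^esub> (e, x) = v \<cdot>\<^bsub>elements\<^esub> (f, y)"
    obtain u' t v' where uv': "u = (u', t)" "v = (v', t)" using uv(5) by (cases u, cases v) auto
    obtain h where h: "h \<in> arr L" "src L h = tgt L p" "tgt L h = tgt L u'" "h \<cdot> p = u'" "h \<cdot> q = v'"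
      by (rule pushout_map[OF po(1), of u' v']) (use uv uv' in auto)
    have t: "t \<in> Mo (tgt L h)" "tgt L h \<in> S" using uv uv' h by auto
    have "Ma h t = z"
    proof (rule zu)
      show "Ma h t \<in> Mo (tgt L p)" using Ma_in[of h t] h t po(2) by simp
      show "Ma p (Ma h t) = x" using Ma_cmp[of p h t] h t po(2) P e uv uv' by simp
      show "Ma q (Ma h t) = y" using Ma_cmp[of q h t] h t po(2) P f uv uv' by simp
    qed
    then show "\<exists>h. h \<in> arr elements \<and> src elements h = tgt elements (p, z) \<and>
        tgt elements h = tgt elements u \<and> h \<cdot>\<^bsub>elements\<^esub> (p, z) = u \<and> h \<cdot>\<^bsub>elements\<^esub> (q, z) = v"
      using h t po(2) uv' by (intro exI[of _ "(h, t)"]) simp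
  next
    fix h k assume "h \<in> arr elements" "k \<in> arr elements" "src elements h = tgt elements (p, z)"
      "src elements k = tgt elements (p, z)" "tgt elements k = tgt elements h"
      "h \<cdot>\<^bsub>elements\<^esub> (p, z) = k \<cdot>\<^bsub>elements\<^esub> (p, z)" "h \<cdot>\<^bsub>elements\<^esub> (q, z) = k \<cdot>\<^bsub>elements\<^esub> (q, z)"
    note hk = this
    then obtain h' k' s where s: "h = (h', s)" "k = (k', s)" by (cases h, cases k) auto
    have "h' = k'" by (rule pushout_unique[OF po(1)]) (use hk s in auto)
    then show "h = k" using s by simp
  qed (use e f eq P po z in auto)
  then show ?thesis by blast
qed

text \<open>Objects of \<open>S\<close> are compact, so an arrow from one into the colimit
  \<open>X\<close> is represented by some \<open>b\<close> into a stage \<open>A p\<close>, and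
  \<theta> restricts the element \<open>m p\<close> of that stage along \<open>b\<close>. A lifting
  problem on the source of \<open>b\<close> is pushed forward to the stage, where saturation solves
  it.\<close>

lemma ex_full_cover: "\<exists>X \<theta>. full_cover X \<theta>"
proof -
  let ?T = "{a \<in> arr elements. fst a \<in> E}"
  interpret el: attaching elements ?T
  proof (intro attaching.intro attaching_axioms.intro category_elements)
    show "\<exists>p q. pushout elements e f p q"
      if "e \<in> ?T" "f \<in> arr elements" "src elements f = src elements e" for e f
      using that elements_pushout[of "fst e" "snd e" "fst f" "snd f"] by simp
  qed auto
  \<comment> \<open>Saturation needs some starting vertex; the point over an initial object provides
    one.\<close>
  obtain I where I: "I \<in> S" "initial L I" by (rule S_initial)
  then obtain x where "Mo I = {x}" using Mo_initial by blast
  then have k: "(I, x) \<in> obj elements" using I by simp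
  obtain P r ob d where P: "P \<noteq> {}" "P \<subseteq> {p. labels p \<subseteq> arr elements}" "r \<subseteq> P \<times> P" "\<And>p. p \<in> P \<Longrightarrow> (p, p) \<in> r" "trans r"
    and dir: "\<And>p q. p \<in> P \<Longrightarrow> q \<in> P \<Longrightarrow> \<exists>s. (p, s) \<in> r \<and> (q, s) \<in> r"
    and ide: "\<And>p. p \<in> P \<Longrightarrow> d p p = ide elements (ob p)" "\<And>p. p \<in> P \<Longrightarrow> ob p \<in> obj elements"
    and d: "\<And>p q. (p, q) \<in> r \<Longrightarrow> d p q \<in> arr elements \<and> src elements (d p q) = ob p \<and> tgt elements (d p q) = ob q"
    and dd: "\<And>p q s. (p, q) \<in> r \<Longrightarrow> (q, s) \<in> r \<Longrightarrow> d q s \<cdot>\<^bsub>elements\<^esub> d p q = d p s"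
    and sat: "\<And>p e. p \<in> P \<Longrightarrow> e \<in> ?T \<Longrightarrow> src elements e = ob p \<Longrightarrow>
       \<exists>q g. (p, q) \<in> r \<and> g \<in> arr elements \<and> src elements g = tgt elements e \<and> g \<cdot>\<^bsub>elements\<^esub> e = d p q"
    by (rule el.saturated[OF k]) (rule that, assumption+)
  let ?J = "thin P r"
  define A where "A p = fst (ob p)" for p
  define m where "m p = snd (ob p)" for p
  define t where "t p q = fst (d p q)" for p q
  have Am: "A p \<in> S" "m p \<in> Mo (A p)" if "p \<in> P" for p
    using ide(2)[OF that] by (auto simp: A_def m_def)
  have t: "t p q \<in> arr L" "src L (t p q) = A p" "tgt L (t p q) = A q" "Ma (t p q) (m q) = m p"
    if "(p, q) \<in> r" for p q
  proof -
    obtain f y where f: "d p q = (f, y)" by (cases "d p q")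
    have "src elements (f, y) = ob p" "tgt elements (f, y) = ob q" "(f, y) \<in> arr elements"
      using d[OF that] by (simp_all add: f)
    then have "ob p = (src L f, Ma f y)" "ob q = (tgt L f, y)" "f \<in> arr L" by simp_all
    then show "t p q \<in> arr L" "src L (t p q) = A p" "tgt L (t p q) = A q" "Ma (t p q) (m q) = m p"
      by (simp_all add: t_def A_def m_def f)
  qed
  have rP: "p \<in> P" "q \<in> P" if "(p, q) \<in> r" for p q using that P(3) by auto
  have tt: "t q s \<cdot> t p q = t p s" if "(p, q) \<in> r" "(q, s) \<in> r" for p q s
    using dd[OF that, symmetric] by (cases "d p q"; cases "d q s") (simp add: t_def)
  have tid: "t p p = ide L (A p)" if "p \<in> P" for p
    using ide[OF that] by (cases "ob p") (simp add: t_def A_def)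
  have cat: "category ?J" by (rule category_thin[OF P(3-5)])
  have filt: "filtered ?J" by (rule filtered_thin[OF P(3-5,1) dir])
  \<comment> \<open>The vertices are trees labelled by arrows of the category of elements, which is
    small.\<close>
  have Psm: "small \<kappa> P"
    by (rule small_subset[OF small_stages[OF inacc] P(2)]) (use small_elements in \<open>simp add: small_cat_def\<close>)
  then have "small \<kappa> r"
    using small_subset[OF small_Sigma[OF inacc Psm, of "\<lambda>_. P"] P(3)] by simp
  then have sm: "small_cat \<kappa> ?J" using cat Psm by (simp add: small_cat_def)
  define D where "D = \<lparr>omap = restrict A P, amap = (\<lambda>u \<in> r. t (fst u) (snd u))\<rparr>"
  have D [simp]: "p \<in> P \<Longrightarrow> omap D p = A p" "(p, q) \<in> r \<Longrightarrow> amap D (p, q) = t p q" for p q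
    by (simp_all add: D_def)
  have fD: "is_functor ?J L D"
    unfolding is_functor_def
  proof (intro conjI ballI impI)
    show "omap D \<in> obj ?J \<rightarrow>\<^sub>E obj L" using Am(1) by (auto simp: D_def)
    show "amap D \<in> arr ?J \<rightarrow>\<^sub>E arr L" using t(1) by (auto simp: D_def)
    show "amap D (ide ?J p) = ide L (omap D p)" if "p \<in> obj ?J" for p using that P(4) tid by simp
  next
    fix u assume "u \<in> arr ?J"
    then obtain p q where "u = (p, q)" "(p, q) \<in> r" by (cases u) auto
    then show "src L (amap D u) = omap D (src ?J u)" "tgt L (amap D u) = omap D (tgt ?J u)"
      using t rP[of p q] by simp_all
  next
    fix u v assume uv: "u \<in> arr ?J" "v \<in> arr ?J" "tgt ?J u = src ?J v"
    obtain p q where u: "u = (p, q)" by (cases u)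
    obtain s where v: "v = (q, s)" using uv u by (cases v) auto
    have "(p, q) \<in> r" "(q, s) \<in> r" "(p, s) \<in> r" using uv u v transD[OF P(5), of p q s] by auto
    then show "amap D (v \<cdot>\<^bsub>?J\<^esub> u) = amap D v \<cdot> amap D u" using tt[of p q s] u v by simp
  qed
  obtain X \<iota> where col: "is_colimit ?J L D X \<iota>" using ex_colimit[OF inacc cocomplete sm fD] by blast
  then have coc: "is_cocone ?J L D X \<iota>" by (simp add: is_colimit_def)
  have \<iota>: "\<iota> p \<in> arr L" "src L (\<iota> p) = A p" "tgt L (\<iota> p) = X" if "p \<in> P" for p
    using coconeD(2-4)[OF coc, of p] that by simp_all
  have \<iota>t: "\<iota> q \<cdot> (t p q \<cdot> b) = \<iota> p \<cdot> b" if "(p, q) \<in> r" "b \<in> arr L" "tgt L b = A p" for p q b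
    using cocone_cmp[OF cat fD coc, of "(p, q)" b] that rP by simp
  have pres: "hom_preserves L B ?J D X \<iota>" if "B \<in> S" for B
    by (rule compact_hom_preserves[OF inacc S_compact[OF that] sm filt col])
  have cov: "\<exists>p \<in> P. \<exists>b \<in> arr L. src L b = src L a \<and> tgt L b = A p \<and> \<iota> p \<cdot> b = a"
    if a: "a \<in> arr L" "src L a \<in> S" "tgt L a = X" for a
  proof -
    have "a \<in> hom L (src L a) X" using a by (simp add: in_hom)
    then obtain p b where "p \<in> obj ?J" "b \<in> hom L (src L a) (omap D p)" "\<iota> p \<cdot> b = a"
      using pres[OF a(2)] unfolding hom_preserves_def by blast
    then show ?thesis by (auto simp: in_hom)
  qed
  have inj: "\<exists>q. (p, q) \<in> r \<and> t p q \<cdot> b = t p q \<cdot> b'"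
    if "p \<in> P" "b \<in> arr L" "b' \<in> arr L" "src L b \<in> S" "src L b' = src L b" "tgt L b = A p" "tgt L b' = A p"
      "\<iota> p \<cdot> b = \<iota> p \<cdot> b'" for p b b'
  proof -
    have "b \<in> hom L (src L b) (omap D p)" "b' \<in> hom L (src L b) (omap D p)" using that by (auto simp: in_hom)
    then have "\<exists>u \<in> arr ?J. src ?J u = p \<and> amap D u \<cdot> b = amap D u \<cdot> b'"
      using pres[OF that(4)] that(1,8) unfolding hom_preserves_def by simp
    then show ?thesis by (auto simp: D_def)
  qed
  have Mt: "Ma (t p q \<cdot> b) (m q) = Ma b (m p)"
    if "(p, q) \<in> r" "b \<in> arr L" "src L b \<in> S" "tgt L b = A p" for p q b
    using Ma_cmp[of b "t p q" "m q"] t[OF that(1)] that rP[OF that(1)] Am by simp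
  \<comment> \<open>Representatives with the same image in \<open>X\<close> agree at a later stage
    \<open>q\<close>, and restricting \<open>m q\<close> along the common arrow gives both
    values.\<close>
  have wd: "Ma b (m p) = Ma b' (m p')"
    if p: "p \<in> P" "p' \<in> P" and b: "b \<in> arr L" "src L b \<in> S" "tgt L b = A p"
      and b': "b' \<in> arr L" "src L b' = src L b" "tgt L b' = A p'" and eq: "\<iota> p \<cdot> b = \<iota> p' \<cdot> b'"
    for p p' b b'
  proof -
    obtain s where s: "(p, s) \<in> r" "(p', s) \<in> r" using dir[OF p] by blast
    have "\<iota> s \<cdot> (t p s \<cdot> b) = \<iota> s \<cdot> (t p' s \<cdot> b')"
      using \<iota>t[OF s(1) b(1,3)] \<iota>t[OF s(2) b'(1,3)] eq by simp
    then obtain q where q: "(s, q) \<in> r" "t s q \<cdot> (t p s \<cdot> b) = t s q \<cdot> (t p' s \<cdot> b')"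
      using inj[of s "t p s \<cdot> b" "t p' s \<cdot> b'"] b b' t[OF s(1)] t[OF s(2)] rP[OF s(1)] by auto
    have "Ma b (m p) = Ma (t s q \<cdot> (t p s \<cdot> b)) (m q)"
      using Mt[OF s(1) b(1,2,3)] Mt[OF q(1), of "t p s \<cdot> b"] b t[OF s(1)] by simp
    also have "\<dots> = Ma b' (m p')"
      unfolding q(2) using Mt[OF s(2) b'(1)] Mt[OF q(1), of "t p' s \<cdot> b'"] b b' t[OF s(2)] by simp
    finally show ?thesis .
  qed
  define \<theta> where "\<theta> a = (SOME y. \<exists>p \<in> P. \<exists>b \<in> arr L. src L b = src L a \<and> tgt L b = A p \<and> \<iota> p \<cdot> b = a \<and>
      y = Ma b (m p))" for a
  have \<theta>: "\<theta> (\<iota> p \<cdot> b) = Ma b (m p)"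
    if p: "p \<in> P" and b: "b \<in> arr L" "src L b \<in> S" "tgt L b = A p" for p b
    unfolding \<theta>_def
  proof (rule some_equality)
    show "\<exists>p' \<in> P. \<exists>b' \<in> arr L. src L b' = src L (\<iota> p \<cdot> b) \<and> tgt L b' = A p' \<and> \<iota> p' \<cdot> b' = \<iota> p \<cdot> b \<and>
        Ma b (m p) = Ma b' (m p')"
      using p b \<iota>[OF p] by (intro bexI[of _ p] bexI[of _ b]) auto
    fix y assume "\<exists>p' \<in> P. \<exists>b' \<in> arr L. src L b' = src L (\<iota> p \<cdot> b) \<and> tgt L b' = A p' \<and>
        \<iota> p' \<cdot> b' = \<iota> p \<cdot> b \<and> y = Ma b' (m p')"
    then obtain p' b' where p': "p' \<in> P" "b' \<in> arr L" "src L b' = src L b" "tgt L b' = A p'"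
        "\<iota> p' \<cdot> b' = \<iota> p \<cdot> b" "y = Ma b' (m p')" using b \<iota>[OF p] by auto
    then show "y = Ma b (m p)" using wd[OF p p'(1) b p'(2-4)] by simp
  qed
  have "full_cover X \<theta>"
    unfolding full_cover_def
  proof (intro conjI ballI impI)
    show "X \<in> obj L" by (rule coconeD(1)[OF coc])
  next
    fix a assume "a \<in> arr L" "src L a \<in> S" "tgt L a = X"
    then obtain p b where pb: "p \<in> P" "b \<in> arr L" "src L b = src L a" "tgt L b = A p" "\<iota> p \<cdot> b = a" "src L a \<in> S"
      using cov by blast
    then show "\<theta> a \<in> Mo (src L a)" using \<theta>[of p b] Ma_in[of b "m p"] Am[OF pb(1)] by simp
  next
    fix a f assume a: "a \<in> arr L" "f \<in> arr L" "src L a \<in> S" "tgt L a = X" "src L f \<in> S" "tgt L f = src L a"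
    then obtain p b where pb: "p \<in> P" "b \<in> arr L" "src L b = src L a" "tgt L b = A p" "\<iota> p \<cdot> b = a"
      using cov by blast
    then have "a \<cdot> f = \<iota> p \<cdot> (b \<cdot> f)" using a \<iota>[OF pb(1)] by (auto simp: cmp_assoc)
    then show "\<theta> (a \<cdot> f) = Ma f (\<theta> a)"
      using \<theta>[of p "b \<cdot> f"] \<theta>[of p b] pb a Am[OF pb(1)] Ma_cmp[of f b "m p"] by simp
  next
    fix e a y assume e: "e \<in> E" and a: "a \<in> arr L" and y: "y \<in> Mo (tgt L e)" and eS: "src L e \<in> S" "tgt L e \<in> S"
      and a': "src L a = src L e" "tgt L a = X" and eq: "Ma e y = \<theta> a"
    have ea: "e \<in> arr L" using e E_arr by blast
    obtain p b where pb: "p \<in> P" "b \<in> arr L" "src L b = src L e" "tgt L b = A p" "\<iota> p \<cdot> b = a"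
      using cov[OF a] a' eS by auto
    have \<theta>a: "\<theta> a = Ma b (m p)" using \<theta>[OF pb(1,2)] pb eS by simp
    \<comment> \<open>Saturation speaks of extensions out of a stage, so \<open>e\<close> is pushed
      out along \<open>b\<close>; the prescribed \<open>y\<close> and the element \<open>m p\<close>
      of the stage glue to an element \<open>z\<close> over the apex.\<close>
    obtain j i where po: "pushout L e b j i" "tgt L j \<in> S"
      using S_pushout[OF e eS pb(2,3)] pb(4) Am(1)[OF pb(1)] by auto
    note ji = pushoutD[OF po(1)]
    have "\<exists>!z. z \<in> Mo (tgt L j) \<and> Ma j z = y \<and> Ma i z = m p"
      by (rule Mo_pushout[OF e po(1)]) (use eS pb po(2) y Am[OF pb(1)] eq \<theta>a in auto)
    then obtain z where z: "z \<in> Mo (tgt L j)" "Ma j z = y" "Ma i z = m p" by blast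
    have "i \<in> E" by (rule E_pushout[OF e po(1)])
    then have "(i, z) \<in> ?T" "src elements (i, z) = ob p"
      using ji z po(2) pb Am[OF pb(1)] by (simp_all add: A_def m_def)
    from sat[OF pb(1) this] obtain q g where q: "(p, q) \<in> r" "g \<in> arr elements"
      "src elements g = tgt elements (i, z)" "g \<cdot>\<^bsub>elements\<^esub> (i, z) = d p q" by blast
    obtain g' w where g: "g = (g', w)" by (cases g)
    have dpq: "d p q = (g' \<cdot> i, w)" using q(4) g by simp
    have g': "g' \<in> arr L" "src L g' = tgt L j" "w = m q" "Ma g' w = z" "g' \<cdot> i = t p q" "tgt L g' = A q"
    proof -
      have "tgt elements (g' \<cdot> i, w) = ob q" using d[OF q(1)] by (simp add: dpq)
      then have "ob q = (tgt L (g' \<cdot> i), w)" by simp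
      then show "g' \<in> arr L" "src L g' = tgt L j" "w = m q" "Ma g' w = z" "g' \<cdot> i = t p q" "tgt L g' = A q"
        using q(2,3) g ji by (auto simp: t_def m_def A_def dpq)
    qed
    \<comment> \<open>The transition to stage \<open>q\<close> factors through \<open>i\<close>, so
      the coprojection at \<open>q\<close> after \<open>g'\<close> extends the one at
      \<open>p\<close>; precomposing with \<open>j\<close> answers the original problem for
      \<open>e\<close>.\<close>
    let ?c = "\<iota> q \<cdot> (g' \<cdot> j)"
    note qP = rP(2)[OF q(1)]
    have c: "?c \<in> arr L" "src L ?c = tgt L e" "tgt L ?c = X"
      using \<iota>[OF qP] g' ji by simp_all
    have "?c \<cdot> e = \<iota> q \<cdot> (g' \<cdot> (j \<cdot> e))" using \<iota>[OF qP] g'(1,2,6) ji(1-8) ea by (simp add: cmp_assoc)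
    also have "\<dots> = \<iota> q \<cdot> (g' \<cdot> (i \<cdot> b))" using ji(9) by simp
    also have "\<dots> = \<iota> q \<cdot> ((g' \<cdot> i) \<cdot> b)" using g'(1,2) ji(1-8) pb by (simp add: cmp_assoc)
    also have "\<dots> = a" using g'(5) \<iota>t[OF q(1) pb(2,4)] pb(5) by simp
    finally have ce: "?c \<cdot> e = a" .
    have "\<theta> ?c = Ma (g' \<cdot> j) (m q)" by (rule \<theta>[OF qP]) (use g' ji eS in simp_all)
    also have "\<dots> = y" using Ma_cmp[of j g' "m q"] g' ji eS po(2) Am[OF qP] z by simp
    finally have "\<theta> ?c = y" .
    then show "\<exists>c \<in> arr L. src L c = tgt L e \<and> tgt L c = X \<and> c \<cdot> e = a \<and> \<theta> c = y"
      using c ce by blast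
  qed
  then show ?thesis by blast
qed

end

section \<open>Models are representable\<close>

context category
begin

lemma colimit_map:
  assumes "is_colimit J C D X \<iota>" "is_cocone J C D Y \<nu>"
  obtains h where "h \<in> arr C" "src C h = X" "tgt C h = Y" "\<And>j. j \<in> obj J \<Longrightarrow> h \<cdot> \<iota> j = \<nu> j"
proof -
  have "\<exists>!h. h \<in> hom C X Y \<and> (\<forall>j \<in> obj J. h \<cdot> \<iota> j = \<nu> j)"
    using assms unfolding is_colimit_def by simp
  then obtain h where "h \<in> hom C X Y" "\<forall>j \<in> obj J. h \<cdot> \<iota> j = \<nu> j" by (elim ex1E conjE)
  then show ?thesis by (intro that[of h]) (simp_all add: in_hom)
qed

lemma coequalizer_map:
  assumes "coequalizer C p q c" "d \<in> arr C" "src C d = tgt C p" "d \<cdot> p = d \<cdot> q"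
  obtains h where "h \<in> arr C" "src C h = tgt C c" "tgt C h = tgt C d" "h \<cdot> c = d"
proof -
  have "\<exists>!h. h \<in> hom C (tgt C c) (tgt C d) \<and> h \<cdot> c = d"
    using assms unfolding coequalizer_def by simp
  then obtain h where "h \<in> hom C (tgt C c) (tgt C d)" "h \<cdot> c = d" by (elim ex1E conjE)
  then show ?thesis by (intro that[of h]) (simp_all add: in_hom)
qed

lemma colimit_unique:
  assumes J: "category J" and col: "is_colimit J C D X \<iota>"
    and fg: "f \<in> arr C" "g \<in> arr C" "src C f = X" "src C g = X" "tgt C g = tgt C f"
    and eq: "\<And>j. j \<in> obj J \<Longrightarrow> f \<cdot> \<iota> j = g \<cdot> \<iota> j"
  shows "f = g"
proof -
  interpret J: category J by (rule J)
  have coc: "is_cocone J C D X \<iota>" using col by (simp add: is_colimit_def)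
  have D: "is_functor J C D" using coc by (simp add: is_cocone_def)
  note \<iota> = coconeD[OF coc] and D' = J.functorD[OF D]
  have coc': "is_cocone J C D (tgt C f) (\<lambda>j. f \<cdot> \<iota> j)"
    unfolding is_cocone_def
  proof (intro conjI ballI D)
    fix u assume "u \<in> arr J"
    then show "(f \<cdot> \<iota> (tgt J u)) \<cdot> amap D u = f \<cdot> \<iota> (src J u)"
      using fg \<iota> D' by (simp add: cmp_assoc)
  qed (use fg \<iota> in \<open>simp_all add: in_hom\<close>)
  define H where "H h \<longleftrightarrow> h \<in> hom C X (tgt C f) \<and> (\<forall>j \<in> obj J. h \<cdot> \<iota> j = f \<cdot> \<iota> j)" for h
  have "\<exists>!h. H h"
    unfolding H_def using coc' col unfolding is_colimit_def by simp
  moreover have "H f" "H g" using fg eq by (simp_all add: H_def in_hom)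
  ultimately show ?thesis by blast
qed

end

section \<open>Kernel pairs in \<open>L\<close>\<close>

context clan_algebraic_category
begin

lemma full_quotients: "\<forall>p \<in> F. \<forall>q \<in> F. equivalence_relation L p q \<longrightarrow>
    (\<exists>c. coequalizer L p q c \<and> pullback L c c p q \<and> c \<in> F)"
  using clan_alg unfolding clan_algebraic_def by (elim conjE)

text \<open>A limit obtained from a colimit: \<open>K\<close> is the colimit of the category of
  elements of the presheaf \<open>Mo\<close> of pairs to be parametrized, and density shows that
  arrows from \<open>S\<close> into \<open>K\<close> are exactly these pairs. The universal property
  is therefore stated for sources in \<open>S\<close>.\<close>

lemma ex_joint_kernel_pair:
  assumes d: "d\<^sub>0 \<in> arr L" "d\<^sub>1 \<in> arr L" "src L d\<^sub>0 = X" "src L d\<^sub>1 = X"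
  obtains p q where "p \<in> arr L" "q \<in> arr L" "src L q = src L p" "tgt L p = X" "tgt L q = X"
    "d\<^sub>0 \<cdot> p = d\<^sub>0 \<cdot> q" "d\<^sub>1 \<cdot> p = d\<^sub>1 \<cdot> q"
    "\<And>u v. u \<in> arr L \<Longrightarrow> v \<in> arr L \<Longrightarrow> src L u \<in> S \<Longrightarrow> src L v = src L u \<Longrightarrow> tgt L u = X \<Longrightarrow> tgt L v = X \<Longrightarrow>
      d\<^sub>0 \<cdot> u = d\<^sub>0 \<cdot> v \<Longrightarrow> d\<^sub>1 \<cdot> u = d\<^sub>1 \<cdot> v \<Longrightarrow>
      \<exists>k \<in> arr L. src L k = src L u \<and> tgt L k = src L p \<and> p \<cdot> k = u \<and> q \<cdot> k = v"
    "\<And>k l. k \<in> arr L \<Longrightarrow> l \<in> arr L \<Longrightarrow> src L k \<in> S \<Longrightarrow> src L l = src L k \<Longrightarrow> tgt L k = src L p \<Longrightarrow>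
      tgt L l = src L p \<Longrightarrow> p \<cdot> k = p \<cdot> l \<Longrightarrow> q \<cdot> k = q \<cdot> l \<Longrightarrow> k = l"
proof -
  define Mo where "Mo A = {(u, v). u \<in> hom L A X \<and> v \<in> hom L A X \<and> d\<^sub>0 \<cdot> u = d\<^sub>0 \<cdot> v \<and> d\<^sub>1 \<cdot> u = d\<^sub>1 \<cdot> v}" for A
  define Ma where "Ma f = (\<lambda>(u, v). (u \<cdot> f, v \<cdot> f))" for f
  have Mo: "(u, v) \<in> Mo A \<longleftrightarrow> u \<in> arr L \<and> v \<in> arr L \<and> src L u = A \<and> src L v = A \<and> tgt L u = X \<and> tgt L v = X \<and>
      d\<^sub>0 \<cdot> u = d\<^sub>0 \<cdot> v \<and> d\<^sub>1 \<cdot> u = d\<^sub>1 \<cdot> v" for u v A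
    by (auto simp: Mo_def in_hom)
  have X: "X \<in> obj L" using d by auto
  interpret el: presheaf L \<kappa> E F S Mo Ma
  proof
    fix f x assume f: "f \<in> arr L" "src L f \<in> S" "tgt L f \<in> S" "x \<in> Mo (tgt L f)"
    then obtain u v where x: "x = (u, v)" "(u, v) \<in> Mo (tgt L f)" by (cases x) auto
    then have "d\<^sub>0 \<cdot> (u \<cdot> f) = d\<^sub>0 \<cdot> (v \<cdot> f)" "d\<^sub>1 \<cdot> (u \<cdot> f) = d\<^sub>1 \<cdot> (v \<cdot> f)"
      using d f by (simp_all add: Mo cmp_assoc[symmetric])
    then show "Ma f x \<in> Mo (src L f)" using x f by (simp add: Mo Ma_def)
  next
    fix A x assume "A \<in> S" "x \<in> Mo A"
    then show "Ma (ide L A) x = x" by (cases x) (simp add: Mo Ma_def)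
  next
    fix f g x assume "f \<in> arr L" "g \<in> arr L" "tgt L f = src L g" "x \<in> Mo (tgt L g)"
    then show "Ma (g \<cdot> f) x = Ma f (Ma g x)" by (cases x) (simp add: Mo Ma_def cmp_assoc)
  next
    fix A assume A: "A \<in> S"
    have sm: "small \<kappa> (hom L A X)" using locally_small A X by (simp add: locally_small_def)
    have "Mo A \<subseteq> Sigma (hom L A X) (\<lambda>_. hom L A X)" by (auto simp: Mo_def)
    then show "small \<kappa> (Mo A)" by (rule small_subset[OF small_Sigma[OF inacc sm sm]])
  qed
  obtain K \<iota> where col: "is_colimit el.elements L el.elements_proj K \<iota>"
    using ex_colimit[OF inacc cocomplete el.small_elements el.functor_elements_proj] by blast
  then have coc: "is_cocone el.elements L el.elements_proj K \<iota>" by (simp add: is_colimit_def)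
  have cocone: "is_cocone el.elements L el.elements_proj Y \<nu> \<longleftrightarrow> Y \<in> obj L \<and>
      (\<forall>A \<in> S. \<forall>x \<in> Mo A. \<nu> (A, x) \<in> arr L \<and> src L (\<nu> (A, x)) = A \<and> tgt L (\<nu> (A, x)) = Y) \<and>
      (\<forall>f \<in> S_arr. \<forall>x \<in> Mo (tgt L f). \<nu> (tgt L f, x) \<cdot> f = \<nu> (src L f, Ma f x))" for Y \<nu>
    unfolding is_cocone_def using el.functor_elements_proj
    by (simp add: el.elements_def el.elements_proj_def in_hom split_paired_Ball_Sigma)
      (auto simp: split_paired_all)
  note \<iota> = coc[unfolded cocone]
  have \<iota>': "\<iota> (A, x) \<in> arr L" "src L (\<iota> (A, x)) = A" "tgt L (\<iota> (A, x)) = K" if "A \<in> S" "x \<in> Mo A" for A x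
    using \<iota> that by blast+
  have "is_cocone el.elements L el.elements_proj X (\<lambda>(A, x). fst x)"
    "is_cocone el.elements L el.elements_proj X (\<lambda>(A, x). snd x)"
    unfolding cocone using X by (auto simp: Mo Ma_def)
  then obtain p q where p: "p \<in> arr L" "src L p = K" "tgt L p = X" "\<And>j. j \<in> obj el.elements \<Longrightarrow> p \<cdot> \<iota> j = fst (snd j)"
    and q: "q \<in> arr L" "src L q = K" "tgt L q = X" "\<And>j. j \<in> obj el.elements \<Longrightarrow> q \<cdot> \<iota> j = snd (snd j)"
    using colimit_map[OF col] by (metis (no_types, lifting) case_prod_beta)
  have p\<iota>: "p \<cdot> \<iota> (A, (u, v)) = u" "q \<cdot> \<iota> (A, (u, v)) = v" if "A \<in> S" "(u, v) \<in> Mo A" for A u v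
    using p(4)[of "(A, (u, v))"] q(4)[of "(A, (u, v))"] that by simp_all
  have dpq: "d \<cdot> p = d \<cdot> q" if "d \<in> arr L" "src L d = X"
      "\<And>A u v. A \<in> S \<Longrightarrow> (u, v) \<in> Mo A \<Longrightarrow> d \<cdot> u = d \<cdot> v" for d
  proof (rule colimit_unique[OF el.category_elements col])
    fix j assume "j \<in> obj el.elements"
    then obtain A u v where j: "j = (A, (u, v))" "A \<in> S" "(u, v) \<in> Mo A" by (cases j) auto
    then show "(d \<cdot> p) \<cdot> \<iota> j = (d \<cdot> q) \<cdot> \<iota> j"
      using that p(1-3) q(1-3) \<iota>'[OF j(2,3)] by (simp add: cmp_assoc p\<iota>)
  qed (use that p(1-3) q(1-3) in simp_all)
  have d0: "d\<^sub>0 \<cdot> p = d\<^sub>0 \<cdot> q" and d1: "d\<^sub>1 \<cdot> p = d\<^sub>1 \<cdot> q"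
    using d by (auto intro!: dpq simp: Mo)
  have pqa: "(p \<cdot> a, q \<cdot> a) \<in> Mo (src L a)" if "a \<in> arr L" "tgt L a = K" for a
  proof -
    have "d\<^sub>0 \<cdot> (p \<cdot> a) = (d\<^sub>0 \<cdot> p) \<cdot> a" "d\<^sub>1 \<cdot> (p \<cdot> a) = (d\<^sub>1 \<cdot> p) \<cdot> a"
      using that p(1-3) d by (simp_all add: cmp_assoc)
    then have "d\<^sub>0 \<cdot> (p \<cdot> a) = d\<^sub>0 \<cdot> (q \<cdot> a)" "d\<^sub>1 \<cdot> (p \<cdot> a) = d\<^sub>1 \<cdot> (q \<cdot> a)"
      using that q(1-3) d by (simp_all add: cmp_assoc d0 d1)
    then show ?thesis using that p(1-3) q(1-3) by (simp add: Mo)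
  qed
  \<comment> \<open>\<open>h\<close> sends an arrow from \<open>S\<close> into \<open>K\<close> to
    the coprojection named by its two components. It fixes every coprojection, so it is the
    identity; hence each such arrow is itself a coprojection and is determined by its
    components.\<close>
  obtain h where h: "h \<in> arr L" "src L h = K" "tgt L h = K"
    "\<And>a. a \<in> arr L \<Longrightarrow> src L a \<in> S \<Longrightarrow> tgt L a = K \<Longrightarrow> h \<cdot> a = \<iota> (src L a, (p \<cdot> a, q \<cdot> a))"
  proof (rule S_dense[of K K "\<lambda>a. \<iota> (src L a, (p \<cdot> a, q \<cdot> a))"])
    show "K \<in> obj L" "K \<in> obj L" using \<iota> by simp_all
    fix a assume a: "a \<in> arr L" "src L a \<in> S" "tgt L a = K"
    show "\<iota> (src L a, p \<cdot> a, q \<cdot> a) \<in> arr L \<and> src L (\<iota> (src L a, p \<cdot> a, q \<cdot> a)) = src L a \<and>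
        tgt L (\<iota> (src L a, p \<cdot> a, q \<cdot> a)) = K"
      using \<iota>'[OF a(2) pqa[OF a(1,3)]] by simp
  next
    fix a f assume a: "a \<in> arr L" "f \<in> arr L" "tgt L a = K" "tgt L f = src L a" "src L a \<in> S" "src L f \<in> S"
    have "\<forall>f \<in> S_arr. \<forall>x \<in> Mo (tgt L f). \<iota> (tgt L f, x) \<cdot> f = \<iota> (src L f, Ma f x)" using \<iota> by blast
    moreover have "f \<in> S_arr" "(p \<cdot> a, q \<cdot> a) \<in> Mo (tgt L f)" using a pqa[OF a(1,3)] by simp_all
    ultimately have "\<iota> (tgt L f, (p \<cdot> a, q \<cdot> a)) \<cdot> f = \<iota> (src L f, Ma f (p \<cdot> a, q \<cdot> a))" by blast
    then show "\<iota> (src L (a \<cdot> f), (p \<cdot> (a \<cdot> f), q \<cdot> (a \<cdot> f))) = \<iota> (src L a, (p \<cdot> a, q \<cdot> a)) \<cdot> f"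
      using a p(1-3) q(1-3) by (simp add: Ma_def cmp_assoc)
  qed (rule that, assumption+)
  have "h = ide L K"
  proof (rule colimit_unique[OF el.category_elements col])
    fix j assume "j \<in> obj el.elements"
    then obtain A u v where j: "j = (A, (u, v))" "A \<in> S" "(u, v) \<in> Mo A" by (cases j) auto
    then show "h \<cdot> \<iota> j = ide L K \<cdot> \<iota> j"
      using h(4)[of "\<iota> j"] \<iota>'[OF j(2,3)] by (simp add: p\<iota>)
  qed (use h \<iota> in simp_all)
  then have canonical: "a = \<iota> (src L a, (p \<cdot> a, q \<cdot> a))" if "a \<in> arr L" "src L a \<in> S" "tgt L a = K" for a
    using h(4)[OF that] that by simp
  show ?thesis
  proof (rule that[OF p(1) q(1) _ p(3) q(3) d0 d1])
    show "src L q = src L p" using p q by simp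
    show "\<exists>k \<in> arr L. src L k = src L u \<and> tgt L k = src L p \<and> p \<cdot> k = u \<and> q \<cdot> k = v"
      if "u \<in> arr L" "v \<in> arr L" "src L u \<in> S" "src L v = src L u" "tgt L u = X" "tgt L v = X"
        "d\<^sub>0 \<cdot> u = d\<^sub>0 \<cdot> v" "d\<^sub>1 \<cdot> u = d\<^sub>1 \<cdot> v" for u v
    proof -
      have "(u, v) \<in> Mo (src L u)" using that by (simp add: Mo)
      then show ?thesis
        using \<iota>'[of "src L u" "(u, v)"] p\<iota>[of "src L u" u v] p(2) that(3)
        by (intro bexI[of _ "\<iota> (src L u, (u, v))"]) simp_all
    qed
    show "k = l" if "k \<in> arr L" "l \<in> arr L" "src L k \<in> S" "src L l = src L k" "tgt L k = src L p"
        "tgt L l = src L p" "p \<cdot> k = p \<cdot> l" "q \<cdot> k = q \<cdot> l" for k l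
      using canonical[of k] canonical[of l] that p(2) by simp
  qed
qed

end

section \<open>Kernel pairs of full covers and their quotients\<close>

context presheaf
begin

lemma full_coverD:
  assumes "full_cover X \<theta>"
  shows "X \<in> obj L"
    "\<And>a. a \<in> arr L \<Longrightarrow> src L a \<in> S \<Longrightarrow> tgt L a = X \<Longrightarrow> \<theta> a \<in> Mo (src L a)"
    "\<And>a f. a \<in> arr L \<Longrightarrow> f \<in> arr L \<Longrightarrow> src L a \<in> S \<Longrightarrow> tgt L a = X \<Longrightarrow> src L f \<in> S \<Longrightarrow> tgt L f = src L a \<Longrightarrow>
      \<theta> (a \<cdot> f) = Ma f (\<theta> a)"
proof -
  note c = assms[unfolded full_cover_def]
  show "X \<in> obj L" by (rule c[THEN conjunct1])
  show "\<theta> a \<in> Mo (src L a)" if "a \<in> arr L" "src L a \<in> S" "tgt L a = X" for a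
    by (rule c[THEN conjunct2, THEN conjunct1, rule_format, OF that])
  show "\<theta> (a \<cdot> f) = Ma f (\<theta> a)"
    if "a \<in> arr L" "f \<in> arr L" "src L a \<in> S" "tgt L a = X" "src L f \<in> S" "tgt L f = src L a" for a f
    by (rule c[THEN conjunct2, THEN conjunct2, THEN conjunct1, rule_format, OF that])
qed

lemma full_cover_lift:
  assumes "full_cover X \<theta>" "e \<in> E" "a \<in> arr L" "b \<in> Mo (tgt L e)" "src L e \<in> S" "tgt L e \<in> S"
    "src L a = src L e" "tgt L a = X" "Ma e b = \<theta> a"
  obtains c where "c \<in> arr L" "src L c = tgt L e" "tgt L c = X" "c \<cdot> e = a" "\<theta> c = b"
proof -
  have "\<exists>c \<in> arr L. src L c = tgt L e \<and> tgt L c = X \<and> c \<cdot> e = a \<and> \<theta> c = b"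
    using assms unfolding full_cover_def by simp
  then show ?thesis using that by blast
qed

text \<open>In a lifting problem with top \<open>k\<close> and bottom \<open>a\<close>, fullness of
  \<theta> extends the other component \<open>q \<cdot> k\<close> along the extension to some
  \<open>b\<close> with the same image as \<open>a\<close>; the pair of \<open>a\<close> and
  \<open>b\<close> is the filler.\<close>

lemma full_kernel_pair:
  assumes cover: "full_cover Z \<theta>"
    and pq: "p \<in> arr L" "q \<in> arr L" "src L q = src L p" "tgt L p = Z" "tgt L q = Z"
    and sound: "\<And>k. k \<in> arr L \<Longrightarrow> src L k \<in> S \<Longrightarrow> tgt L k = src L p \<Longrightarrow> \<theta> (p \<cdot> k) = \<theta> (q \<cdot> k)"
    and complete: "\<And>a b. a \<in> arr L \<Longrightarrow> b \<in> arr L \<Longrightarrow> src L a \<in> S \<Longrightarrow> src L b = src L a \<Longrightarrow> tgt L a = Z \<Longrightarrow>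
      tgt L b = Z \<Longrightarrow> \<theta> a = \<theta> b \<Longrightarrow>
      \<exists>k \<in> arr L. src L k = src L a \<and> tgt L k = src L p \<and> p \<cdot> k = a \<and> q \<cdot> k = b"
    and inj: "\<And>k l. k \<in> arr L \<Longrightarrow> l \<in> arr L \<Longrightarrow> src L k \<in> S \<Longrightarrow> src L l = src L k \<Longrightarrow> tgt L k = src L p \<Longrightarrow>
      tgt L l = src L p \<Longrightarrow> p \<cdot> k = p \<cdot> l \<Longrightarrow> q \<cdot> k = q \<cdot> l \<Longrightarrow> k = l"
  shows "p \<in> F"
  unfolding F_iff
proof (intro conjI ballI impI pq(1) liftsI)
  fix e k a assume e: "e \<in> E" "src L e \<in> S" "tgt L e \<in> S"
    and k: "k \<in> arr L" "src L k = src L e" "tgt L k = src L p"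
    and a: "a \<in> arr L" "src L a = tgt L e" "tgt L a = tgt L p" and eq: "p \<cdot> k = a \<cdot> e"
  have ea: "e \<in> arr L" using e E_arr by blast
  have \<theta>a: "\<theta> a \<in> Mo (tgt L e)" using full_coverD(2)[OF cover, of a] a e pq by simp
  have "Ma e (\<theta> a) = \<theta> (a \<cdot> e)"
    by (rule full_coverD(3)[OF cover, symmetric]) (use a e ea pq in simp_all)
  also have "\<dots> = \<theta> (q \<cdot> k)"
    unfolding eq[symmetric] by (rule sound) (use k e in simp_all)
  finally have lift: "Ma e (\<theta> a) = \<theta> (q \<cdot> k)" .
  obtain b where b: "b \<in> arr L" "src L b = tgt L e" "tgt L b = Z" "b \<cdot> e = q \<cdot> k" "\<theta> b = \<theta> a"
    by (rule full_cover_lift[OF cover e(1) _ \<theta>a e(2,3) _ _ lift]) (use k pq in simp_all)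
  have "\<exists>l \<in> arr L. src L l = src L a \<and> tgt L l = src L p \<and> p \<cdot> l = a \<and> q \<cdot> l = b"
    by (rule complete) (use a b e pq in simp_all)
  then obtain l where l: "l \<in> arr L" "src L l = src L a" "tgt L l = src L p" "p \<cdot> l = a" "q \<cdot> l = b"
    by blast
  have "l \<cdot> e = k"
  proof (rule inj)
    show "p \<cdot> (l \<cdot> e) = p \<cdot> k" using l a ea pq by (simp add: eq cmp_assoc[symmetric])
    show "q \<cdot> (l \<cdot> e) = q \<cdot> k" using l a ea pq b(4) by (simp add: cmp_assoc[symmetric])
  qed (use l a ea k e in simp_all)
  then show "\<exists>h. h \<in> arr L \<and> src L h = tgt L e \<and> tgt L h = src L p \<and> h \<cdot> e = k \<and> p \<cdot> h = a"
    using l a by auto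
qed

text \<open>Applied twice: to the second cover, with its kernel pair formed in \<open>L\<close>, and
  then to the first cover, with the quotient so obtained as the relation. Both legs are full, so
  (FQ) applies, and effectiveness identifies the fibres of \<open>c\<close> with those of
  \<theta>.\<close>

lemma full_quotient:
  assumes cover: "full_cover Z \<theta>"
    and pq: "p \<in> arr L" "q \<in> arr L" "src L q = src L p" "tgt L p = Z" "tgt L q = Z"
    and sound: "\<And>k. k \<in> arr L \<Longrightarrow> src L k \<in> S \<Longrightarrow> tgt L k = src L p \<Longrightarrow> \<theta> (p \<cdot> k) = \<theta> (q \<cdot> k)"
    and complete: "\<And>a b. a \<in> arr L \<Longrightarrow> b \<in> arr L \<Longrightarrow> src L a \<in> S \<Longrightarrow> src L b = src L a \<Longrightarrow> tgt L a = Z \<Longrightarrow>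
      tgt L b = Z \<Longrightarrow> \<theta> a = \<theta> b \<Longrightarrow>
      \<exists>k \<in> arr L. src L k = src L a \<and> tgt L k = src L p \<and> p \<cdot> k = a \<and> q \<cdot> k = b"
    and inj: "\<And>k l. k \<in> arr L \<Longrightarrow> l \<in> arr L \<Longrightarrow> src L k \<in> S \<Longrightarrow> src L l = src L k \<Longrightarrow> tgt L k = src L p \<Longrightarrow>
      tgt L l = src L p \<Longrightarrow> p \<cdot> k = p \<cdot> l \<Longrightarrow> q \<cdot> k = q \<cdot> l \<Longrightarrow> k = l"
  obtains c where "coequalizer L p q c" "c \<in> arr L" "src L c = Z"
    "\<And>y. y \<in> arr L \<Longrightarrow> src L y \<in> S \<Longrightarrow> tgt L y = tgt L c \<Longrightarrow>
      \<exists>a \<in> arr L. src L a = src L y \<and> tgt L a = Z \<and> c \<cdot> a = y"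
    "\<And>a b. a \<in> arr L \<Longrightarrow> b \<in> arr L \<Longrightarrow> src L a \<in> S \<Longrightarrow> src L b = src L a \<Longrightarrow> tgt L a = Z \<Longrightarrow> tgt L b = Z \<Longrightarrow>
      c \<cdot> a = c \<cdot> b \<longleftrightarrow> \<theta> a = \<theta> b"
proof -
  have pF: "p \<in> F" by (rule full_kernel_pair[OF cover pq sound complete inj])
  have qF: "q \<in> F"
  proof (rule full_kernel_pair[OF cover pq(2,1) _ pq(5,4)])
    show "src L p = src L q" using pq by simp
    show "\<theta> (q \<cdot> k) = \<theta> (p \<cdot> k)" if "k \<in> arr L" "src L k \<in> S" "tgt L k = src L q" for k
      by (rule sound[symmetric]) (use that pq in simp_all)
    show "\<exists>k \<in> arr L. src L k = src L a \<and> tgt L k = src L q \<and> q \<cdot> k = a \<and> p \<cdot> k = b"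
      if "a \<in> arr L" "b \<in> arr L" "src L a \<in> S" "src L b = src L a" "tgt L a = Z" "tgt L b = Z" "\<theta> a = \<theta> b" for a b
    proof -
      have "\<exists>k \<in> arr L. src L k = src L b \<and> tgt L k = src L p \<and> p \<cdot> k = b \<and> q \<cdot> k = a"
        by (rule complete) (use that in simp_all)
      then show ?thesis using that(4) pq(3) by auto
    qed
    show "k = l" if "k \<in> arr L" "l \<in> arr L" "src L k \<in> S" "src L l = src L k" "tgt L k = src L q"
      "tgt L l = src L q" "q \<cdot> k = q \<cdot> l" "p \<cdot> k = p \<cdot> l" for k l
      by (rule inj) (use that pq in simp_all)
  qed
  have "equivalence_relation L p q"
    unfolding equivalence_relation_def
  proof (intro conjI ballI impI)
    show "p \<in> arr L" "q \<in> arr L" "src L p = src L q" "tgt L p = tgt L q" using pq by simp_all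
  next
    fix X u v assume "X \<in> obj L" "u \<in> hom L X (src L p)" "v \<in> hom L X (src L p)" "p \<cdot> u = p \<cdot> v \<and> q \<cdot> u = q \<cdot> v"
    then have uv: "u \<in> arr L" "v \<in> arr L" "src L u = X" "src L v = X" "tgt L u = src L p" "tgt L v = src L p"
      "p \<cdot> u = p \<cdot> v" "q \<cdot> u = q \<cdot> v" by (auto simp: in_hom)
    show "u = v"
    proof (rule S_separating)
      fix a assume a: "a \<in> arr L" "src L a \<in> S" "tgt L a = src L u"
      have eq: "p \<cdot> (u \<cdot> a) = p \<cdot> (v \<cdot> a)" "q \<cdot> (u \<cdot> a) = q \<cdot> (v \<cdot> a)"
        using uv a pq by (simp_all add: cmp_assoc[symmetric])
      show "u \<cdot> a = v \<cdot> a" by (rule inj) (use uv a eq in simp_all)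
    qed (use uv in simp_all)
  next
    fix X assume X: "X \<in> obj L"
    \<comment> \<open>On an arbitrary \<open>X\<close> the represented relation is agreement under
      \<theta> after every arrow from \<open>S\<close> into \<open>X\<close>, which is visibly an
      equivalence.\<close>
    define sim where "sim f g \<longleftrightarrow> (\<forall>a \<in> arr L. src L a \<in> S \<longrightarrow> tgt L a = X \<longrightarrow> \<theta> (f \<cdot> a) = \<theta> (g \<cdot> a))" for f g
    have "(\<lambda>u. (p \<cdot> u, q \<cdot> u)) ` hom L X (src L p) = {(f, g). f \<in> hom L X Z \<and> g \<in> hom L X Z \<and> sim f g}"
      (is "?l = ?r")
    proof (intro equalityI subsetI)
      fix x assume "x \<in> ?l"
      then obtain u where u: "x = (p \<cdot> u, q \<cdot> u)" "u \<in> arr L" "src L u = X" "tgt L u = src L p"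
        by (auto simp: in_hom)
      have "sim (p \<cdot> u) (q \<cdot> u)"
        unfolding sim_def
      proof (intro ballI impI)
        fix a assume a: "a \<in> arr L" "src L a \<in> S" "tgt L a = X"
        have "\<theta> (p \<cdot> (u \<cdot> a)) = \<theta> (q \<cdot> (u \<cdot> a))" by (rule sound) (use u a in simp_all)
        then show "\<theta> ((p \<cdot> u) \<cdot> a) = \<theta> ((q \<cdot> u) \<cdot> a)"
          using u pq a by (simp add: cmp_assoc)
      qed
      then show "x \<in> ?r" using u pq by (simp add: in_hom)
    next
      fix x assume "x \<in> ?r"
      then obtain f g where x: "x = (f, g)" "sim f g" and fg: "f \<in> arr L" "g \<in> arr L" "src L f = X" "src L g = X"
        "tgt L f = Z" "tgt L g = Z" by (auto simp: in_hom)
      \<comment> \<open>On each arrow \<open>a\<close> from \<open>S\<close> the pair of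
        \<open>f\<close> and \<open>g\<close> is represented by some \<open>k\<close>, unique by
        \<open>inj\<close> and hence natural in \<open>a\<close>; density assembles these into
        \<open>u\<close>.\<close>
      define Q where "Q a k \<longleftrightarrow> k \<in> arr L \<and> src L k = src L a \<and> tgt L k = src L p \<and> p \<cdot> k = f \<cdot> a \<and> q \<cdot> k = g \<cdot> a" for a k
      define \<phi> where "\<phi> a = (SOME k. Q a k)" for a
      have \<phi>: "Q a (\<phi> a)" if a: "a \<in> arr L" "src L a \<in> S" "tgt L a = X" for a
      proof -
        have "\<theta> (f \<cdot> a) = \<theta> (g \<cdot> a)" using x(2) a by (simp add: sim_def)
        then have "\<exists>k \<in> arr L. src L k = src L (f \<cdot> a) \<and> tgt L k = src L p \<and> p \<cdot> k = f \<cdot> a \<and> q \<cdot> k = g \<cdot> a"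
          by (intro complete) (use fg a in simp_all)
        then have "\<exists>k. Q a k" using fg a by (auto simp: Q_def)
        then show ?thesis unfolding \<phi>_def by (rule someI_ex)
      qed
      obtain u where u: "u \<in> arr L" "src L u = X" "tgt L u = src L p"
        "\<And>a. a \<in> arr L \<Longrightarrow> src L a \<in> S \<Longrightarrow> tgt L a = X \<Longrightarrow> u \<cdot> a = \<phi> a"
      proof (rule S_dense[OF X, of "src L p" \<phi>])
        show "src L p \<in> obj L" using pq by simp
        fix a assume a: "a \<in> arr L" "src L a \<in> S" "tgt L a = X"
        show "\<phi> a \<in> arr L \<and> src L (\<phi> a) = src L a \<and> tgt L (\<phi> a) = src L p" using \<phi>[OF a] by (simp add: Q_def)
      next
        fix a b assume ab: "a \<in> arr L" "b \<in> arr L" "tgt L a = X" "tgt L b = src L a" "src L a \<in> S" "src L b \<in> S"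
        have Qa: "Q a (\<phi> a)" by (rule \<phi>) (use ab in simp_all)
        have Qab: "Q (a \<cdot> b) (\<phi> (a \<cdot> b))" by (rule \<phi>) (use ab in simp_all)
        show "\<phi> (a \<cdot> b) = \<phi> a \<cdot> b"
        proof (rule inj)
          have "p \<cdot> (\<phi> a \<cdot> b) = (p \<cdot> \<phi> a) \<cdot> b" "q \<cdot> (\<phi> a \<cdot> b) = (q \<cdot> \<phi> a) \<cdot> b"
            using conjunct1[OF Qa[unfolded Q_def]] Qa[unfolded Q_def, THEN conjunct2, THEN conjunct1]
              Qa[unfolded Q_def, THEN conjunct2, THEN conjunct2, THEN conjunct1] ab pq
            by (simp_all add: cmp_assoc)
          then show "p \<cdot> \<phi> (a \<cdot> b) = p \<cdot> (\<phi> a \<cdot> b)" "q \<cdot> \<phi> (a \<cdot> b) = q \<cdot> (\<phi> a \<cdot> b)"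
            using Qa Qab ab fg by (simp_all add: Q_def cmp_assoc)
        qed (use Qa Qab ab in \<open>simp_all add: Q_def\<close>)
      qed (rule that, assumption+)
      have "p \<cdot> u = f"
      proof (rule S_separating)
        fix a assume a: "a \<in> arr L" "src L a \<in> S" "tgt L a = src L (p \<cdot> u)"
        then show "(p \<cdot> u) \<cdot> a = f \<cdot> a" using u pq \<phi>[of a] by (simp add: cmp_assoc Q_def)
      qed (use u pq fg in simp_all)
      moreover have "q \<cdot> u = g"
      proof (rule S_separating)
        fix a assume a: "a \<in> arr L" "src L a \<in> S" "tgt L a = src L (q \<cdot> u)"
        then show "(q \<cdot> u) \<cdot> a = g \<cdot> a" using u pq \<phi>[of a] by (simp add: cmp_assoc Q_def)
      qed (use u pq fg in simp_all)
      ultimately show "x \<in> ?l" using x u by (auto simp: in_hom)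
    qed
    moreover have "equiv (hom L X Z) ?r"
      by (rule equivI) (auto simp: refl_on_def sym_def trans_def sim_def)
    ultimately show "equiv (hom L X (tgt L p)) ((\<lambda>u. (p \<cdot> u, q \<cdot> u)) ` hom L X (src L p))"
      using pq by simp
  qed
  then obtain c where coeq: "coequalizer L p q c" and pb: "pullback L c c p q" and cF: "c \<in> F"
    using full_quotients pF qF by blast
  have c: "c \<in> arr L" "src L c = Z" "c \<cdot> p = c \<cdot> q" using coeq pq by (auto simp: coequalizer_def)
  show ?thesis
  proof (rule that[OF coeq c(1,2)])
    fix y assume y: "y \<in> arr L" "src L y \<in> S" "tgt L y = tgt L c"
    \<comment> \<open>Surjectivity on arrows from \<open>S\<close>: the full map \<open>c\<close>
      lifts against the extension from an initial object to the source of \<open>y\<close>.\<close>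
    obtain e where e: "e \<in> E" "src L e \<in> S" "initial L (src L e)" "tgt L e = src L y"
      using S_zero_extension[OF y(2)] by metis
    have ea: "e \<in> arr L" using e E_arr by blast
    obtain i where i: "i \<in> arr L" "src L i = src L e" "tgt L i = Z"
      using initial_arrow[OF e(3) full_coverD(1)[OF cover]] by metis
    have "c \<cdot> i = y \<cdot> e" by (rule initial_unique[OF e(3)]) (use c i y e ea in simp_all)
    moreover have "lifts L e c" using cF e y F_iff by simp
    ultimately obtain a where "a \<in> arr L" "src L a = tgt L e" "tgt L a = src L c" "a \<cdot> e = i" "c \<cdot> a = y"
      using liftsE[of e c i y] i y c e by metis
    then have "a \<in> arr L" "src L a = src L y" "tgt L a = Z" "c \<cdot> a = y" using e(4) c(2) by simp_all
    then show "\<exists>a \<in> arr L. src L a = src L y \<and> tgt L a = Z \<and> c \<cdot> a = y" by blast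
  next
    fix a b assume ab: "a \<in> arr L" "b \<in> arr L" "src L a \<in> S" "src L b = src L a" "tgt L a = Z" "tgt L b = Z"
    show "c \<cdot> a = c \<cdot> b \<longleftrightarrow> \<theta> a = \<theta> b"
    proof
      assume eq: "c \<cdot> a = c \<cdot> b"
      have "a \<in> hom L (src L a) (src L c)" "b \<in> hom L (src L a) (src L c)" "src L a \<in> obj L"
        using ab c by (simp_all add: in_hom)
      then obtain k where "k \<in> hom L (src L a) (src L p)" "p \<cdot> k = a" "q \<cdot> k = b"
        using pb eq unfolding pullback_def by blast
      then show "\<theta> a = \<theta> b" using sound[of k] ab(3) by (auto simp: in_hom)
    next
      assume "\<theta> a = \<theta> b"
      then obtain k where k: "k \<in> arr L" "src L k = src L a" "tgt L k = src L p" "p \<cdot> k = a" "q \<cdot> k = b"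
        using complete[OF ab] by blast
      have "c \<cdot> (p \<cdot> k) = (c \<cdot> p) \<cdot> k" using k(1-3) c(1,2) pq by (simp add: cmp_assoc)
      also have "\<dots> = c \<cdot> (q \<cdot> k)" unfolding c(3) using k(1-3) c(1,2) pq by (simp add: cmp_assoc)
      finally show "c \<cdot> a = c \<cdot> b" using k by simp
    qed
  qed
qed

end

section \<open>The object representing a model\<close>

context model
begin

text \<open>Lift against the extension from an initial object to \<open>A\<close>: the boundary
  condition is automatic, because a model sends that object to a point.\<close>

lemma full_cover_surj:
  assumes cover: "full_cover X \<theta>" and x: "A \<in> S" "x \<in> Mo A"
  obtains a where "a \<in> arr L" "src L a = A" "tgt L a = X" "\<theta> a = x"
proof -
  obtain e where e: "e \<in> E" "src L e \<in> S" "initial L (src L e)" "tgt L e = A"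
    by (rule S_zero_extension[OF x(1)])
  have ea: "e \<in> arr L" using e E_arr by blast
  obtain i where i: "i \<in> arr L" "src L i = src L e" "tgt L i = X"
    by (rule initial_arrow[OF e(3) full_coverD(1)[OF cover]])
  obtain y where y: "Mo (src L e) = {y}" using Mo_initial[OF e(3,2)] by blast
  have "Ma e x \<in> Mo (src L e)" by (rule Ma_in) (use ea e x in simp_all)
  moreover have "\<theta> i \<in> Mo (src L i)" by (rule full_coverD(2)[OF cover]) (use i e in simp_all)
  ultimately have eq: "Ma e x = \<theta> i" using y i by simp
  obtain a where "a \<in> arr L" "src L a = tgt L e" "tgt L a = X" "\<theta> a = x"
    by (rule full_cover_lift[OF cover e(1) i(1) _ _ _ _ _ eq]) (use e x i in simp_all)
  then show ?thesis using that e(4) by simp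
qed

text \<open>The conclusions make \<tau> a natural bijection from the nerve of \<open>Y\<close> to
  the model; it arises by descending \<theta> along the second of two quotients.\<close>

lemma ex_representation:
  obtains Y \<tau> where "Y \<in> obj L"
    "\<And>a. a \<in> arr L \<Longrightarrow> src L a \<in> S \<Longrightarrow> tgt L a = Y \<Longrightarrow> \<tau> a \<in> Mo (src L a)"
    "\<And>a f. a \<in> arr L \<Longrightarrow> f \<in> arr L \<Longrightarrow> src L a \<in> S \<Longrightarrow> tgt L a = Y \<Longrightarrow> src L f \<in> S \<Longrightarrow> tgt L f = src L a \<Longrightarrow>
      \<tau> (a \<cdot> f) = Ma f (\<tau> a)"
    "\<And>a b. a \<in> arr L \<Longrightarrow> b \<in> arr L \<Longrightarrow> src L a \<in> S \<Longrightarrow> src L b = src L a \<Longrightarrow> tgt L a = Y \<Longrightarrow> tgt L b = Y \<Longrightarrow>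
      \<tau> a = \<tau> b \<Longrightarrow> a = b"
    "\<And>A x. A \<in> S \<Longrightarrow> x \<in> Mo A \<Longrightarrow> \<exists>a \<in> arr L. src L a = A \<and> tgt L a = Y \<and> \<tau> a = x"
proof -
  obtain X\<^sub>0 \<theta> where cover: "full_cover X\<^sub>0 \<theta>" using ex_full_cover by blast
  note cov = full_coverD[OF cover]
  \<comment> \<open>The fibre product over the model of the nerve of \<open>X\<^sub>0\<close> with
    itself.\<close>
  define Mo1 where "Mo1 A = {(a, b). a \<in> hom L A X\<^sub>0 \<and> b \<in> hom L A X\<^sub>0 \<and> \<theta> a = \<theta> b}" for A
  define Ma1 where "Ma1 f = (\<lambda>(a, b). (a \<cdot> f, b \<cdot> f))" for f
  have Mo1: "(a, b) \<in> Mo1 A \<longleftrightarrow> a \<in> arr L \<and> b \<in> arr L \<and> src L a = A \<and> src L b = A \<and> tgt L a = X\<^sub>0 \<and>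
      tgt L b = X\<^sub>0 \<and> \<theta> a = \<theta> b" for a b A
    by (auto simp: Mo1_def in_hom)
  interpret M1: model L \<kappa> E F S Mo1 Ma1
  proof
    fix f x assume f: "f \<in> arr L" "src L f \<in> S" "tgt L f \<in> S" "x \<in> Mo1 (tgt L f)"
    then obtain a b where x: "x = (a, b)" "(a, b) \<in> Mo1 (tgt L f)" by (cases x) auto
    then have "\<theta> (a \<cdot> f) = Ma f (\<theta> a)" "\<theta> (b \<cdot> f) = Ma f (\<theta> b)"
      by (intro cov(3); use f in \<open>simp add: Mo1\<close>)+
    then show "Ma1 f x \<in> Mo1 (src L f)" using x f by (simp add: Mo1 Ma1_def)
  next
    fix A x assume "A \<in> S" "x \<in> Mo1 A"
    then show "Ma1 (ide L A) x = x" by (cases x) (simp add: Mo1 Ma1_def)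
  next
    fix f g x assume "f \<in> arr L" "g \<in> arr L" "tgt L f = src L g" "x \<in> Mo1 (tgt L g)"
    then show "Ma1 (g \<cdot> f) x = Ma1 f (Ma1 g x)" by (cases x) (simp add: Mo1 Ma1_def cmp_assoc)
  next
    fix A assume A: "A \<in> S"
    have sm: "small \<kappa> (hom L A X\<^sub>0)" using locally_small A cov(1) by (simp add: locally_small_def)
    have "Mo1 A \<subseteq> Sigma (hom L A X\<^sub>0) (\<lambda>_. hom L A X\<^sub>0)" by (auto simp: Mo1_def)
    then show "small \<kappa> (Mo1 A)" by (rule small_subset[OF small_Sigma[OF inacc sm sm]])
  next
    fix I assume I: "initial L I"
    obtain i where i: "i \<in> arr L" "src L i = I" "tgt L i = X\<^sub>0" by (rule initial_arrow[OF I cov(1)])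
    have uniq: "a = i" if "a \<in> arr L" "src L a = I" "tgt L a = X\<^sub>0" for a
      by (rule initial_unique[OF I]) (use that i in simp_all)
    have "x = (i, i)" if "x \<in> Mo1 I" for x
      using that uniq[of "fst x"] uniq[of "snd x"] by (cases x) (simp add: Mo1)
    moreover have "(i, i) \<in> Mo1 I" using i by (simp add: Mo1)
    ultimately have "Mo1 I = {(i, i)}" by blast
    then show "\<exists>x. Mo1 I = {x}" by blast
  next
    fix e f p q x y
    assume e: "e \<in> E" and po: "pushout L e f p q" and S: "src L e \<in> S" "tgt L e \<in> S" "tgt L f \<in> S" "tgt L p \<in> S"
      and x: "x \<in> Mo1 (tgt L e)" and y: "y \<in> Mo1 (tgt L f)" and eq: "Ma1 e x = Ma1 f y"
    note P = pushoutD[OF po]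
    obtain a b where ab: "x = (a, b)" "(a, b) \<in> Mo1 (tgt L e)" using x by (cases x) auto
    obtain a' b' where ab': "y = (a', b')" "(a', b') \<in> Mo1 (tgt L f)" using y by (cases y) auto
    have eq': "a \<cdot> e = a' \<cdot> f" "b \<cdot> e = b' \<cdot> f" using eq by (simp_all add: ab ab' Ma1_def)
    obtain h where h: "h \<in> arr L" "src L h = tgt L p" "tgt L h = tgt L a" "h \<cdot> p = a" "h \<cdot> q = a'"
      by (rule pushout_map[OF po, of a a']) (use ab(2) ab'(2) eq' in \<open>simp_all add: Mo1\<close>)
    obtain k where k: "k \<in> arr L" "src L k = tgt L p" "tgt L k = tgt L b" "k \<cdot> p = b" "k \<cdot> q = b'"
      by (rule pushout_map[OF po, of b b']) (use ab(2) ab'(2) eq' in \<open>simp_all add: Mo1\<close>)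
    have ht: "tgt L h = X\<^sub>0" "tgt L k = X\<^sub>0" using ab(2) h k by (simp_all add: Mo1)
    have \<theta>: "\<theta> (h \<cdot> p) = Ma p (\<theta> h)" "\<theta> (h \<cdot> q) = Ma q (\<theta> h)" "\<theta> (k \<cdot> p) = Ma p (\<theta> k)" "\<theta> (k \<cdot> q) = Ma q (\<theta> k)"
      by (rule cov(3); use h(1,2) k(1,2) ht P S in simp)+
    have \<theta>a: "\<theta> (a \<cdot> e) = Ma e (\<theta> a)" "\<theta> (a' \<cdot> f) = Ma f (\<theta> a')"
      by (rule cov(3); use ab(2) ab'(2) P S in \<open>simp add: Mo1\<close>)+
    \<comment> \<open>Gluing in the two components yields \<open>h\<close> and \<open>k\<close>;
      that they again have equal images under \<theta> is the uniqueness clause of the model axiom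
      for \<open>Mo\<close>.\<close>
    have "\<exists>!z. z \<in> Mo (tgt L p) \<and> Ma p z = \<theta> a \<and> Ma q z = \<theta> a'"
    proof (rule Mo_pushout[OF e po S])
      show "\<theta> a \<in> Mo (tgt L e)" "\<theta> a' \<in> Mo (tgt L f)"
        using cov(2)[of a] cov(2)[of a'] ab(2) ab'(2) S by (simp_all add: Mo1)
      show "Ma e (\<theta> a) = Ma f (\<theta> a')" using \<theta>a eq'(1) by simp
    qed
    moreover have "\<theta> h \<in> Mo (tgt L p) \<and> Ma p (\<theta> h) = \<theta> a \<and> Ma q (\<theta> h) = \<theta> a'"
      using \<theta>(1,2) h cov(2)[OF h(1)] S ht by simp
    moreover have "\<theta> k \<in> Mo (tgt L p) \<and> Ma p (\<theta> k) = \<theta> a \<and> Ma q (\<theta> k) = \<theta> a'"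
      using \<theta>(3,4) k cov(2)[OF k(1)] S ht ab(2) ab'(2) by (simp add: Mo1)
    ultimately have "\<theta> h = \<theta> k" by blast
    then have hk: "(h, k) \<in> Mo1 (tgt L p)" using h k ht by (simp add: Mo1)
    show "\<exists>!z. z \<in> Mo1 (tgt L p) \<and> Ma1 p z = x \<and> Ma1 q z = y"
    proof (rule ex1I[of _ "(h, k)"])
      show "(h, k) \<in> Mo1 (tgt L p) \<and> Ma1 p (h, k) = x \<and> Ma1 q (h, k) = y"
        using hk h k ab ab' by (simp add: Ma1_def)
      fix z assume z: "z \<in> Mo1 (tgt L p) \<and> Ma1 p z = x \<and> Ma1 q z = y"
      then obtain m n where mn: "z = (m, n)" "(m, n) \<in> Mo1 (tgt L p)" by (cases z) auto
      then have e4: "m \<cdot> p = a" "m \<cdot> q = a'" "n \<cdot> p = b" "n \<cdot> q = b'"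
        using z ab(1) ab'(1) by (simp_all add: Ma1_def)
      have "m = h" by (rule pushout_unique[OF po]) (use e4 mn(2) h ht in \<open>simp_all add: Mo1\<close>)
      moreover have "n = k" by (rule pushout_unique[OF po]) (use e4 mn(2) k ht in \<open>simp_all add: Mo1\<close>)
      ultimately show "z = (h, k)" using mn by simp
    qed
  qed
  obtain X\<^sub>1 \<theta>\<^sub>1 where cover1: "M1.full_cover X\<^sub>1 \<theta>\<^sub>1" using M1.ex_full_cover by blast
  note cov1 = M1.full_coverD[OF cover1]
  have \<theta>\<^sub>1: "fst (\<theta>\<^sub>1 u) \<in> arr L \<and> src L (fst (\<theta>\<^sub>1 u)) = src L u \<and> tgt L (fst (\<theta>\<^sub>1 u)) = X\<^sub>0"
    "snd (\<theta>\<^sub>1 u) \<in> arr L \<and> src L (snd (\<theta>\<^sub>1 u)) = src L u \<and> tgt L (snd (\<theta>\<^sub>1 u)) = X\<^sub>0"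
    "\<theta> (fst (\<theta>\<^sub>1 u)) = \<theta> (snd (\<theta>\<^sub>1 u))"
    if "u \<in> arr L" "src L u \<in> S" "tgt L u = X\<^sub>1" for u
    using cov1(2)[OF that] by (cases "\<theta>\<^sub>1 u"; simp add: Mo1)+
  have \<theta>\<^sub>1_cmp: "fst (\<theta>\<^sub>1 (u \<cdot> f)) = fst (\<theta>\<^sub>1 u) \<cdot> f" "snd (\<theta>\<^sub>1 (u \<cdot> f)) = snd (\<theta>\<^sub>1 u) \<cdot> f"
    if "u \<in> arr L" "f \<in> arr L" "tgt L u = X\<^sub>1" "tgt L f = src L u" "src L u \<in> S" "src L f \<in> S" for u f
    using cov1(3)[OF that(1,2,5,3,6,4)] by (simp_all add: Ma1_def case_prod_beta)
  \<comment> \<open>Density turns the two components of the second cover into arrows of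
    \<open>L\<close>.\<close>
  obtain d\<^sub>0 where d0: "d\<^sub>0 \<in> arr L" "src L d\<^sub>0 = X\<^sub>1" "tgt L d\<^sub>0 = X\<^sub>0"
      "\<And>u. u \<in> arr L \<Longrightarrow> src L u \<in> S \<Longrightarrow> tgt L u = X\<^sub>1 \<Longrightarrow> d\<^sub>0 \<cdot> u = fst (\<theta>\<^sub>1 u)"
    by (rule S_dense[OF cov1(1) cov(1) \<theta>\<^sub>1(1) \<theta>\<^sub>1_cmp(1)], assumption+) (rule that, assumption+)
  obtain d\<^sub>1 where d1: "d\<^sub>1 \<in> arr L" "src L d\<^sub>1 = X\<^sub>1" "tgt L d\<^sub>1 = X\<^sub>0"
      "\<And>u. u \<in> arr L \<Longrightarrow> src L u \<in> S \<Longrightarrow> tgt L u = X\<^sub>1 \<Longrightarrow> d\<^sub>1 \<cdot> u = snd (\<theta>\<^sub>1 u)"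
    by (rule S_dense[OF cov1(1) cov(1) \<theta>\<^sub>1(2) \<theta>\<^sub>1_cmp(2)], assumption+) (rule that, assumption+)
  have \<theta>\<^sub>1_d: "\<theta>\<^sub>1 u = (d\<^sub>0 \<cdot> u, d\<^sub>1 \<cdot> u)" if "u \<in> arr L" "src L u \<in> S" "tgt L u = X\<^sub>1" for u
    using d0(4)[OF that] d1(4)[OF that] by simp
  \<comment> \<open>On arrows from \<open>S\<close> the cover \<open>\<theta>\<^sub>1\<close> is the
    pair of \<open>d\<^sub>0\<close> and \<open>d\<^sub>1\<close>, so agreement under it is a
    condition inside \<open>L\<close> and its kernel pair can be formed there.\<close>
  obtain p q where pq: "p \<in> arr L" "q \<in> arr L" "src L q = src L p" "tgt L p = X\<^sub>1" "tgt L q = X\<^sub>1"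
    and dpq: "d\<^sub>0 \<cdot> p = d\<^sub>0 \<cdot> q" "d\<^sub>1 \<cdot> p = d\<^sub>1 \<cdot> q"
    and K: "\<And>u v. u \<in> arr L \<Longrightarrow> v \<in> arr L \<Longrightarrow> src L u \<in> S \<Longrightarrow> src L v = src L u \<Longrightarrow> tgt L u = X\<^sub>1 \<Longrightarrow> tgt L v = X\<^sub>1 \<Longrightarrow>
      d\<^sub>0 \<cdot> u = d\<^sub>0 \<cdot> v \<Longrightarrow> d\<^sub>1 \<cdot> u = d\<^sub>1 \<cdot> v \<Longrightarrow>
      \<exists>k \<in> arr L. src L k = src L u \<and> tgt L k = src L p \<and> p \<cdot> k = u \<and> q \<cdot> k = v"
    and Kinj: "\<And>k l. k \<in> arr L \<Longrightarrow> l \<in> arr L \<Longrightarrow> src L k \<in> S \<Longrightarrow> src L l = src L k \<Longrightarrow> tgt L k = src L p \<Longrightarrow>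
      tgt L l = src L p \<Longrightarrow> p \<cdot> k = p \<cdot> l \<Longrightarrow> q \<cdot> k = q \<cdot> l \<Longrightarrow> k = l"
    by (rule ex_joint_kernel_pair[OF d0(1) d1(1) d0(2) d1(2)]) (rule that, assumption+)
  have sound: "\<theta>\<^sub>1 (p \<cdot> k) = \<theta>\<^sub>1 (q \<cdot> k)" if k: "k \<in> arr L" "src L k \<in> S" "tgt L k = src L p" for k
  proof -
    have "d\<^sub>0 \<cdot> (p \<cdot> k) = (d\<^sub>0 \<cdot> p) \<cdot> k" "d\<^sub>1 \<cdot> (p \<cdot> k) = (d\<^sub>1 \<cdot> p) \<cdot> k"
      using k pq d0(1,2) d1(1,2) by (simp_all add: cmp_assoc)
    moreover have "(d\<^sub>0 \<cdot> q) \<cdot> k = d\<^sub>0 \<cdot> (q \<cdot> k)" "(d\<^sub>1 \<cdot> q) \<cdot> k = d\<^sub>1 \<cdot> (q \<cdot> k)"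
      using k pq d0(1,2) d1(1,2) by (simp_all add: cmp_assoc)
    ultimately show ?thesis using \<theta>\<^sub>1_d[of "p \<cdot> k"] \<theta>\<^sub>1_d[of "q \<cdot> k"] k pq dpq by simp
  qed
  have complete: "\<exists>k \<in> arr L. src L k = src L u \<and> tgt L k = src L p \<and> p \<cdot> k = u \<and> q \<cdot> k = v"
    if uv: "u \<in> arr L" "v \<in> arr L" "src L u \<in> S" "src L v = src L u" "tgt L u = X\<^sub>1" "tgt L v = X\<^sub>1" "\<theta>\<^sub>1 u = \<theta>\<^sub>1 v" for u v
    by (rule K) (use uv \<theta>\<^sub>1_d[of u] \<theta>\<^sub>1_d[of v] in simp_all)
  \<comment> \<open>Dividing by this kernel pair makes \<open>\<theta>\<^sub>1\<close> injective on
    arrows from \<open>S\<close> and keeps it surjective, so the target of \<open>c\<^sub>1\<close>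
    represents \<open>Mo1\<close>.\<close>
  obtain c\<^sub>1 where coeq: "coequalizer L p q c\<^sub>1" and c1: "c\<^sub>1 \<in> arr L" "src L c\<^sub>1 = X\<^sub>1"
    and c1_surj: "\<And>y. y \<in> arr L \<Longrightarrow> src L y \<in> S \<Longrightarrow> tgt L y = tgt L c\<^sub>1 \<Longrightarrow>
      \<exists>a \<in> arr L. src L a = src L y \<and> tgt L a = X\<^sub>1 \<and> c\<^sub>1 \<cdot> a = y"
    and c1_iff: "\<And>a b. a \<in> arr L \<Longrightarrow> b \<in> arr L \<Longrightarrow> src L a \<in> S \<Longrightarrow> src L b = src L a \<Longrightarrow> tgt L a = X\<^sub>1 \<Longrightarrow> tgt L b = X\<^sub>1 \<Longrightarrow>
      c\<^sub>1 \<cdot> a = c\<^sub>1 \<cdot> b \<longleftrightarrow> \<theta>\<^sub>1 a = \<theta>\<^sub>1 b"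
    by (rule M1.full_quotient[OF cover1 pq sound complete Kinj], assumption+) (rule that, assumption+)
  obtain r\<^sub>0 where r0: "r\<^sub>0 \<in> arr L" "src L r\<^sub>0 = tgt L c\<^sub>1" "tgt L r\<^sub>0 = tgt L d\<^sub>0" "r\<^sub>0 \<cdot> c\<^sub>1 = d\<^sub>0"
    by (rule coequalizer_map[OF coeq d0(1) _ dpq(1)]) (use d0 pq in simp_all)
  obtain r\<^sub>1 where r1: "r\<^sub>1 \<in> arr L" "src L r\<^sub>1 = tgt L c\<^sub>1" "tgt L r\<^sub>1 = tgt L d\<^sub>1" "r\<^sub>1 \<cdot> c\<^sub>1 = d\<^sub>1"
    by (rule coequalizer_map[OF coeq d1(1) _ dpq(2)]) (use d1 pq in simp_all)
  have r_c: "r\<^sub>0 \<cdot> (c\<^sub>1 \<cdot> u) = fst (\<theta>\<^sub>1 u)" "r\<^sub>1 \<cdot> (c\<^sub>1 \<cdot> u) = snd (\<theta>\<^sub>1 u)"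
    if u: "u \<in> arr L" "src L u \<in> S" "tgt L u = X\<^sub>1" for u
  proof -
    have "r\<^sub>0 \<cdot> (c\<^sub>1 \<cdot> u) = (r\<^sub>0 \<cdot> c\<^sub>1) \<cdot> u" "r\<^sub>1 \<cdot> (c\<^sub>1 \<cdot> u) = (r\<^sub>1 \<cdot> c\<^sub>1) \<cdot> u"
      using u c1 r0(1,2) r1(1,2) by (simp_all add: cmp_assoc)
    then show "r\<^sub>0 \<cdot> (c\<^sub>1 \<cdot> u) = fst (\<theta>\<^sub>1 u)" "r\<^sub>1 \<cdot> (c\<^sub>1 \<cdot> u) = snd (\<theta>\<^sub>1 u)"
      using r0(4) r1(4) d0(4)[OF u] d1(4)[OF u] by simp_all
  qed
  have r_point: "\<exists>u \<in> arr L. src L u = src L k \<and> tgt L u = X\<^sub>1 \<and> c\<^sub>1 \<cdot> u = k \<and> r\<^sub>0 \<cdot> k = fst (\<theta>\<^sub>1 u) \<and>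
      r\<^sub>1 \<cdot> k = snd (\<theta>\<^sub>1 u)" if k: "k \<in> arr L" "src L k \<in> S" "tgt L k = src L r\<^sub>0" for k
  proof -
    obtain u where u: "u \<in> arr L" "src L u = src L k" "tgt L u = X\<^sub>1" "c\<^sub>1 \<cdot> u = k"
      using c1_surj[of k] k r0(2) by auto
    then show ?thesis using r_c[of u] k by auto
  qed
  \<comment> \<open>\<open>r\<^sub>0\<close> and \<open>r\<^sub>1\<close> now parametrize without
    repetition the pairs with equal image under \<theta>, which is what the second quotient
    requires.\<close>
  obtain c where c: "c \<in> arr L" "src L c = X\<^sub>0"
    and c_surj: "\<And>y. y \<in> arr L \<Longrightarrow> src L y \<in> S \<Longrightarrow> tgt L y = tgt L c \<Longrightarrow>
      \<exists>a \<in> arr L. src L a = src L y \<and> tgt L a = X\<^sub>0 \<and> c \<cdot> a = y"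
    and c_iff: "\<And>a b. a \<in> arr L \<Longrightarrow> b \<in> arr L \<Longrightarrow> src L a \<in> S \<Longrightarrow> src L b = src L a \<Longrightarrow> tgt L a = X\<^sub>0 \<Longrightarrow> tgt L b = X\<^sub>0 \<Longrightarrow>
      c \<cdot> a = c \<cdot> b \<longleftrightarrow> \<theta> a = \<theta> b"
  proof (rule full_quotient[OF cover r0(1) r1(1)])
    show "src L r\<^sub>1 = src L r\<^sub>0" "tgt L r\<^sub>0 = X\<^sub>0" "tgt L r\<^sub>1 = X\<^sub>0" using r0 r1 d0 d1 by simp_all
    show "\<theta> (r\<^sub>0 \<cdot> k) = \<theta> (r\<^sub>1 \<cdot> k)" if k: "k \<in> arr L" "src L k \<in> S" "tgt L k = src L r\<^sub>0" for k
      using r_point[OF k] \<theta>\<^sub>1(3) k by auto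
    show "\<exists>k \<in> arr L. src L k = src L a \<and> tgt L k = src L r\<^sub>0 \<and> r\<^sub>0 \<cdot> k = a \<and> r\<^sub>1 \<cdot> k = b"
      if ab: "a \<in> arr L" "b \<in> arr L" "src L a \<in> S" "src L b = src L a" "tgt L a = X\<^sub>0" "tgt L b = X\<^sub>0" "\<theta> a = \<theta> b" for a b
    proof -
      have "(a, b) \<in> Mo1 (src L a)" using ab by (simp add: Mo1)
      then obtain u where u: "u \<in> arr L" "src L u = src L a" "tgt L u = X\<^sub>1" "\<theta>\<^sub>1 u = (a, b)"
        by (rule M1.full_cover_surj[OF cover1 ab(3)])
      then show ?thesis
        using r_c[of u] ab(3) c1 r0(2) by (intro bexI[of _ "c\<^sub>1 \<cdot> u"]) simp_all
    qed
    show "k = l" if kl: "k \<in> arr L" "l \<in> arr L" "src L k \<in> S" "src L l = src L k" "tgt L k = src L r\<^sub>0"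
        "tgt L l = src L r\<^sub>0" "r\<^sub>0 \<cdot> k = r\<^sub>0 \<cdot> l" "r\<^sub>1 \<cdot> k = r\<^sub>1 \<cdot> l" for k l
    proof -
      obtain u where u: "u \<in> arr L" "src L u = src L k" "tgt L u = X\<^sub>1" "c\<^sub>1 \<cdot> u = k" "r\<^sub>0 \<cdot> k = fst (\<theta>\<^sub>1 u)"
          "r\<^sub>1 \<cdot> k = snd (\<theta>\<^sub>1 u)" using r_point[of k] kl by auto
      obtain v where v: "v \<in> arr L" "src L v = src L l" "tgt L v = X\<^sub>1" "c\<^sub>1 \<cdot> v = l" "r\<^sub>0 \<cdot> l = fst (\<theta>\<^sub>1 v)"
          "r\<^sub>1 \<cdot> l = snd (\<theta>\<^sub>1 v)" using r_point[of l] kl by auto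
      have eq: "\<theta>\<^sub>1 u = \<theta>\<^sub>1 v" using u(5,6) v(5,6) kl(7,8) by (simp add: prod_eq_iff)
      have "c\<^sub>1 \<cdot> u = c\<^sub>1 \<cdot> v"
        by (rule c1_iff[THEN iffD2]) (use u(1-3) v(1-3) kl(3,4) eq in simp_all)
      then show ?thesis using u(4) v(4) by simp
    qed
  qed (rule that, assumption+)
  \<comment> \<open>\<theta> is constant on the fibres of \<open>c\<close>, so it descends, and the
    choice of a preimage is immaterial.\<close>
  define \<tau> where "\<tau> y = \<theta> (SOME a. a \<in> arr L \<and> src L a = src L y \<and> tgt L a = X\<^sub>0 \<and> c \<cdot> a = y)" for y
  have \<tau>: "\<tau> (c \<cdot> a) = \<theta> a" if a: "a \<in> arr L" "src L a \<in> S" "tgt L a = X\<^sub>0" for a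
  proof -
    define b where "b = (SOME b. b \<in> arr L \<and> src L b = src L (c \<cdot> a) \<and> tgt L b = X\<^sub>0 \<and> c \<cdot> b = c \<cdot> a)"
    have "\<exists>b. b \<in> arr L \<and> src L b = src L (c \<cdot> a) \<and> tgt L b = X\<^sub>0 \<and> c \<cdot> b = c \<cdot> a" using a c by auto
    then have b: "b \<in> arr L \<and> src L b = src L (c \<cdot> a) \<and> tgt L b = X\<^sub>0 \<and> c \<cdot> b = c \<cdot> a"
      unfolding b_def by (rule someI_ex)
    have "\<theta> a = \<theta> b"
      by (rule c_iff[THEN iffD1]) (use a b c in simp_all)
    then show ?thesis by (simp add: \<tau>_def b_def)
  qed
  have pt: "\<exists>a. a \<in> arr L \<and> src L a = src L y \<and> tgt L a = X\<^sub>0 \<and> y = c \<cdot> a \<and> \<tau> y = \<theta> a"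
    if y: "y \<in> arr L" "src L y \<in> S" "tgt L y = tgt L c" for y
  proof -
    obtain a where a: "a \<in> arr L" "src L a = src L y" "tgt L a = X\<^sub>0" "c \<cdot> a = y" using c_surj[OF y] by blast
    then show ?thesis using \<tau>[of a] y by auto
  qed
  show ?thesis
  proof (rule that[of "tgt L c" \<tau>])
    show "tgt L c \<in> obj L" using c by simp
    show "\<tau> y \<in> Mo (src L y)" if y: "y \<in> arr L" "src L y \<in> S" "tgt L y = tgt L c" for y
    proof -
      obtain a where a: "a \<in> arr L" "src L a = src L y" "tgt L a = X\<^sub>0" "\<tau> y = \<theta> a" using pt[OF y] by blast
      have "\<theta> a \<in> Mo (src L a)" by (rule cov(2)) (use a y in simp_all)
      then show ?thesis using a by simp
    qed
    show "\<tau> (y \<cdot> f) = Ma f (\<tau> y)"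
      if y: "y \<in> arr L" "f \<in> arr L" "src L y \<in> S" "tgt L y = tgt L c" "src L f \<in> S" "tgt L f = src L y" for y f
    proof -
      obtain a where a: "a \<in> arr L" "src L a = src L y" "tgt L a = X\<^sub>0" "y = c \<cdot> a" "\<tau> y = \<theta> a"
        using pt[OF y(1,3,4)] by blast
      have "y \<cdot> f = c \<cdot> (a \<cdot> f)" unfolding a(4) using a(1-3) y(2,6) c by (simp add: cmp_assoc)
      then have "\<tau> (y \<cdot> f) = \<theta> (a \<cdot> f)" using \<tau>[of "a \<cdot> f"] a(1-3) y(2,5,6) by simp
      also have "\<dots> = Ma f (\<theta> a)" by (rule cov(3)) (use a(1-3) y(2,3,5,6) in simp_all)
      finally show ?thesis using a(5) by simp
    qed
    show "y = z" if yz: "y \<in> arr L" "z \<in> arr L" "src L y \<in> S" "src L z = src L y" "tgt L y = tgt L c" "tgt L z = tgt L c"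
        "\<tau> y = \<tau> z" for y z
    proof -
      obtain a where a: "a \<in> arr L" "src L a = src L y" "tgt L a = X\<^sub>0" "y = c \<cdot> a" "\<tau> y = \<theta> a"
        using pt[OF yz(1,3,5)] by blast
      have "src L z \<in> S" using yz by simp
      then obtain b where b: "b \<in> arr L" "src L b = src L z" "tgt L b = X\<^sub>0" "z = c \<cdot> b" "\<tau> z = \<theta> b"
        using pt[OF yz(2) _ yz(6)] by blast
      have "c \<cdot> a = c \<cdot> b"
        by (rule c_iff[THEN iffD2]) (use a(1-3,5) b(1-3,5) yz(3,4,7) in simp_all)
      then show ?thesis using a(4) b(4) by simp
    qed
    show "\<exists>y \<in> arr L. src L y = A \<and> tgt L y = tgt L c \<and> \<tau> y = x" if x: "A \<in> S" "x \<in> Mo A" for A x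
    proof -
      obtain a where a: "a \<in> arr L" "src L a = A" "tgt L a = X\<^sub>0" "\<theta> a = x"
        by (rule full_cover_surj[OF cover x])
      then show ?thesis using \<tau>[of a] x c by (intro bexI[of _ "c \<cdot> a"]) simp_all
    qed
  qed
qed

end

section \<open>Equivalences of categories\<close>

text \<open>The quasi-inverse chooses for each object a preimage up to isomorphism and conjugates
  arrows by these isomorphisms before lifting them; its laws hold because they hold after applying
  the faithful \<open>F\<close>.\<close>

lemma fully_faithful_ess_surj_equivalence:
  assumes C: "category C" and D: "category D" and F: "is_functor C D F"
    and ff: "\<And>A B g. A \<in> obj C \<Longrightarrow> B \<in> obj C \<Longrightarrow> g \<in> arr D \<Longrightarrow> src D g = omap F A \<Longrightarrow> tgt D g = omap F B \<Longrightarrow>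
      \<exists>f. f \<in> arr C \<and> src C f = A \<and> tgt C f = B \<and> amap F f = g"
    and faithful: "\<And>f g. f \<in> arr C \<Longrightarrow> g \<in> arr C \<Longrightarrow> src C f = src C g \<Longrightarrow> tgt C f = tgt C g \<Longrightarrow>
      amap F f = amap F g \<Longrightarrow> f = g"
    and es: "\<And>Y. Y \<in> obj D \<Longrightarrow> \<exists>X \<in> obj C. isomorphic D (omap F X) Y"
  shows "is_equivalence C D F"
proof -
  interpret C: category C by (rule C)
  interpret D: category D by (rule D)
  note F' = C.functorD[OF F]
  define Q where "Q Y X e e' \<longleftrightarrow> X \<in> obj C \<and> e \<in> arr D \<and> src D e = omap F X \<and> tgt D e = Y \<and>
      e' \<in> arr D \<and> src D e' = Y \<and> tgt D e' = omap F X \<and>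
      cmp D e' e = ide D (omap F X) \<and> cmp D e e' = ide D Y" for Y X e e'
  have "\<exists>X e e'. Q Y X e e'" if Y: "Y \<in> obj D" for Y
  proof -
    obtain X e where X: "X \<in> obj C" and e: "e \<in> hom D (omap F X) Y" "is_iso D e"
      using es[OF Y] by (auto simp: isomorphic_def)
    have e': "src D e = omap F X" "tgt D e = Y" using e(1) by (simp_all add: D.in_hom)
    obtain g where "e \<in> arr D" "g \<in> arr D" "src D g = tgt D e" "tgt D g = src D e"
      "cmp D g e = ide D (src D e)" "cmp D e g = ide D (tgt D e)" by (rule D.isoE[OF e(2)])
    then have "Q Y X e g" using X e' by (simp add: Q_def)
    then show ?thesis by blast
  qed
  then obtain X e e' where Q: "\<And>Y. Y \<in> obj D \<Longrightarrow> Q Y (X Y) (e Y) (e' Y)" by metis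
  have X: "X Y \<in> obj C" and e: "e Y \<in> arr D" "src D (e Y) = omap F (X Y)" "tgt D (e Y) = Y"
    "e' Y \<in> arr D" "src D (e' Y) = Y" "tgt D (e' Y) = omap F (X Y)"
    and ee: "cmp D (e' Y) (e Y) = ide D (omap F (X Y))" "cmp D (e Y) (e' Y) = ide D Y"
    if "Y \<in> obj D" for Y
    using Q[OF that] by (simp_all add: Q_def)
  define lift where "lift A B g = (SOME f. f \<in> arr C \<and> src C f = A \<and> tgt C f = B \<and> amap F f = g)" for A B g
  have lift: "lift A B g \<in> arr C" "src C (lift A B g) = A" "tgt C (lift A B g) = B" "amap F (lift A B g) = g"
    if "A \<in> obj C" "B \<in> obj C" "g \<in> arr D" "src D g = omap F A" "tgt D g = omap F B" for A B g
    using someI_ex[OF ff[OF that]] by (simp_all add: lift_def)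
  define G where "G g = lift (X (src D g)) (X (tgt D g)) (cmp D (e' (tgt D g)) (cmp D g (e (src D g))))" for g
  have G: "G g \<in> arr C" "src C (G g) = X (src D g)" "tgt C (G g) = X (tgt D g)"
    "amap F (G g) = cmp D (e' (tgt D g)) (cmp D g (e (src D g)))" if g: "g \<in> arr D" for g
  proof -
    note s = D.src_obj[OF g] and t = D.tgt_obj[OF g]
    have "cmp D (e' (tgt D g)) (cmp D g (e (src D g))) \<in> arr D"
      "src D (cmp D (e' (tgt D g)) (cmp D g (e (src D g)))) = omap F (X (src D g))"
      "tgt D (cmp D (e' (tgt D g)) (cmp D g (e (src D g)))) = omap F (X (tgt D g))"
      using e[OF s] e[OF t] g by simp_all
    from lift[OF X[OF s] X[OF t] this]
    show "G g \<in> arr C" "src C (G g) = X (src D g)" "tgt C (G g) = X (tgt D g)"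
      "amap F (G g) = cmp D (e' (tgt D g)) (cmp D g (e (src D g)))" by (simp_all add: G_def)
  qed
  define GF where "GF = \<lparr>omap = restrict X (obj D), amap = restrict G (arr D)\<rparr>"
  have GF [simp]: "Y \<in> obj D \<Longrightarrow> omap GF Y = X Y" "g \<in> arr D \<Longrightarrow> amap GF g = G g" for Y g
    by (simp_all add: GF_def)
  have fG: "is_functor D C GF"
    unfolding is_functor_def
  proof (intro conjI ballI impI)
    show "omap GF \<in> obj D \<rightarrow>\<^sub>E obj C" "amap GF \<in> arr D \<rightarrow>\<^sub>E arr C" using X G by (auto simp: GF_def)
    show "src C (amap GF g) = omap GF (src D g)" "tgt C (amap GF g) = omap GF (tgt D g)" if "g \<in> arr D" for g
      using that G by simp_all
    show "amap GF (ide D Y) = ide C (omap GF Y)" if Y: "Y \<in> obj D" for Y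
    proof -
      have "amap F (G (ide D Y)) = amap F (ide C (X Y))"
        using G[of "ide D Y"] Y e[OF Y] ee[OF Y] X[OF Y] F' by simp
      then have "G (ide D Y) = ide C (X Y)"
        by (rule faithful[rotated -1]) (use G[of "ide D Y"] Y X[OF Y] in simp_all)
      then show ?thesis using Y by simp
    qed
    show "amap GF (cmp D g f) = cmp C (amap GF g) (amap GF f)"
      if f: "f \<in> arr D" and g: "g \<in> arr D" and fg: "tgt D f = src D g" for f g
    proof -
      note s = D.src_obj[OF f] and t = D.tgt_obj[OF g] and m = D.src_obj[OF g]
      have gf: "cmp D g f \<in> arr D" using f g fg by simp
      have "amap F (cmp C (G g) (G f)) = cmp D (amap F (G g)) (amap F (G f))"
        using G[OF f] G[OF g] fg by (intro F'(6)) simp_all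
      also have "\<dots> = cmp D (e' (tgt D g)) (cmp D g (cmp D (cmp D (e (src D g)) (e' (src D g))) (cmp D f (e (src D f)))))"
        using G[OF f] G[OF g] fg f g e[OF s] e[OF t] e[OF m] by (simp add: D.cmp_assoc)
      also have "\<dots> = amap F (G (cmp D g f))"
        using G[OF gf] f g fg e[OF s] e[OF t] ee(2)[OF m] by (simp add: D.cmp_assoc)
      finally have "G (cmp D g f) = cmp C (G g) (G f)"
        by (intro faithful) (use G[OF f] G[OF g] G[OF gf] f g fg in simp_all)
      then show ?thesis using f g gf by simp
    qed
  qed
  define \<eta> where "\<eta> = (\<lambda>A \<in> obj C. lift A (X (omap F A)) (e' (omap F A)))"
  have \<eta>: "\<eta> A \<in> arr C" "src C (\<eta> A) = A" "tgt C (\<eta> A) = X (omap F A)" "amap F (\<eta> A) = e' (omap F A)"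
    if A: "A \<in> obj C" for A
    using lift[OF A X e(4)] e(5,6) F'(1)[OF A] A by (simp_all add: \<eta>_def)
  have "naturally_isomorphic C C (id_fctr C) (fcomp C GF F)"
    unfolding naturally_isomorphic_def
  proof (intro exI[of _ \<eta>] conjI ballI)
    show "nat_trans C C (id_fctr C) (fcomp C GF F) \<eta>"
      unfolding nat_trans_def
    proof (intro conjI ballI)
      show "\<eta> \<in> extensional (obj C)" by (simp add: \<eta>_def)
      show "\<eta> A \<in> hom C (omap (id_fctr C) A) (omap (fcomp C GF F) A)" if "A \<in> obj C" for A
        using that \<eta> F' by (simp add: id_fctr_def C.in_hom)
      fix f assume f: "f \<in> arr C"
      note s = C.src_obj[OF f] and t = C.tgt_obj[OF f]
      have Ff: "amap F f \<in> arr D" "src D (amap F f) = omap F (src C f)" "tgt D (amap F f) = omap F (tgt C f)"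
        using F' f by simp_all
      note Gf = G[OF Ff(1)] and es = e[OF F'(1)[OF s]] and et = e[OF F'(1)[OF t]]
      have "amap F (cmp C (\<eta> (tgt C f)) f) = cmp D (e' (omap F (tgt C f))) (amap F f)"
        using F'(6)[of f "\<eta> (tgt C f)"] \<eta>[OF t] f by simp
      also have "\<dots> = cmp D (e' (omap F (tgt C f)))
          (cmp D (amap F f) (cmp D (e (omap F (src C f))) (e' (omap F (src C f)))))"
        using ee(2)[OF F'(1)[OF s]] Ff by simp
      also have "\<dots> = cmp D (amap F (G (amap F f))) (amap F (\<eta> (src C f)))"
        using Gf(4) \<eta>(4)[OF s] Ff es et by (simp add: D.cmp_assoc)
      also have "\<dots> = amap F (cmp C (G (amap F f)) (\<eta> (src C f)))"
        using Gf \<eta>[OF s] Ff by (intro F'(6)[symmetric]) simp_all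
      finally have "cmp C (\<eta> (tgt C f)) f = cmp C (G (amap F f)) (\<eta> (src C f))"
        by (intro faithful) (use Gf \<eta>[OF s] \<eta>[OF t] Ff f in simp_all)
      then show "cmp C (\<eta> (tgt C f)) (amap (id_fctr C) f) = cmp C (amap (fcomp C GF F) f) (\<eta> (src C f))"
        using f Ff by (simp add: id_fctr_def)
    qed
  next
    fix A assume A: "A \<in> obj C"
    note FA = F'(1)[OF A]
    define \<theta> where "\<theta> = lift (X (omap F A)) A (e (omap F A))"
    have \<theta>: "\<theta> \<in> arr C" "src C \<theta> = X (omap F A)" "tgt C \<theta> = A" "amap F \<theta> = e (omap F A)"
      using lift[OF X A e(1)] e(2,3) FA by (simp_all add: \<theta>_def)
    have "amap F (cmp C \<theta> (\<eta> A)) = amap F (ide C A)"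
      using F'(6)[of "\<eta> A" \<theta>] F'(5)[OF A] \<theta> \<eta>[OF A] ee(2)[OF FA] by simp
    then have 1: "cmp C \<theta> (\<eta> A) = ide C A" by (rule faithful[rotated -1]) (use \<theta> \<eta>[OF A] A in simp_all)
    have "amap F (cmp C (\<eta> A) \<theta>) = amap F (ide C (X (omap F A)))"
      using F'(6)[of \<theta> "\<eta> A"] F'(5)[OF X[OF FA]] \<theta> \<eta>[OF A] ee(1)[OF FA] by simp
    then have 2: "cmp C (\<eta> A) \<theta> = ide C (X (omap F A))"
      by (rule faithful[rotated -1]) (use \<theta> \<eta>[OF A] X[OF FA] in simp_all)
    show "is_iso C (\<eta> A)"
      unfolding is_iso_def using \<theta> \<eta>[OF A] 1 2 by (auto simp: C.in_hom)
  qed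
  moreover have "naturally_isomorphic D D (fcomp D F GF) (id_fctr D)"
    unfolding naturally_isomorphic_def
  proof (intro exI[of _ "restrict e (obj D)"] conjI ballI)
    show "nat_trans D D (fcomp D F GF) (id_fctr D) (restrict e (obj D))"
      unfolding nat_trans_def
    proof (intro conjI ballI)
      show "restrict e (obj D) Y \<in> hom D (omap (fcomp D F GF) Y) (omap (id_fctr D) Y)" if "Y \<in> obj D" for Y
        using that e by (simp add: id_fctr_def D.in_hom)
      fix g assume g: "g \<in> arr D"
      note s = D.src_obj[OF g] and t = D.tgt_obj[OF g]
      have "cmp D (e (tgt D g)) (amap F (G g)) = cmp D (cmp D (e (tgt D g)) (e' (tgt D g))) (cmp D g (e (src D g)))"
        using G(4)[OF g] e[OF s] e[OF t] g by (simp add: D.cmp_assoc)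
      also have "\<dots> = cmp D g (e (src D g))" using ee(2)[OF t] e[OF s] g by simp
      finally show "cmp D (restrict e (obj D) (tgt D g)) (amap (fcomp D F GF) g) =
          cmp D (amap (id_fctr D) g) (restrict e (obj D) (src D g))"
        using g by (simp add: id_fctr_def)
    qed simp
    show "is_iso D (restrict e (obj D) Y)" if Y: "Y \<in> obj D" for Y
      unfolding is_iso_def using e[OF Y] ee[OF Y] Y by (auto simp: D.in_hom)
  qed
  ultimately show ?thesis using F fG unfolding is_equivalence_def by blast
qed

section \<open>Functor categories\<close>

lemma functor_cat_simps [simp]:
  "F \<in> obj (functor_cat C D) \<longleftrightarrow> is_functor C D F"
  "(F, G, \<eta>) \<in> arr (functor_cat C D) \<longleftrightarrow> is_functor C D F \<and> is_functor C D G \<and> nat_trans C D F G \<eta>"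
  "src (functor_cat C D) (F, G, \<eta>) = F" "tgt (functor_cat C D) (F, G, \<eta>) = G"
  "ide (functor_cat C D) F = (F, F, \<lambda>A \<in> obj C. ide D (omap F A))"
  "cmp (functor_cat C D) (G', H, \<theta>) (F, G, \<eta>) = (F, H, \<lambda>A \<in> obj C. cmp D (\<theta> A) (\<eta> A))"
  by (auto simp: functor_cat_def)

lemma nat_transD:
  assumes "nat_trans C D F G \<eta>"
  shows "\<eta> \<in> extensional (obj C)" "A \<in> obj C \<Longrightarrow> \<eta> A \<in> arr D" "A \<in> obj C \<Longrightarrow> src D (\<eta> A) = omap F A"
    "A \<in> obj C \<Longrightarrow> tgt D (\<eta> A) = omap G A"
    "f \<in> arr C \<Longrightarrow> cmp D (\<eta> (tgt C f)) (amap F f) = cmp D (amap G f) (\<eta> (src C f))"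
  using assms by (simp_all add: nat_trans_def hom_def)

lemma category_functor_cat:
  assumes "category C" "category D"
  shows "category (functor_cat C D)"
proof -
  interpret C: category C by fact
  interpret D: category D by fact
  have ide: "nat_trans C D F F (\<lambda>A \<in> obj C. ide D (omap F A))" if F: "is_functor C D F" for F
    using C.functorD[OF F] by (simp add: nat_trans_def D.in_hom)
  have comp: "nat_trans C D F H (\<lambda>A \<in> obj C. cmp D (\<theta> A) (\<eta> A))"
    if F: "is_functor C D F" "is_functor C D G" "is_functor C D H" and n: "nat_trans C D F G \<eta>" "nat_trans C D G H \<theta>"
    for F G H \<eta> \<theta>
  proof -
    note F' = C.functorD[OF F(1)] and G' = C.functorD[OF F(2)] and H' = C.functorD[OF F(3)]
    note n1 = nat_transD[OF n(1)] and n2 = nat_transD[OF n(2)]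
    have "cmp D (cmp D (\<theta> (tgt C f)) (\<eta> (tgt C f))) (amap F f) = cmp D (amap H f) (cmp D (\<theta> (src C f)) (\<eta> (src C f)))"
      if f: "f \<in> arr C" for f
    proof -
      have "cmp D (cmp D (\<theta> (tgt C f)) (\<eta> (tgt C f))) (amap F f) = cmp D (\<theta> (tgt C f)) (cmp D (\<eta> (tgt C f)) (amap F f))"
        using f n1(2-4) n2(2-4) F' by (intro D.cmp_assoc) simp_all
      also have "\<dots> = cmp D (\<theta> (tgt C f)) (cmp D (amap G f) (\<eta> (src C f)))" using n1(5)[OF f] by simp
      also have "\<dots> = cmp D (cmp D (\<theta> (tgt C f)) (amap G f)) (\<eta> (src C f))"
        using f n1(2-4) n2(2-4) G' by (intro D.cmp_assoc[symmetric]) simp_all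
      also have "\<dots> = cmp D (cmp D (amap H f) (\<theta> (src C f))) (\<eta> (src C f))" using n2(5)[OF f] by simp
      also have "\<dots> = cmp D (amap H f) (cmp D (\<theta> (src C f)) (\<eta> (src C f)))"
        using f n1(2-4) n2(2-4) H' by (intro D.cmp_assoc) simp_all
      finally show ?thesis .
    qed
    then show ?thesis using n1(2-4) n2(2-4) by (simp add: nat_trans_def D.in_hom)
  qed
  show ?thesis
  proof
    fix f assume "f \<in> arr (functor_cat C D)"
    then show "src (functor_cat C D) f \<in> obj (functor_cat C D)" "tgt (functor_cat C D) f \<in> obj (functor_cat C D)"
      by (cases f; simp)+
  next
    fix F assume "F \<in> obj (functor_cat C D)"
    then show "ide (functor_cat C D) F \<in> hom (functor_cat C D) F F" using ide by (simp add: hom_def)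
  next
    fix f g F G H assume "f \<in> hom (functor_cat C D) F G" "g \<in> hom (functor_cat C D) G H"
    then show "cmp (functor_cat C D) g f \<in> hom (functor_cat C D) F H"
      by (cases f; cases g) (auto simp: hom_def intro: comp)
  next
    fix f F G assume "f \<in> hom (functor_cat C D) F G"
    then obtain \<eta> where \<eta>: "f = (F, G, \<eta>)" "nat_trans C D F G \<eta>" by (cases f) (auto simp: hom_def)
    note n = nat_transD[OF \<eta>(2)]
    have "(\<lambda>A \<in> obj C. cmp D (\<eta> A) (ide D (omap F A))) = \<eta>" "(\<lambda>A \<in> obj C. cmp D (ide D (omap G A)) (\<eta> A)) = \<eta>"
      by (rule extensionalityI[OF restrict_extensional n(1)]; use n in simp)+
    then show "cmp (functor_cat C D) f (ide (functor_cat C D) F) = f"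
      "cmp (functor_cat C D) (ide (functor_cat C D) G) f = f"
      using \<eta>(1) by (simp_all cong: restrict_cong)
  next
    fix f g h F G H K
    assume f: "f \<in> hom (functor_cat C D) F G" and g: "g \<in> hom (functor_cat C D) G H" and h: "h \<in> hom (functor_cat C D) H K"
    obtain \<eta> where \<eta>: "f = (F, G, \<eta>)" "nat_trans C D F G \<eta>" using f by (cases f) (auto simp: hom_def)
    obtain \<theta> where \<theta>: "g = (G, H, \<theta>)" "nat_trans C D G H \<theta>" using g by (cases g) (auto simp: hom_def)
    obtain \<zeta> where \<zeta>: "h = (H, K, \<zeta>)" "nat_trans C D H K \<zeta>" using h by (cases h) (auto simp: hom_def)
    have "cmp D (cmp D (\<zeta> A) (\<theta> A)) (\<eta> A) = cmp D (\<zeta> A) (cmp D (\<theta> A) (\<eta> A))" if "A \<in> obj C" for A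
      using that nat_transD[OF \<eta>(2)] nat_transD[OF \<theta>(2)] nat_transD[OF \<zeta>(2)] by (intro D.cmp_assoc) simp_all
    then show "cmp (functor_cat C D) (cmp (functor_cat C D) h g) f = cmp (functor_cat C D) h (cmp (functor_cat C D) g f)"
      by (auto simp: \<eta>(1) \<theta>(1) \<zeta>(1) fun_eq_iff)
  qed
qed

section \<open>The nerve functor\<close>

lemma terminal_set_cat:
  fixes \<kappa> :: "'u rel"
  assumes \<kappa>: "inaccessible \<kappa>"
  shows "terminal (set_cat \<kappa>) Z \<longleftrightarrow> (\<exists>x. Z = {x})"
proof
  assume Z: "terminal (set_cat \<kappa>) Z"
  fix b :: 'u
  have sm: "small \<kappa> {b}" and Zs: "small \<kappa> Z" using \<kappa> Z by (simp_all add: small_finite terminal_def)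
  then have *: "\<exists>!f. f \<in> hom (set_cat \<kappa>) {b} Z" using Z by (simp add: terminal_def)
  then obtain f where "f \<in> hom (set_cat \<kappa>) {b} Z" by blast
  then obtain x where x: "x \<in> Z" by (auto simp: hom_set_cat)
  have "y = x" if y: "y \<in> Z" for y
  proof -
    have "({b}, Z, \<lambda>_ \<in> {b}. x) \<in> hom (set_cat \<kappa>) {b} Z" "({b}, Z, \<lambda>_ \<in> {b}. y) \<in> hom (set_cat \<kappa>) {b} Z"
      using x y sm Zs by (auto simp: hom_set_cat)
    then have "({b}, Z, \<lambda>_ \<in> {b}. x) = ({b}, Z, \<lambda>_ \<in> {b}. y)" using * by blast
    then show ?thesis by (auto simp: fun_eq_iff split: if_splits)
  qed
  then show "\<exists>x. Z = {x}" using x by blast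
next
  assume "\<exists>x. Z = {x}"
  then obtain x where Z: "Z = {x}" by blast
  have "\<exists>!f. f \<in> hom (set_cat \<kappa>) A Z" if "small \<kappa> A" for A
  proof (rule ex1I[of _ "(A, Z, \<lambda>_ \<in> A. x)"])
    show "(A, Z, \<lambda>_ \<in> A. x) \<in> hom (set_cat \<kappa>) A Z" using that Z \<kappa> by (simp add: hom_set_cat small_finite)
    show "f = (A, Z, \<lambda>_ \<in> A. x)" if "f \<in> hom (set_cat \<kappa>) A Z" for f
      using that by (auto simp: hom_set_cat Z fun_eq_iff PiE_iff extensional_def)
  qed
  then show "terminal (set_cat \<kappa>) Z" using Z \<kappa> by (simp add: terminal_def small_finite)
qed

text \<open>Maps out of a one-point set are elements, which gives one direction; for the other, the
  mediating map is defined elementwise by unique choice.\<close>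

lemma pullback_set_cat:
  fixes \<kappa> :: "'u rel"
  assumes \<kappa>: "inaccessible \<kappa>"
    and arr: "(A, C, f) \<in> arr (set_cat \<kappa>)" "(B, C, g) \<in> arr (set_cat \<kappa>)"
      "(P, A, p) \<in> arr (set_cat \<kappa>)" "(P, B, q) \<in> arr (set_cat \<kappa>)"
    and comm: "\<And>z. z \<in> P \<Longrightarrow> f (p z) = g (q z)"
  shows "pullback (set_cat \<kappa>) (A, C, f) (B, C, g) (P, A, p) (P, B, q) \<longleftrightarrow>
    (\<forall>a \<in> A. \<forall>b \<in> B. f a = g b \<longrightarrow> (\<exists>!z. z \<in> P \<and> p z = a \<and> q z = b))" (is "?l \<longleftrightarrow> ?r")
proof
  assume l: ?l
  show ?r
  proof (intro ballI impI)
    fix a b assume ab: "a \<in> A" "b \<in> B" "f a = g b"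
    fix s :: 'u
    have sm: "small \<kappa> {s}" using \<kappa> by (simp add: small_finite)
    let ?u = "({s}, A, \<lambda>_ \<in> {s}. a)" and ?v = "({s}, B, \<lambda>_ \<in> {s}. b)"
    have uv: "?u \<in> hom (set_cat \<kappa>) {s} A" "?v \<in> hom (set_cat \<kappa>) {s} B" using ab sm arr by (auto simp: hom_set_cat)
    have "cmp (set_cat \<kappa>) (A, C, f) ?u = cmp (set_cat \<kappa>) (B, C, g) ?v"
      using ab by (auto simp: compose_def fun_eq_iff)
    then have *: "\<exists>!h. h \<in> hom (set_cat \<kappa>) {s} P \<and> cmp (set_cat \<kappa>) (P, A, p) h = ?u \<and> cmp (set_cat \<kappa>) (P, B, q) h = ?v"
      using l sm uv unfolding pullback_def by simp
    have pt: "({s}, P, \<lambda>_ \<in> {s}. z) \<in> hom (set_cat \<kappa>) {s} P \<and>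
        cmp (set_cat \<kappa>) (P, A, p) ({s}, P, \<lambda>_ \<in> {s}. z) = ?u \<and> cmp (set_cat \<kappa>) (P, B, q) ({s}, P, \<lambda>_ \<in> {s}. z) = ?v"
      if "z \<in> P" "p z = a" "q z = b" for z
    proof (intro conjI)
      show "({s}, P, \<lambda>_ \<in> {s}. z) \<in> hom (set_cat \<kappa>) {s} P" using that sm arr by (simp add: hom_set_cat)
    qed (use that in \<open>auto simp: compose_def fun_eq_iff\<close>)
    obtain h where h: "h \<in> hom (set_cat \<kappa>) {s} P" "cmp (set_cat \<kappa>) (P, A, p) h = ?u" "cmp (set_cat \<kappa>) (P, B, q) h = ?v"
      using * by blast
    obtain k where k: "h = ({s}, P, k)" "k \<in> {s} \<rightarrow>\<^sub>E P" using h(1) by (auto simp: hom_set_cat)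
    have z: "k s \<in> P" "p (k s) = a" "q (k s) = b"
      using h(2,3) k by (auto simp: compose_def fun_eq_iff split: if_splits)
    show "\<exists>!z. z \<in> P \<and> p z = a \<and> q z = b"
    proof (rule ex1I[of _ "k s"])
      show "k s \<in> P \<and> p (k s) = a \<and> q (k s) = b" using z by simp
      fix z assume "z \<in> P \<and> p z = a \<and> q z = b"
      then have "({s}, P, \<lambda>_ \<in> {s}. z) = ({s}, P, \<lambda>_ \<in> {s}. k s)" using * pt[of z] pt[of "k s"] z by blast
      then show "z = k s" by (auto simp: fun_eq_iff split: if_splits)
    qed
  qed
next
  assume r: ?r
  show ?l
    unfolding pullback_def
  proof (intro conjI ballI impI)
    show "cmp (set_cat \<kappa>) (A, C, f) (P, A, p) = cmp (set_cat \<kappa>) (B, C, g) (P, B, q)"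
      using comm by (auto simp: compose_def fun_eq_iff)
    fix X u v assume X: "X \<in> obj (set_cat \<kappa>)" and "u \<in> hom (set_cat \<kappa>) X (src (set_cat \<kappa>) (A, C, f))"
      "v \<in> hom (set_cat \<kappa>) X (src (set_cat \<kappa>) (B, C, g))"
      and eq: "cmp (set_cat \<kappa>) (A, C, f) u = cmp (set_cat \<kappa>) (B, C, g) v"
    then obtain m n where mn: "u = (X, A, m)" "m \<in> X \<rightarrow>\<^sub>E A" "v = (X, B, n)" "n \<in> X \<rightarrow>\<^sub>E B"
      by (auto simp: hom_set_cat)
    have fg: "f (m x) = g (n x)" if "x \<in> X" for x
      using eq that by (auto simp: mn compose_def fun_eq_iff split: if_splits)
    have ex: "\<exists>!z. z \<in> P \<and> p z = m x \<and> q z = n x" if "x \<in> X" for x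
      using r fg[OF that] mn that by (simp add: PiE_iff)
    define k where "k = (\<lambda>x \<in> X. THE z. z \<in> P \<and> p z = m x \<and> q z = n x)"
    have k: "k x \<in> P" "p (k x) = m x" "q (k x) = n x" if "x \<in> X" for x
      using theI'[OF ex[OF that]] that by (simp_all add: k_def)
    show "\<exists>!h. h \<in> hom (set_cat \<kappa>) X (src (set_cat \<kappa>) (P, A, p)) \<and> cmp (set_cat \<kappa>) (P, A, p) h = u \<and>
        cmp (set_cat \<kappa>) (P, B, q) h = v"
    proof (rule ex1I[of _ "(X, P, k)"])
      have "compose X p k = m" "compose X q k = n"
        by (rule extensionalityI[of _ X]; use k mn in \<open>simp add: compose_def PiE_iff\<close>)+
      moreover have "k \<in> X \<rightarrow>\<^sub>E P" using k by (simp add: k_def PiE_iff)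
      ultimately show "(X, P, k) \<in> hom (set_cat \<kappa>) X (src (set_cat \<kappa>) (P, A, p)) \<and>
          cmp (set_cat \<kappa>) (P, A, p) (X, P, k) = u \<and> cmp (set_cat \<kappa>) (P, B, q) (X, P, k) = v"
        using X arr mn by (simp add: hom_set_cat)
      fix h assume h: "h \<in> hom (set_cat \<kappa>) X (src (set_cat \<kappa>) (P, A, p)) \<and> cmp (set_cat \<kappa>) (P, A, p) h = u \<and>
        cmp (set_cat \<kappa>) (P, B, q) h = v"
      then obtain l where l: "h = (X, P, l)" "l \<in> X \<rightarrow>\<^sub>E P" by (auto simp: hom_set_cat)
      have "l x = k x" if x: "x \<in> X" for x
      proof -
        have "compose X p l = m" "compose X q l = n" using h l mn by simp_all
        then have "p (l x) = m x" "q (l x) = n x" using x by (auto simp: compose_def)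
        then show ?thesis using ex[OF x] k[OF x] l(2) x by (auto simp: PiE_iff)
      qed
      then have "l = k" by (intro extensionalityI[of _ X]) (use l in \<open>auto simp: k_def PiE_iff\<close>)
      then show "h = (X, P, k)" using l by simp
    qed
  qed (use arr in simp_all)
qed

section \<open>The clan of compact 0-extensions and the nerves as its models\<close>

context clan_algebraic_category
begin

abbreviation "C \<equiv> op (full_sub L S)"

lemma ext_clan_simps [simp]:
  "ucat (ext_clan L E S) = C" "display (ext_clan L E S) = E \<inter> arr (full_sub L S)"
  by (simp_all add: ext_clan_def)

lemma category_C: "category C"
  by (rule category.category_op[OF category_full_sub[OF S_subset]])

lemma hom_full_sub: "A \<in> S \<Longrightarrow> B \<in> S \<Longrightarrow> hom (full_sub L S) A B = hom L A B"
  by (auto simp: hom_def)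

text \<open>\<open>S\<close> contains an initial object of \<open>L\<close>, and an object initial
  among those of \<open>S\<close> is isomorphic to it.\<close>

lemma terminal_C: "terminal C t \<longleftrightarrow> t \<in> S \<and> initial L t"
proof
  assume t: "terminal C t"
  then have tS: "t \<in> S" by (simp add: terminal_def)
  have uniq: "\<exists>!f. f \<in> hom L t A" if "A \<in> S" for A
    using t that tS by (simp add: terminal_def hom_full_sub)
  obtain I where I: "I \<in> S" "initial L I" by (rule S_initial)
  obtain i where i: "i \<in> arr L" "src L i = I" "tgt L i = t" by (rule initial_arrow[OF I(2) S_obj[OF tS]])
  obtain j where j: "j \<in> arr L" "src L j = t" "tgt L j = I" using uniq[OF I(1)] by (auto simp: in_hom)
  have "j \<cdot> i = ide L I" by (rule initial_unique[OF I(2)]) (use i j I in simp_all)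
  moreover have "i \<cdot> j = ide L t"
  proof -
    have "i \<cdot> j \<in> hom L t t" "ide L t \<in> hom L t t" using i j tS by (simp_all add: in_hom)
    then show ?thesis using uniq[OF tS] by blast
  qed
  ultimately have "is_iso L i" using is_isoI[of i j] i j by simp
  then show "t \<in> S \<and> initial L t" using initial_iso[OF I(2), of i] i tS by simp
next
  assume "t \<in> S \<and> initial L t"
  then show "terminal C t" by (simp add: terminal_def initial_def hom_full_sub)
qed

text \<open>A pushout in \<open>L\<close> with apex in \<open>S\<close> exists by
  \<open>S_pushout\<close>, and a pushout in the full subcategory is identified with it by mutually
  inverse mediating arrows. This lets the model axioms, which speak of the clan, be used in
  \<open>L\<close>.\<close>

lemma pushout_full_sub:
  assumes e: "e \<in> E" "src L e \<in> S" "tgt L e \<in> S"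
  shows "pushout (full_sub L S) e f p q \<longleftrightarrow> pushout L e f p q \<and> tgt L f \<in> S \<and> tgt L p \<in> S" (is "?l \<longleftrightarrow> ?r")
proof
  interpret FS: category "full_sub L S" by (rule category_full_sub[OF S_subset])
  show ?l if r: ?r
  proof -
    from r have po: "pushout L e f p q" and S: "tgt L f \<in> S" "tgt L p \<in> S" by simp_all
    note P = pushoutD[OF po]
    show ?l
    proof (rule FS.pushoutI)
      fix u v assume uv: "u \<in> arr (full_sub L S)" "v \<in> arr (full_sub L S)"
        "src (full_sub L S) u = tgt (full_sub L S) e" "src (full_sub L S) v = tgt (full_sub L S) f"
        "tgt (full_sub L S) v = tgt (full_sub L S) u" "cmp (full_sub L S) u e = cmp (full_sub L S) v f"
      obtain h where "h \<in> arr L" "src L h = tgt L p" "tgt L h = tgt L u" "h \<cdot> p = u" "h \<cdot> q = v"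
        by (rule pushout_map[OF po, of u v]) (use uv in simp_all)
      then show "\<exists>h. h \<in> arr (full_sub L S) \<and> src (full_sub L S) h = tgt (full_sub L S) p \<and>
          tgt (full_sub L S) h = tgt (full_sub L S) u \<and> cmp (full_sub L S) h p = u \<and> cmp (full_sub L S) h q = v"
        using uv S by (intro exI[of _ h]) simp
    next
      fix h k assume hk: "h \<in> arr (full_sub L S)" "k \<in> arr (full_sub L S)" "src (full_sub L S) h = tgt (full_sub L S) p"
        "src (full_sub L S) k = tgt (full_sub L S) p" "tgt (full_sub L S) k = tgt (full_sub L S) h"
        "cmp (full_sub L S) h p = cmp (full_sub L S) k p" "cmp (full_sub L S) h q = cmp (full_sub L S) k q"
      show "h = k" by (rule pushout_unique[OF po]) (use hk in simp_all)
    qed (use P S e in simp_all)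
  qed
  assume l: ?l
  note P = FS.pushoutD[OF l, simplified]
  obtain p' q' where po: "pushout L e f p' q'" "tgt L p' \<in> S"
    by (rule S_pushout[OF e, of f]) (use P in simp_all)
  note P' = pushoutD[OF po(1)]
  obtain h where h: "h \<in> arr (full_sub L S)" "src (full_sub L S) h = tgt (full_sub L S) p"
    "tgt (full_sub L S) h = tgt (full_sub L S) p'" "cmp (full_sub L S) h p = p'" "cmp (full_sub L S) h q = q'"
    by (rule FS.pushout_map[OF l, of p' q']) (use P P' po in simp_all)
  obtain k where k: "k \<in> arr L" "src L k = tgt L p'" "tgt L k = tgt L p" "k \<cdot> p' = p" "k \<cdot> q' = q"
    by (rule pushout_map[OF po(1), of p q]) (use P in simp_all)
  have "k \<cdot> h = ide L (tgt L p)"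
  proof -
    have "(k \<cdot> h) \<cdot> p = k \<cdot> (h \<cdot> p)" "(k \<cdot> h) \<cdot> q = k \<cdot> (h \<cdot> q)"
      using k(1,2) h(1-3) P by (simp_all add: cmp_assoc)
    then have "(k \<cdot> h) \<cdot> p = p" "(k \<cdot> h) \<cdot> q = q" using h(4,5) k(4,5) by simp_all
    then show ?thesis
      by (intro FS.pushout_unique[OF l, of "k \<cdot> h" "ide L (tgt L p)", simplified]; (use h k P in simp)?)
  qed
  moreover have "h \<cdot> k = ide L (tgt L p')"
  proof -
    have "(h \<cdot> k) \<cdot> p' = h \<cdot> (k \<cdot> p')" "(h \<cdot> k) \<cdot> q' = h \<cdot> (k \<cdot> q')"
      using k(1-3) h(1-3) P' by (simp_all add: cmp_assoc)
    then have eq: "(h \<cdot> k) \<cdot> p' = p'" "(h \<cdot> k) \<cdot> q' = q'" using h(4,5) k(4,5) by simp_all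
    show ?thesis by (rule pushout_unique[OF po(1)]) (use eq h k P' in simp_all)
  qed
  ultimately have "is_iso L k" using is_isoI[of k h] h k by simp
  from pushout_iso[OF po(1) this] k P show ?r by simp
qed

lemma nerve_obj_simps [simp]:
  "A \<in> S \<Longrightarrow> omap (nerve_obj L S X) A = hom L A X"
  "f \<in> arr L \<Longrightarrow> src L f \<in> S \<Longrightarrow> tgt L f \<in> S \<Longrightarrow> amap (nerve_obj L S X) f =
     (hom L (tgt L f) X, hom L (src L f) X, \<lambda>g \<in> hom L (tgt L f) X. g \<cdot> f)"
  by (simp_all add: nerve_obj_def)

lemma small_hom: "A \<in> S \<Longrightarrow> X \<in> obj L \<Longrightarrow> small \<kappa> (hom L A X)"
  using locally_small by (simp add: locally_small_def)

lemma functor_nerve_obj: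
  assumes X: "X \<in> obj L"
  shows "is_functor C (set_cat \<kappa>) (nerve_obj L S X)"
  unfolding is_functor_def
proof (intro conjI ballI impI)
  have "omap (nerve_obj L S X) \<in> extensional S" by (simp add: nerve_obj_def)
  then show "omap (nerve_obj L S X) \<in> obj C \<rightarrow>\<^sub>E obj (set_cat \<kappa>)" using small_hom X by (simp add: PiE_iff)
  have "amap (nerve_obj L S X) \<in> extensional (arr C)" by (simp add: nerve_obj_def)
  then show "amap (nerve_obj L S X) \<in> arr C \<rightarrow>\<^sub>E arr (set_cat \<kappa>)"
    using small_hom X by (auto simp: PiE_iff in_hom)
  show "src (set_cat \<kappa>) (amap (nerve_obj L S X) f) = omap (nerve_obj L S X) (src C f)"
    "tgt (set_cat \<kappa>) (amap (nerve_obj L S X) f) = omap (nerve_obj L S X) (tgt C f)" if "f \<in> arr C" for f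
    using that by simp_all
  show "amap (nerve_obj L S X) (ide C A) = ide (set_cat \<kappa>) (omap (nerve_obj L S X) A)" if "A \<in> obj C" for A
    using that by (auto simp: fun_eq_iff in_hom)
  show "amap (nerve_obj L S X) (cmp C g f) = cmp (set_cat \<kappa>) (amap (nerve_obj L S X) g) (amap (nerve_obj L S X) f)"
    if "f \<in> arr C" "g \<in> arr C" "tgt C f = src C g" for f g
    using that by (auto simp: fun_eq_iff compose_def in_hom cmp_assoc)
qed

lemma model_nerve_obj:
  assumes X: "X \<in> obj L"
  shows "is_model \<kappa> (ext_clan L E S) (nerve_obj L S X)"
  unfolding is_model_def ext_clan_simps
proof (intro conjI allI impI ballI)
  show "is_functor C (set_cat \<kappa>) (nerve_obj L S X)" by (rule functor_nerve_obj[OF X])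
next
  fix t assume "terminal C t"
  then have t: "t \<in> S" "initial L t" by (simp_all add: terminal_C)
  obtain i where "i \<in> arr L" "src L i = t" "tgt L i = X" by (rule initial_arrow[OF t(2) X])
  then have "hom L t X = {i}" using initial_unique[OF t(2)] by (auto simp: in_hom)
  then show "terminal (set_cat \<kappa>) (omap (nerve_obj L S X) t)" using t by (simp add: terminal_set_cat[OF inacc])
next
  fix e f p q assume "e \<in> E \<inter> arr (full_sub L S)" and "pullback C e f p q"
  then have e: "e \<in> E" "src L e \<in> S" "tgt L e \<in> S" and po: "pushout L e f p q" "tgt L f \<in> S" "tgt L p \<in> S"
    using pushout_full_sub[of e f p q] by simp_all
  note P = pushoutD[OF po(1)]
  have "\<exists>!h. h \<in> hom L (tgt L p) X \<and> (\<lambda>g \<in> hom L (tgt L p) X. g \<cdot> p) h = u \<and> (\<lambda>g \<in> hom L (tgt L p) X. g \<cdot> q) h = v"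
    if u: "u \<in> hom L (tgt L e) X" and v: "v \<in> hom L (tgt L f) X" and eq: "u \<cdot> e = v \<cdot> f" for u v
  proof -
    obtain h where h: "h \<in> arr L" "src L h = tgt L p" "tgt L h = tgt L u" "h \<cdot> p = u" "h \<cdot> q = v"
      by (rule pushout_map[OF po(1), of u v]) (use u v eq in \<open>simp_all add: in_hom\<close>)
    show ?thesis
    proof (rule ex1I[of _ h])
      show "h \<in> hom L (tgt L p) X \<and> (\<lambda>g \<in> hom L (tgt L p) X. g \<cdot> p) h = u \<and> (\<lambda>g \<in> hom L (tgt L p) X. g \<cdot> q) h = v"
        using h u by (simp add: in_hom)
      fix k assume k: "k \<in> hom L (tgt L p) X \<and> (\<lambda>g \<in> hom L (tgt L p) X. g \<cdot> p) k = u \<and>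
        (\<lambda>g \<in> hom L (tgt L p) X. g \<cdot> q) k = v"
      show "k = h" by (rule pushout_unique[OF po(1)]) (use h k u in \<open>auto simp: in_hom\<close>)
    qed
  qed
  then show "pullback (set_cat \<kappa>) (amap (nerve_obj L S X) e) (amap (nerve_obj L S X) f)
      (amap (nerve_obj L S X) p) (amap (nerve_obj L S X) q)"
    using e po P small_hom[OF _ X]
    by (simp, subst pullback_set_cat[OF inacc]) (auto simp: in_hom cmp_assoc)
qed

lemma functor_C_amap:
  assumes M: "is_functor C (set_cat \<kappa>) M" and f: "f \<in> arr L" "src L f \<in> S" "tgt L f \<in> S"
  shows "amap M f = (omap M (tgt L f), omap M (src L f), snd (snd (amap M f)))"
    "snd (snd (amap M f)) \<in> omap M (tgt L f) \<rightarrow>\<^sub>E omap M (src L f)"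
proof -
  note M' = category.functorD[OF category_C M]
  obtain A B m where m: "amap M f = (A, B, m)" by (cases "amap M f")
  have "(A, B, m) \<in> arr (set_cat \<kappa>)" "src (set_cat \<kappa>) (A, B, m) = omap M (tgt L f)"
    "tgt (set_cat \<kappa>) (A, B, m) = omap M (src L f)"
    using M'(2-4)[of f] f by (simp_all add: m)
  then show "amap M f = (omap M (tgt L f), omap M (src L f), snd (snd (amap M f)))"
    "snd (snd (amap M f)) \<in> omap M (tgt L f) \<rightarrow>\<^sub>E omap M (src L f)"
    using m by simp_all
qed

text \<open>Passes from functors into \<open>set_cat\<close>, whose arrows carry their domain and
  codomain, to the bare functions of the locale \<open>model\<close>.\<close>

lemma is_model_model:
  assumes M: "is_model \<kappa> (ext_clan L E S) M"
  shows "model L \<kappa> E F S (omap M) (\<lambda>f. snd (snd (amap M f)))"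
proof -
  have fM: "is_functor C (set_cat \<kappa>) M" using M by (simp add: is_model_def)
  note M' = category.functorD[OF category_C fM] and am = functor_C_amap[OF fM]
  let ?m = "\<lambda>f. snd (snd (amap M f))"
  have m_in: "?m f x \<in> omap M (src L f)"
    if "f \<in> arr L" "src L f \<in> S" "tgt L f \<in> S" "x \<in> omap M (tgt L f)" for f x
    using am(2)[OF that(1-3)] that(4) by (rule PiE_mem)
  have m_cmp: "?m (g \<cdot> f) x = ?m f (?m g x)"
    if "f \<in> arr L" "g \<in> arr L" "tgt L f = src L g" "src L f \<in> S" "src L g \<in> S" "tgt L g \<in> S" "x \<in> omap M (tgt L g)" for f g x
  proof -
    have "amap M (g \<cdot> f) = cmp (set_cat \<kappa>) (amap M f) (amap M g)"
      using M'(6)[of g f] that by simp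
    also have "\<dots> = (omap M (tgt L g), omap M (src L f), compose (omap M (tgt L g)) (?m f) (?m g))"
      using am(1)[of f] am(1)[of g] that by (metis set_cat_simps(6))
    finally show ?thesis using that by (simp add: compose_def)
  qed
  show ?thesis
  proof (intro model.intro presheaf.intro presheaf_axioms.intro model_axioms.intro clan_algebraic_category_axioms)
    show "?m (ide L A) x = x" if "A \<in> S" "x \<in> omap M A" for A x
      using M'(5)[of A] that by simp
    show "small \<kappa> (omap M A)" if "A \<in> S" for A using M'(1)[of A] that by simp
    show "\<exists>x. omap M I = {x}" if "initial L I" "I \<in> S" for I
      using M that by (simp add: is_model_def terminal_C terminal_set_cat[OF inacc])
  next
    fix e f p q x y
    assume e: "e \<in> E" and po: "pushout L e f p q" and S: "src L e \<in> S" "tgt L e \<in> S" "tgt L f \<in> S" "tgt L p \<in> S"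
      and xy: "x \<in> omap M (tgt L e)" "y \<in> omap M (tgt L f)" "?m e x = ?m f y"
    note P = pushoutD[OF po]
    have ea: "e \<in> arr (full_sub L S)" "pullback C e f p q"
      using pushout_full_sub[OF e S(1,2), of f p q] po S P by simp_all
    have "pullback (set_cat \<kappa>) (amap M e) (amap M f) (amap M p) (amap M q)"
      using M e ea unfolding is_model_def ext_clan_simps by blast
    then have pb: "pullback (set_cat \<kappa>) (omap M (tgt L e), omap M (src L e), ?m e)
        (omap M (tgt L f), omap M (src L e), ?m f) (omap M (tgt L p), omap M (tgt L e), ?m p)
        (omap M (tgt L p), omap M (tgt L f), ?m q)"
      using am(1)[of e] am(1)[of f] am(1)[of p] am(1)[of q] P S by simp
    moreover have "?m e (?m p z) = ?m f (?m q z)" if z: "z \<in> omap M (tgt L p)" for z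
      using m_cmp[of e p z] m_cmp[of f q z] P S z by simp
    ultimately show "\<exists>!z. z \<in> omap M (tgt L p) \<and> ?m p z = x \<and> ?m q z = y"
      using pullback_set_cat[OF inacc, of "omap M (tgt L e)" "omap M (src L e)" "?m e" "omap M (tgt L f)" "?m f"
          "omap M (tgt L p)" "?m p" "?m q"] xy by (auto simp: pullback_def)
  qed (fact m_in m_cmp)+
qed

section \<open>The category of models and its arrows\<close>

abbreviation "Models \<equiv> Mod \<kappa> (ext_clan L E S)"

lemma Models_simps [simp]:
  "M \<in> obj Models \<longleftrightarrow> is_model \<kappa> (ext_clan L E S) M"
  "(M, N, \<eta>) \<in> arr Models \<longleftrightarrow> is_model \<kappa> (ext_clan L E S) M \<and> is_model \<kappa> (ext_clan L E S) N \<and>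
     nat_trans C (set_cat \<kappa>) M N \<eta>"
  "src Models (M, N, \<eta>) = M" "tgt Models (M, N, \<eta>) = N"
  "ide Models M = (M, M, \<lambda>A \<in> S. ide (set_cat \<kappa>) (omap M A))"
  "cmp Models (N', K, \<theta>) (M, N, \<eta>) = (M, K, \<lambda>A \<in> S. cmp (set_cat \<kappa>) (\<theta> A) (\<eta> A))"
  by (auto simp: Mod_def is_model_def)

lemma category_Models: "category Models"
proof -
  interpret fc: category "functor_cat C (set_cat \<kappa>)"
    by (rule category_functor_cat[OF category_C category_set_cat])
  show ?thesis unfolding Mod_def ext_clan_simps
    by (rule fc.category_full_sub) (auto simp: is_model_def)
qed

lemma nat_trans_components:
  assumes \<eta>: "nat_trans C (set_cat \<kappa>) M N \<eta>" and A: "A \<in> S"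
  shows "\<eta> A = (omap M A, omap N A, snd (snd (\<eta> A)))" "snd (snd (\<eta> A)) \<in> omap M A \<rightarrow>\<^sub>E omap N A"
proof -
  obtain X Y m where m: "\<eta> A = (X, Y, m)" by (cases "\<eta> A")
  have "(X, Y, m) \<in> arr (set_cat \<kappa>)" "X = omap M A" "Y = omap N A"
    using nat_transD(2-4)[OF \<eta>, of A] A by (simp_all add: m)
  then show "\<eta> A = (omap M A, omap N A, snd (snd (\<eta> A)))" "snd (snd (\<eta> A)) \<in> omap M A \<rightarrow>\<^sub>E omap N A"
    using m by simp_all
qed

lemma nat_transI:
  assumes M: "is_functor C (set_cat \<kappa>) M" and N: "is_functor C (set_cat \<kappa>) N"
    and h: "\<And>A. A \<in> S \<Longrightarrow> h A \<in> omap M A \<rightarrow>\<^sub>E omap N A"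
    and nat: "\<And>f x. f \<in> arr L \<Longrightarrow> src L f \<in> S \<Longrightarrow> tgt L f \<in> S \<Longrightarrow> x \<in> omap M (tgt L f) \<Longrightarrow>
      h (src L f) (snd (snd (amap M f)) x) = snd (snd (amap N f)) (h (tgt L f) x)"
  shows "nat_trans C (set_cat \<kappa>) M N (\<lambda>A \<in> S. (omap M A, omap N A, h A))"
  unfolding nat_trans_def
proof (intro conjI ballI)
  show "(\<lambda>A \<in> S. (omap M A, omap N A, h A)) \<in> extensional (obj C)" by simp
  show "(\<lambda>A \<in> S. (omap M A, omap N A, h A)) A \<in> hom (set_cat \<kappa>) (omap M A) (omap N A)" if "A \<in> obj C" for A
    using that h category.functorD(1)[OF category_C M] category.functorD(1)[OF category_C N] by (simp add: hom_set_cat)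
  fix f assume "f \<in> arr C"
  then have f: "f \<in> arr L" "src L f \<in> S" "tgt L f \<in> S" by simp_all
  note m = functor_C_amap(1)[OF M f] and n = functor_C_amap(1)[OF N f]
  have "compose (omap M (tgt L f)) (h (src L f)) (snd (snd (amap M f))) =
      compose (omap M (tgt L f)) (snd (snd (amap N f))) (h (tgt L f))"
    using nat[OF f] by (auto simp: compose_def fun_eq_iff)
  then have "cmp (set_cat \<kappa>) (omap M (src L f), omap N (src L f), h (src L f))
        (omap M (tgt L f), omap M (src L f), snd (snd (amap M f))) =
      cmp (set_cat \<kappa>) (omap N (tgt L f), omap N (src L f), snd (snd (amap N f)))
        (omap M (tgt L f), omap N (tgt L f), h (tgt L f))" by simp
  then show "cmp (set_cat \<kappa>) ((\<lambda>A \<in> S. (omap M A, omap N A, h A)) (tgt C f)) (amap M f) =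
      cmp (set_cat \<kappa>) (amap N f) ((\<lambda>A \<in> S. (omap M A, omap N A, h A)) (src C f))"
    using f by (simp flip: m n)
qed

lemma nat_trans_natural:
  assumes \<eta>: "nat_trans C (set_cat \<kappa>) M N \<eta>"
    and M: "is_functor C (set_cat \<kappa>) M" and N: "is_functor C (set_cat \<kappa>) N"
    and f: "f \<in> arr L" "src L f \<in> S" "tgt L f \<in> S" and x: "x \<in> omap M (tgt L f)"
  shows "snd (snd (\<eta> (src L f))) (snd (snd (amap M f)) x) = snd (snd (amap N f)) (snd (snd (\<eta> (tgt L f))) x)"
proof -
  note m = functor_C_amap(1)[OF M f] and n = functor_C_amap(1)[OF N f]
  have "cmp (set_cat \<kappa>) (\<eta> (src L f)) (amap M f) = cmp (set_cat \<kappa>) (amap N f) (\<eta> (tgt L f))"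
    using nat_transD(5)[OF \<eta>, of f] f by simp
  then have "cmp (set_cat \<kappa>) (omap M (src L f), omap N (src L f), snd (snd (\<eta> (src L f))))
        (omap M (tgt L f), omap M (src L f), snd (snd (amap M f))) =
      cmp (set_cat \<kappa>) (omap N (tgt L f), omap N (src L f), snd (snd (amap N f)))
        (omap M (tgt L f), omap N (tgt L f), snd (snd (\<eta> (tgt L f))))"
    using m n nat_trans_components(1)[OF \<eta> f(2)] nat_trans_components(1)[OF \<eta> f(3)] by metis
  then have "compose (omap M (tgt L f)) (snd (snd (\<eta> (src L f)))) (snd (snd (amap M f))) x =
      compose (omap M (tgt L f)) (snd (snd (amap N f))) (snd (snd (\<eta> (tgt L f)))) x" by simp
  then show ?thesis using x by (simp add: compose_def)
qed

section \<open>The nerve as a fully faithful and essentially surjective functor\<close>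

definition postcomp :: "'u \<Rightarrow> 'o \<Rightarrow> 'u \<Rightarrow> 'u" where
  "postcomp h A = (\<lambda>g \<in> hom L A (src L h). h \<cdot> g)"

lemma nerve_simps [simp]:
  "X \<in> obj L \<Longrightarrow> omap (nerve L S) X = nerve_obj L S X"
  "h \<in> arr L \<Longrightarrow> amap (nerve L S) h = (nerve_obj L S (src L h), nerve_obj L S (tgt L h),
     \<lambda>A \<in> S. (omap (nerve_obj L S (src L h)) A, omap (nerve_obj L S (tgt L h)) A, postcomp h A))"
  by (simp_all add: nerve_def postcomp_def cong: restrict_cong)

lemma functor_nerve: "is_functor L Models (nerve L S)"
  unfolding is_functor_def
proof (intro conjI ballI impI)
  have "omap (nerve L S) \<in> extensional (obj L)" "amap (nerve L S) \<in> extensional (arr L)" by (simp_all add: nerve_def)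
  moreover have "amap (nerve L S) h \<in> arr Models" if h: "h \<in> arr L" for h
  proof -
    have "nat_trans C (set_cat \<kappa>) (nerve_obj L S (src L h)) (nerve_obj L S (tgt L h))
      (\<lambda>A \<in> S. (omap (nerve_obj L S (src L h)) A, omap (nerve_obj L S (tgt L h)) A, postcomp h A))"
      using h by (intro nat_transI functor_nerve_obj) (auto simp: postcomp_def in_hom cmp_assoc)
    then show ?thesis using h by (simp add: model_nerve_obj)
  qed
  ultimately show "omap (nerve L S) \<in> obj L \<rightarrow>\<^sub>E obj Models" "amap (nerve L S) \<in> arr L \<rightarrow>\<^sub>E arr Models"
    by (simp_all add: PiE_iff model_nerve_obj del: nerve_simps(2))
  show "src Models (amap (nerve L S) h) = omap (nerve L S) (src L h)"
    "tgt Models (amap (nerve L S) h) = omap (nerve L S) (tgt L h)" if "h \<in> arr L" for h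
    using that by simp_all
  show "amap (nerve L S) (ide L X) = ide Models (omap (nerve L S) X)" if "X \<in> obj L" for X
    using that by (auto simp: postcomp_def fun_eq_iff in_hom)
  show "amap (nerve L S) (cmp L g f) = cmp Models (amap (nerve L S) g) (amap (nerve L S) f)"
    if "f \<in> arr L" "g \<in> arr L" "tgt L f = src L g" for f g
    using that by (auto simp: postcomp_def fun_eq_iff in_hom compose_def cmp_assoc)
qed

text \<open>The components of a transformation between nerves form a natural family on the arrows
  from \<open>S\<close> into \<open>X\<close>, to which \<open>S_dense\<close> applies.\<close>

lemma nerve_full:
  assumes XY: "X \<in> obj L" "Y \<in> obj L" and \<eta>: "nat_trans C (set_cat \<kappa>) (nerve_obj L S X) (nerve_obj L S Y) \<eta>"
  obtains h where "h \<in> arr L" "src L h = X" "tgt L h = Y" "amap (nerve L S) h = (nerve_obj L S X, nerve_obj L S Y, \<eta>)"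
proof -
  let ?h = "\<lambda>A. snd (snd (\<eta> A))"
  have mem: "?h A \<in> hom L A X \<rightarrow>\<^sub>E hom L A Y" if "A \<in> S" for A
    using nat_trans_components(2)[OF \<eta> that] that by simp
  obtain h where h: "h \<in> arr L" "src L h = X" "tgt L h = Y"
    "\<And>a. a \<in> arr L \<Longrightarrow> src L a \<in> S \<Longrightarrow> tgt L a = X \<Longrightarrow> h \<cdot> a = ?h (src L a) a"
  proof (rule S_dense[OF XY, of "\<lambda>a. ?h (src L a) a"])
    fix a assume a: "a \<in> arr L" "src L a \<in> S" "tgt L a = X"
    have "?h (src L a) a \<in> hom L (src L a) Y"
      by (rule PiE_mem[OF mem[OF a(2)]]) (use a in \<open>simp add: in_hom\<close>)
    then show "?h (src L a) a \<in> arr L \<and> src L (?h (src L a) a) = src L a \<and> tgt L (?h (src L a) a) = Y"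
      by (simp add: in_hom)
  next
    fix a f assume a: "a \<in> arr L" "f \<in> arr L" "tgt L a = X" "tgt L f = src L a" "src L a \<in> S" "src L f \<in> S"
    have aX: "a \<in> hom L (src L a) X" using a by (simp add: in_hom)
    have "?h (src L a) a \<in> hom L (src L a) Y" by (rule PiE_mem[OF mem[OF a(5)] aX])
    then show "?h (src L (a \<cdot> f)) (a \<cdot> f) = ?h (src L a) a \<cdot> f"
      using nat_trans_natural[OF \<eta> functor_nerve_obj[OF XY(1)] functor_nerve_obj[OF XY(2)] a(2,6), of a] a aX by simp
  qed (rule that, assumption+)
  have "\<eta> = (\<lambda>A \<in> S. (omap (nerve_obj L S X) A, omap (nerve_obj L S Y) A, postcomp h A))"
  proof (rule extensionalityI[of _ S])
    show "\<eta> \<in> extensional S" using nat_transD(1)[OF \<eta>] by simp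
    fix A assume A: "A \<in> S"
    have "?h A = postcomp h A"
    proof (rule extensionalityI[of _ "hom L A X"])
      show "?h A \<in> extensional (hom L A X)" using mem[OF A] by (simp add: PiE_iff)
      show "postcomp h A \<in> extensional (hom L A X)" using h(2) by (simp add: postcomp_def)
      show "?h A a = postcomp h A a" if "a \<in> hom L A X" for a
        using h(4)[of a] that A h(2) by (simp add: postcomp_def in_hom)
    qed
    then show "\<eta> A = (\<lambda>A \<in> S. (omap (nerve_obj L S X) A, omap (nerve_obj L S Y) A, postcomp h A)) A"
      using nat_trans_components(1)[OF \<eta> A] A by simp
  qed simp
  then show ?thesis using h by (intro that[of h]) simp_all
qed

lemma nerve_faithful:
  assumes fg: "f \<in> arr L" "g \<in> arr L" "src L f = src L g" "tgt L f = tgt L g"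
    and eq: "amap (nerve L S) f = amap (nerve L S) g"
  shows "f = g"
proof (rule S_separating)
  fix a assume a: "a \<in> arr L" "src L a \<in> S" "tgt L a = src L f"
  have "(\<lambda>A \<in> S. (omap (nerve_obj L S (src L f)) A, omap (nerve_obj L S (tgt L f)) A, postcomp f A)) =
      (\<lambda>A \<in> S. (omap (nerve_obj L S (src L g)) A, omap (nerve_obj L S (tgt L g)) A, postcomp g A))"
    using eq unfolding nerve_simps(2)[OF fg(1)] nerve_simps(2)[OF fg(2)] by (elim Pair_inject)
  from fun_cong[OF this, of "src L a"] have "postcomp f (src L a) a = postcomp g (src L a) a" using a(2) by simp
  then show "f \<cdot> a = g \<cdot> a" using a fg(3) by (simp add: postcomp_def in_hom)
qed (use fg in simp_all)

lemma nerve_ess_surj: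
  assumes M: "is_model \<kappa> (ext_clan L E S) M"
  shows "\<exists>Y \<in> obj L. isomorphic Models (nerve_obj L S Y) M"
proof -
  have fM: "is_functor C (set_cat \<kappa>) M" using M by (simp add: is_model_def)
  let ?m = "\<lambda>f. snd (snd (amap M f))"
  interpret M: model L \<kappa> E F S "omap M" ?m by (rule is_model_model[OF M])
  obtain Y \<tau> where Y: "Y \<in> obj L"
    and \<tau>: "\<And>a. a \<in> arr L \<Longrightarrow> src L a \<in> S \<Longrightarrow> tgt L a = Y \<Longrightarrow> \<tau> a \<in> omap M (src L a)"
    and nat: "\<And>a f. a \<in> arr L \<Longrightarrow> f \<in> arr L \<Longrightarrow> src L a \<in> S \<Longrightarrow> tgt L a = Y \<Longrightarrow> src L f \<in> S \<Longrightarrow> tgt L f = src L a \<Longrightarrow>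
      \<tau> (a \<cdot> f) = ?m f (\<tau> a)"
    and inj: "\<And>a b. a \<in> arr L \<Longrightarrow> b \<in> arr L \<Longrightarrow> src L a \<in> S \<Longrightarrow> src L b = src L a \<Longrightarrow> tgt L a = Y \<Longrightarrow> tgt L b = Y \<Longrightarrow>
      \<tau> a = \<tau> b \<Longrightarrow> a = b"
    and surj: "\<And>A x. A \<in> S \<Longrightarrow> x \<in> omap M A \<Longrightarrow> \<exists>a \<in> arr L. src L a = A \<and> tgt L a = Y \<and> \<tau> a = x"
    by (rule M.ex_representation) (rule that, assumption+)
  let ?N = "nerve_obj L S Y"
  define t where "t A = restrict \<tau> (hom L A Y)" for A
  \<comment> \<open>The inverse of \<tau>; injectivity of \<tau> makes the choice unique, so
    naturality passes from \<tau> to \<open>s\<close>.\<close>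
  define s where "s A = (\<lambda>x \<in> omap M A. SOME a. a \<in> hom L A Y \<and> \<tau> a = x)" for A
  have t: "t A \<in> hom L A Y \<rightarrow>\<^sub>E omap M A" if "A \<in> S" for A
    using \<tau> that by (auto simp: t_def in_hom)
  have s: "s A x \<in> hom L A Y" "\<tau> (s A x) = x" if x: "A \<in> S" "x \<in> omap M A" for A x
  proof -
    have "\<exists>a. a \<in> hom L A Y \<and> \<tau> a = x" using surj[OF x] by (auto simp: in_hom)
    from someI_ex[OF this] show "s A x \<in> hom L A Y" "\<tau> (s A x) = x" using x by (simp_all add: s_def)
  qed
  have sE: "s A \<in> omap M A \<rightarrow>\<^sub>E hom L A Y" if "A \<in> S" for A
    using s(1)[OF that] by (simp add: PiE_iff) (simp add: s_def)
  have st: "s A (\<tau> a) = a" if A: "A \<in> S" and a: "a \<in> hom L A Y" for A a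
  proof -
    have \<tau>a: "\<tau> a \<in> omap M A" using \<tau>[of a] a A by (simp add: in_hom)
    show ?thesis by (rule inj) (use s[OF A \<tau>a] a A in \<open>simp_all add: in_hom\<close>)
  qed
  define \<eta> where "\<eta> = (\<lambda>A \<in> S. (omap ?N A, omap M A, t A))"
  define \<theta> where "\<theta> = (\<lambda>A \<in> S. (omap M A, omap ?N A, s A))"
  have n\<eta>: "nat_trans C (set_cat \<kappa>) ?N M \<eta>"
    unfolding \<eta>_def
  proof (rule nat_transI[OF functor_nerve_obj[OF Y] fM])
    show "t A \<in> omap ?N A \<rightarrow>\<^sub>E omap M A" if "A \<in> S" for A using t[OF that] that by simp
    fix f a assume f: "f \<in> arr L" "src L f \<in> S" "tgt L f \<in> S" and a: "a \<in> omap ?N (tgt L f)"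
    then have a': "a \<in> arr L" "src L a = tgt L f" "tgt L a = Y" by (simp_all add: in_hom)
    have "\<tau> (a \<cdot> f) = ?m f (\<tau> a)" by (rule nat) (use f a' in simp_all)
    then show "t (src L f) (snd (snd (amap ?N f)) a) = ?m f (t (tgt L f) a)"
      using f a' by (simp add: t_def in_hom)
  qed
  have n\<theta>: "nat_trans C (set_cat \<kappa>) M ?N \<theta>"
    unfolding \<theta>_def
  proof (rule nat_transI[OF fM functor_nerve_obj[OF Y]])
    show "s A \<in> omap M A \<rightarrow>\<^sub>E omap ?N A" if "A \<in> S" for A using sE[OF that] that by simp
    fix f x assume f: "f \<in> arr L" "src L f \<in> S" "tgt L f \<in> S" and x: "x \<in> omap M (tgt L f)"
    note sx = s[OF f(3) x]
    have a: "s (tgt L f) x \<in> arr L" "src L (s (tgt L f) x) = tgt L f" "tgt L (s (tgt L f) x) = Y"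
      using sx(1) by (simp_all add: in_hom)
    have "\<tau> (s (tgt L f) x \<cdot> f) = ?m f (\<tau> (s (tgt L f) x))" by (rule nat) (use f a in simp_all)
    then have "s (src L f) (?m f x) = s (tgt L f) x \<cdot> f"
      using st[OF f(2), of "s (tgt L f) x \<cdot> f"] sx(2) a f by (simp add: in_hom)
    then show "s (src L f) (?m f x) = snd (snd (amap ?N f)) (s (tgt L f) x)" using f sx(1) by simp
  qed
  have N: "is_model \<kappa> (ext_clan L E S) ?N" by (rule model_nerve_obj[OF Y])
  have "compose (hom L A Y) (s A) (t A) = (\<lambda>a \<in> hom L A Y. a)" if "A \<in> S" for A
    using st[OF that] by (auto simp: compose_def t_def fun_eq_iff)
  then have 1: "cmp Models (M, ?N, \<theta>) (?N, M, \<eta>) = ide Models ?N"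
    by (auto simp: \<theta>_def \<eta>_def fun_eq_iff)
  have "compose (omap M A) (t A) (s A) = (\<lambda>x \<in> omap M A. x)" if "A \<in> S" for A
    using s[OF that] by (auto simp: compose_def t_def fun_eq_iff)
  then have 2: "cmp Models (?N, M, \<eta>) (M, ?N, \<theta>) = ide Models M"
    by (auto simp: \<theta>_def \<eta>_def fun_eq_iff)
  have "(?N, M, \<eta>) \<in> hom Models ?N M" "(M, ?N, \<theta>) \<in> hom Models M ?N"
    using M N n\<eta> n\<theta> by (simp_all add: hom_def)
  then have "isomorphic Models ?N M"
    unfolding isomorphic_def is_iso_def using 1 2 by (intro bexI[of _ "(?N, M, \<eta>)"]) (auto simp: hom_def)
  then show ?thesis using Y by blast
qed

theorem nerve_equivalence: "is_equivalence L Models (nerve L S)"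
proof (rule fully_faithful_ess_surj_equivalence[OF category_axioms category_Models functor_nerve])
  fix X Y g assume XY: "X \<in> obj L" "Y \<in> obj L" and g: "g \<in> arr Models" "src Models g = omap (nerve L S) X"
    "tgt Models g = omap (nerve L S) Y"
  obtain M N \<eta> where g': "g = (M, N, \<eta>)" by (cases g)
  have "M = nerve_obj L S X" "N = nerve_obj L S Y" "nat_trans C (set_cat \<kappa>) M N \<eta>" using g XY by (simp_all add: g')
  then show "\<exists>f. f \<in> arr L \<and> src L f = X \<and> tgt L f = Y \<and> amap (nerve L S) f = g"
    using nerve_full[OF XY, of \<eta>] g' by metis
next
  show "\<exists>X \<in> obj L. isomorphic Models (omap (nerve L S) X) M" if "M \<in> obj Models" for M
    using nerve_ess_surj[of M] that by auto
qed (rule nerve_faithful)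

end

theorem theorem6p18:
  fixes \<kappa> :: "'u rel" and L :: "('o, 'u) cat" and E F :: "'u set" and S :: "'o set"
  assumes "inaccessible \<kappa>"
    and "clan_algebraic \<kappa> L E F"
    and "small_replacement \<kappa> L (compact_0_exts \<kappa> L E) S"
  shows "is_equivalence L (Mod \<kappa> (ext_clan L E S)) (nerve L S)"
proof -
  have "category L"
    using assms(2) by (simp add: clan_algebraic_def EF_category_def locally_finitely_presentable_def)
  then interpret clan_algebraic_category L \<kappa> E F S
    using assms by (intro clan_algebraic_category.intro clan_algebraic_category_axioms.intro)
  show ?thesis by (rule nerve_equivalence)
qed

end
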